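(* Let $X$ be a locally finite CAT(0) cube complex with a cocompact cellular action of a group $G$. With $G_{xy}$ and $\bar c_{xy}$, $x,y\in Vert(X/G)$, as defined in the context, the finite square matrices $(G_{xy})$ and $(\bar c_{xy})$ indexed by $Vert(X/G)$ are inverses of each other: $$\sum_{y\in Vert(X/G)}\bar c_{xy}\,G_{yz}=\delta_{xz}\qquad\text{for all }x,z\in Vert(X/G).$$
   Context: $d(x,y)$ denotes the $\ell_1$-distance between vertices of $X$ (the edge-path distance in the 1-skeleton). Locally finite means each vertex lies in finitely many cubes; cocompact means $X/G$ is compact, so there are finitely many $G$-orbits of vertices. $\pi:X\to X/G$ is the projection, and $Vert(X/G)$ is the set of $G$-orbits of vertices. Orbit growth series: for vertices $x,y$ of $X$, $G_{xy}=\sum_{z\in Gy}t^{d(x,z)}\in\mathbb{Z}[[t]]$. It depends only on the $G$-orbits of $x$ and $y$, so it is defined for $x,y\in Vert(X/G)$. The $f$-polynomial of a finite simplicial complex $L$ is $f_L(t)=\sum_{\sigma\in L}t^{\dim\sigma+1}$, where $L$ includes the empty simplex of dimension $-1$. For vertices $x,y$ of $X$ contained in a common cube, $\Box_{xy}$ is the minimal cube containing both, and $f_{xy}$ is the $f$-polynomial of the link of $\Box_{xy}$, i.e. $f_{xy}(s)=\sum_{Q\supseteq\Box_{xy}}s^{\dim Q-\dim\Box_{xy}}$, the sum being over cubes $Q$ of $X$. If $x,y$ are not in a common cube, $f_{xy}=0$. For vertices $x,y$ of $X$ put $$c_{xy}=\left(\frac{-t}{1-t^2}\right)^{d(x,y)}f_{xy}\left(\frac{t^2}{1-t^2}\right).$$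 For $x,y\in Vert(X/G)$ pick $\bar x\in\pi^{-1}(x)$ and set $\bar c_{xy}=\sum_{\bar y\in\pi^{-1}(y)}c_{\bar x\bar y}$ (a sum over vertices with finitely many nonzero terms, independent of the choice of $\bar x$). Rational functions regular at $t=0$ are identified with their power series expansions at $0$. *)

theory Defs
  imports "HOL-Analysis.Analysis" "HOL-Algebra.Group_Action"
begin

section \<open>Cubical complexes\<close>

text \<open>A cubical complex is given by the family \<open>K\<close> of vertex sets of its cubes. The vertices of
  the standard cube \<open>[0,1]^n\<close> are written as subsets \<open>S\<close> of \<open>{..<n}\<close> (the coordinates equal to 1);
  its nonempty faces are then exactly the intervals \<open>{A..B}\<close> of the subset order. A chart
  identifies a cube, together with those members of \<open>K\<close> that it contains, with the standard cube
  and its faces.\<close>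

definition cube_chart :: "'v set set \<Rightarrow> nat \<Rightarrow> 'v set \<Rightarrow> ('v \<Rightarrow> nat set) \<Rightarrow> bool" where
  "cube_chart K n C \<phi> \<longleftrightarrow>
     bij_betw \<phi> C (Pow {..<n}) \<and>
     (\<lambda>D. \<phi> ` D) ` {D \<in> K. D \<subseteq> C} = {{A..B} | A B. A \<subseteq> B \<and> B \<subseteq> {..<n}}"

text \<open>This is the complex of Bridson and Haefliger (I.7.32): cubes are embedded, and two cubes that
  meet do so in a common face. (\<open>C \<inter> D \<in> K\<close> makes \<open>C \<inter> D\<close> a face of both \<open>C\<close> and \<open>D\<close>,
  because charts match the members of \<open>K\<close> inside a cube with its faces.)\<close>

definition cubical_complex :: "'v set set \<Rightarrow> bool" where
  "cubical_complex K \<longleftrightarrow>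
     (\<forall>C\<in>K. \<exists>n \<phi>. cube_chart K n C \<phi>) \<and>
     (\<forall>C\<in>K. \<forall>D\<in>K. C \<inter> D \<noteq> {} \<longrightarrow> C \<inter> D \<in> K)"

definition verts :: "'v set set \<Rightarrow> 'v set" where
  "verts K = \<Union>K"

definition cube_dim :: "'v set set \<Rightarrow> 'v set \<Rightarrow> nat" where
  "cube_dim K C = (THE n. \<exists>\<phi>. cube_chart K n C \<phi>)"

definition locally_finite_complex :: "'v set set \<Rightarrow> bool" where
  "locally_finite_complex K \<longleftrightarrow> (\<forall>v\<in>verts K. finite {C \<in> K. v \<in> C})"

definition edges :: "'v set set \<Rightarrow> ('v \<times> 'v) set" where
  "edges K = {(u, v). u \<noteq> v \<and> {u, v} \<in> K}"

definition vdist :: "'v set set \<Rightarrow> 'v \<Rightarrow> 'v \<Rightarrow> nat" where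
  "vdist K x y = (LEAST n. (x, y) \<in> edges K ^^ n)"


section \<open>The piecewise Euclidean realization\<close>

definition unit_cube :: "nat \<Rightarrow> (nat \<Rightarrow> real) set" where
  "unit_cube n = {x. \<forall>i<n. 0 \<le> x i \<and> x i \<le> 1}"

text \<open>The point with coordinates \<open>x\<close> in the cube \<open>C\<close> is encoded by its multilinear barycentric
  weights on the vertices: the weight of a vertex \<open>S\<close> of \<open>[0,1]^n\<close> is the product of the factors
  \<open>x i\<close> for \<open>i \<in> S\<close> and \<open>1 - x i\<close> for \<open>i \<notin> S\<close>. The coordinates are recovered as
  \<open>x i = (\<Sum>v | v \<in> C \<and> i \<in> \<phi> v. p v)\<close>, the weights do not depend on the chart, and on a common
  face of two cubes they agree; hence equality of weight functions is exactly the gluing of the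
  cubes along their common faces.\<close>

definition cube_point ::
    "nat \<Rightarrow> 'v set \<Rightarrow> ('v \<Rightarrow> nat set) \<Rightarrow> (nat \<Rightarrow> real) \<Rightarrow> 'v \<Rightarrow> real" where
  "cube_point n C \<phi> x =
     (\<lambda>v. if v \<in> C then (\<Prod>i<n. if i \<in> \<phi> v then x i else 1 - x i) else 0)"

definition realization :: "'v set set \<Rightarrow> ('v \<Rightarrow> real) set" where
  "realization K =
     {cube_point n C \<phi> x | n C \<phi> x. C \<in> K \<and> cube_chart K n C \<phi> \<and> x \<in> unit_cube n}"

text \<open>\<open>string_between K p q l\<close>: there is a finite sequence of points from \<open>p\<close> to \<open>q\<close>,
  consecutive ones lying in a common cube, whose Euclidean step lengths add up to \<open>l\<close>.\<close>

inductive string_between ::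
    "'v set set \<Rightarrow> ('v \<Rightarrow> real) \<Rightarrow> ('v \<Rightarrow> real) \<Rightarrow> real \<Rightarrow> bool" for K where
  refl: "p \<in> realization K \<Longrightarrow> string_between K p p 0"
| step: "\<lbrakk>C \<in> K; cube_chart K n C \<phi>; x \<in> unit_cube n; y \<in> unit_cube n;
          string_between K (cube_point n C \<phi> y) q l\<rbrakk>
         \<Longrightarrow> string_between K (cube_point n C \<phi> x) q (L2_set (\<lambda>i. x i - y i) {..<n} + l)"

text \<open>The value 0 outside the realization is only a convention: the library's \<open>Metric_space\<close>
  demands nonnegativity and symmetry on the whole type.\<close>

definition length_dist :: "'v set set \<Rightarrow> ('v \<Rightarrow> real) \<Rightarrow> ('v \<Rightarrow> real) \<Rightarrow> real" where
  "length_dist K p q =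
     (if p \<in> realization K \<and> q \<in> realization K then Inf {l. string_between K p q l} else 0)"


section \<open>CAT(0) spaces\<close>

text \<open>Geodesics are parametrized on \<open>{0..1}\<close> with constant speed.\<close>

definition geodesic_from_to ::
    "'a set \<Rightarrow> ('a \<Rightarrow> 'a \<Rightarrow> real) \<Rightarrow> (real \<Rightarrow> 'a) \<Rightarrow> 'a \<Rightarrow> 'a \<Rightarrow> bool" where
  "geodesic_from_to M d \<sigma> p q \<longleftrightarrow>
     \<sigma> ` {0..1} \<subseteq> M \<and> \<sigma> 0 = p \<and> \<sigma> 1 = q \<and>
     (\<forall>s\<in>{0..1}. \<forall>t\<in>{0..1}. d (\<sigma> s) (\<sigma> t) = \<bar>s - t\<bar> * d p q)"

text \<open>Points of a geodesic triangle are no farther apart than their comparison points in the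
  Euclidean plane. It is enough to compare points on two sides issuing from the same vertex \<open>p\<close>:
  any two sides share a vertex, and \<open>p\<close>, \<open>q\<close>, \<open>r\<close> are arbitrary.\<close>

definition CAT0_space :: "'a set \<Rightarrow> ('a \<Rightarrow> 'a \<Rightarrow> real) \<Rightarrow> bool" where
  "CAT0_space M d \<longleftrightarrow>
     Metric_space M d \<and>
     (\<forall>p\<in>M. \<forall>q\<in>M. \<exists>\<sigma>. geodesic_from_to M d \<sigma> p q) \<and>
     (\<forall>p\<in>M. \<forall>q\<in>M. \<forall>r\<in>M. \<forall>\<sigma> \<tau>.
        geodesic_from_to M d \<sigma> p q \<longrightarrow> geodesic_from_to M d \<tau> p r \<longrightarrow>
        (\<forall>p' q' r' :: real^2.
           dist p' q' = d p q \<longrightarrow> dist p' r' = d p r \<longrightarrow> dist q' r' = d q r \<longrightarrow>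
           (\<forall>s\<in>{0..1}. \<forall>t\<in>{0..1}.
              d (\<sigma> s) (\<tau> t) \<le> dist (p' + s *\<^sub>R (q' - p')) (p' + t *\<^sub>R (r' - p')))))"

definition CAT0_cubical_complex :: "'v set set \<Rightarrow> bool" where
  "CAT0_cubical_complex K \<longleftrightarrow>
     cubical_complex K \<and>
     (\<forall>p\<in>realization K. \<forall>q\<in>realization K. \<exists>l. string_between K p q l) \<and>
     CAT0_space (realization K) (length_dist K)"


section \<open>Cellular actions\<close>

text \<open>A cellular action is determined by its effect on vertices; it extends to the realization
  affinely on each cube, by transporting weights.\<close>

definition cellular_action ::
    "('g, 'm) monoid_scheme \<Rightarrow> 'v set set \<Rightarrow> ('g \<Rightarrow> 'v \<Rightarrow> 'v) \<Rightarrow> bool" where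
  "cellular_action G K \<phi> \<longleftrightarrow>
     group_action G (verts K) \<phi> \<and> (\<forall>g\<in>carrier G. \<forall>C\<in>K. \<phi> g ` C \<in> K)"

definition point_action ::
    "('g, 'm) monoid_scheme \<Rightarrow> 'v set set \<Rightarrow> ('g \<Rightarrow> 'v \<Rightarrow> 'v) \<Rightarrow>
      'g \<Rightarrow> ('v \<Rightarrow> real) \<Rightarrow> 'v \<Rightarrow> real" where
  "point_action G K \<phi> g p = (\<lambda>v. if v \<in> verts K then p (\<phi> (inv\<^bsub>G\<^esub> g) v) else 0)"

text \<open>The quotient topology on the set of orbits is the unique topology \<open>Y\<close> making the orbit map a
  quotient map.\<close>

definition cocompact_action ::
    "('g, 'm) monoid_scheme \<Rightarrow> 'v set set \<Rightarrow> ('g \<Rightarrow> 'v \<Rightarrow> 'v) \<Rightarrow> bool" where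
  "cocompact_action G K \<phi> \<longleftrightarrow>
     (\<exists>Y. quotient_map (Metric_space.mtopology (realization K) (length_dist K)) Y
            (orbit G (point_action G K \<phi>)) \<and>
          compact_space Y)"

definition vert_orbits ::
    "('g, 'm) monoid_scheme \<Rightarrow> 'v set set \<Rightarrow> ('g \<Rightarrow> 'v \<Rightarrow> 'v) \<Rightarrow> 'v set set" where
  "vert_orbits G K \<phi> = orbits G (verts K) \<phi>"

definition orbit_rep :: "'v set \<Rightarrow> 'v" where
  "orbit_rep x = (SOME v. v \<in> x)"


section \<open>The two matrices\<close>

definition growth_series ::
    "('g, 'm) monoid_scheme \<Rightarrow> 'v set set \<Rightarrow> ('g \<Rightarrow> 'v \<Rightarrow> 'v) \<Rightarrow> 'v \<Rightarrow> 'v \<Rightarrow> rat fps" where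
  "growth_series G K \<phi> x y =
     Abs_fps (\<lambda>n. of_nat (card {z \<in> orbit G \<phi> y. vdist K x z = n}))"

definition orbit_growth_series ::
    "('g, 'm) monoid_scheme \<Rightarrow> 'v set set \<Rightarrow> ('g \<Rightarrow> 'v \<Rightarrow> 'v) \<Rightarrow> 'v set \<Rightarrow> 'v set \<Rightarrow> rat fps" where
  "orbit_growth_series G K \<phi> x y = growth_series G K \<phi> (orbit_rep x) (orbit_rep y)"

definition in_common_cube :: "'v set set \<Rightarrow> 'v \<Rightarrow> 'v \<Rightarrow> bool" where
  "in_common_cube K x y \<longleftrightarrow> (\<exists>C\<in>K. x \<in> C \<and> y \<in> C)"

definition min_cube :: "'v set set \<Rightarrow> 'v \<Rightarrow> 'v \<Rightarrow> 'v set" where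
  "min_cube K x y = \<Inter>{C \<in> K. x \<in> C \<and> y \<in> C}"

definition link_f :: "'v set set \<Rightarrow> 'v \<Rightarrow> 'v \<Rightarrow> 'r::comm_ring_1 \<Rightarrow> 'r" where
  "link_f K x y s =
     (if in_common_cube K x y
      then (\<Sum>Q | Q \<in> K \<and> min_cube K x y \<subseteq> Q. s ^ (cube_dim K Q - cube_dim K (min_cube K x y)))
      else 0)"

text \<open>The denominators have constant term 1, so the quotients below are the expansions at 0 of the
  corresponding rational functions.\<close>

definition c_coeff :: "'v set set \<Rightarrow> 'v \<Rightarrow> 'v \<Rightarrow> rat fps" where
  "c_coeff K x y =
     (- fps_X / (1 - fps_X\<^sup>2)) ^ vdist K x y * link_f K x y (fps_X\<^sup>2 / (1 - fps_X\<^sup>2))"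

text \<open>An orbit may be infinite, so the sum is taken over its nonzero terms.\<close>

definition c_bar :: "'v set set \<Rightarrow> 'v set \<Rightarrow> 'v set \<Rightarrow> rat fps" where
  "c_bar K x y =
     (\<Sum>y' | y' \<in> y \<and> c_coeff K (orbit_rep x) y' \<noteq> 0. c_coeff K (orbit_rep x) y')"

end

theory Submission
  imports Defs
begin

text \<open>The identity reduces to \<open>(\<Sum>y. c x y * t ^ d y z) = (if x = z then 1 else 0)\<close> for vertices \<open>x\<close>
  and \<open>z\<close>. By the definition of \<open>c\<close>, the left side is a sum over pairs of a cube \<open>Q\<close> containing \<open>x\<close>
  and a corner \<open>y\<close> of \<open>Q\<close>. On \<open>Q\<close> each edge direction at \<open>x\<close> changes the distance to \<open>z\<close> by a fixed
  sign, so the sum over the corners of \<open>Q\<close> factors. It vanishes unless all directions of \<open>Q\<close> at \<open>x\<close>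
  lead towards \<open>z\<close>, in which case it is \<open>(- 1) ^ dim Q * t ^ d x z\<close>. The neighbours of \<open>x\<close> that are
  closer to \<open>z\<close> span a cube together with \<open>x\<close>, so what remains is an alternating sum over the subsets
  of a finite set that is empty only for \<open>x = z\<close>.

  The combinatorial facts used here are the flag condition and the quadrangle condition: two
  neighbours of \<open>x\<close> closer to \<open>z\<close> span a square whose fourth vertex is closer still. The flag
  condition follows from the median inequality because coordinates at a vertex do not expand
  distances. Sliding along geodesics to a fixed vertex shows that a local system on the edges without
  monodromy around squares has sections. The reduced edge paths from \<open>z\<close>, up to exchanging two sides of
  a square for the other two, form such a local system by the flag condition. Its section shows
  that shortest edge paths with the same ends differ by exchanges, whence the quadrangle condition.\<close>

section \<open>Cubes seen from a corner\<close>

text \<open>The metric is only an infimum over strings of steps inside cubes, so distances can be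
  computed only in the open star of a vertex, which a short string starting there cannot leave. All
  metric arguments are therefore local, the constants 1/2, 1/3 and 1/6 are measured against such
  stars, and cubes are described from a corner. The identity, on the other hand, concerns edge-path
  distance, whose shortest paths need not lie near geodesics. The only global information taken from
  the metric is that values can be transported along geodesics; this plays the part of simple
  connectivity. The fineness of the subdivision depends on the length of the geodesics, so sections
  are obtained on balls of arbitrary radius. The weights in \<open>c\<close> solve two linear
  equations. Let a direction of a cube have weight a if it is crossed between x and y, and b if it
  is not. Then a * t + b = 0 cancels a direction leading away from z, and a + b * t = - t leaves
  only a sign and a power of t for one leading towards z.\<close>

definition nbc :: "'v set set \<Rightarrow> 'v \<Rightarrow> 'v set \<Rightarrow> 'v set" where
  "nbc K v C = {u \<in> C. (v, u) \<in> edges K}"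

text \<open>These are the coordinates of \<open>w\<close> with respect to \<open>v\<close>, a coordinate direction at \<open>v\<close> being
  given by a neighbour of \<open>v\<close>. They are the same in every cube containing \<open>v\<close> and \<open>w\<close>.\<close>

definition lab :: "'v set set \<Rightarrow> 'v \<Rightarrow> 'v \<Rightarrow> 'v set" where
  "lab K v w = nbc K v (min_cube K v w)"

definition sq :: "'v set set \<Rightarrow> 'v \<Rightarrow> 'v \<Rightarrow> 'v \<Rightarrow> 'v \<Rightarrow> bool" where
  "sq K x u y w \<longleftrightarrow> {x, u, y, w} \<in> K \<and> (x, u) \<in> edges K \<and> (u, y) \<in> edges K \<and>
     (y, w) \<in> edges K \<and> (w, x) \<in> edges K \<and> x \<noteq> y \<and> u \<noteq> w"

lemma edges_sym: "(u, v) \<in> edges K \<Longrightarrow> (v, u) \<in> edges K"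
  by (auto simp: edges_def insert_commute)

lemma edges_neq: "(u, v) \<in> edges K \<Longrightarrow> u \<noteq> v"
  by (auto simp: edges_def)

lemma edges_verts: "(u, v) \<in> edges K \<Longrightarrow> u \<in> verts K \<and> v \<in> verts K"
  by (auto simp: edges_def verts_def)

lemma sq_rotate: "sq K x u y w \<Longrightarrow> sq K u y w x"
  unfolding sq_def by (auto simp: insert_commute dest: edges_sym)

lemma sq_flip: "sq K x u y w \<Longrightarrow> sq K x w y u"
  unfolding sq_def by (auto simp: insert_commute dest: edges_sym)

lemma min_cube_subset: "C \<in> K \<Longrightarrow> x \<in> C \<Longrightarrow> y \<in> C \<Longrightarrow> min_cube K x y \<subseteq> C"
  unfolding min_cube_def by auto

lemma mem_min_cube: "x \<in> min_cube K x y" "y \<in> min_cube K x y"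
  unfolding min_cube_def by auto

section \<open>Faces and edges in a single chart\<close>

context
  fixes K :: "'v set set" and n C \<phi>
  assumes chart: "cube_chart K n C \<phi>"
begin

lemma chart_bij: "bij_betw \<phi> C (Pow {..<n})"
  using chart by (simp add: cube_chart_def)

lemma chart_inj: "inj_on \<phi> C"
  using chart_bij by (simp add: bij_betw_def)

lemma chart_sub: "w \<in> C \<Longrightarrow> \<phi> w \<subseteq> {..<n}"
  using chart_bij by (auto simp: bij_betw_def)

lemma chart_ex: "A \<subseteq> {..<n} \<Longrightarrow> \<exists>w\<in>C. \<phi> w = A"
  using bij_betw_imp_surj_on[OF chart_bij] by (metis PowI imageE)

lemma chart_card: "card C = 2 ^ n"
  using bij_betw_same_card[OF chart_bij] by (simp add: card_Pow)

lemma chart_finite: "finite C"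
  using bij_betw_finite[OF chart_bij] by simp

lemma chart_face:
  assumes "D \<in> K" "D \<subseteq> C"
  obtains A B where "A \<subseteq> B" "B \<subseteq> {..<n}" "D = {w \<in> C. A \<subseteq> \<phi> w \<and> \<phi> w \<subseteq> B}"
proof -
  have "\<phi> ` D \<in> {{A..B} | A B. A \<subseteq> B \<and> B \<subseteq> {..<n}}"
    using chart assms unfolding cube_chart_def by blast
  then obtain A B where AB: "A \<subseteq> B" "B \<subseteq> {..<n}" "\<phi> ` D = {A..B}" by auto
  have "D = {w \<in> C. \<phi> w \<in> \<phi> ` D}"
    using assms(2) chart_inj by (auto simp: inj_on_def)
  then have "D = {w \<in> C. A \<subseteq> \<phi> w \<and> \<phi> w \<subseteq> B}" unfolding AB by simp
  with AB show ?thesis using that by blast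
qed

lemma chart_interval:
  assumes "A \<subseteq> B" "B \<subseteq> {..<n}"
  shows "{w \<in> C. A \<subseteq> \<phi> w \<and> \<phi> w \<subseteq> B} \<in> K"
proof -
  have "{A..B} \<in> (\<lambda>D. \<phi> ` D) ` {D \<in> K. D \<subseteq> C}"
    using chart assms unfolding cube_chart_def by blast
  then obtain D where D: "D \<in> K" "D \<subseteq> C" "\<phi> ` D = {A..B}" by auto
  have "D = {w \<in> C. \<phi> w \<in> \<phi> ` D}"
    using D(2) chart_inj by (auto simp: inj_on_def)
  then have "D = {w \<in> C. A \<subseteq> \<phi> w \<and> \<phi> w \<subseteq> B}" unfolding D by simp
  with D show ?thesis by simp
qed

lemma chart_eqI: "a \<in> C \<Longrightarrow> b \<in> C \<Longrightarrow> \<phi> a = \<phi> b \<Longrightarrow> a = b"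
  using chart_inj by (auto simp: inj_on_def)

lemma chart_edge1:
  assumes ab: "a \<in> C" "b \<in> C" and i: "i \<notin> \<phi> a" "\<phi> b = insert i (\<phi> a)"
  shows "(a, b) \<in> edges K"
proof -
  have "{w \<in> C. \<phi> a \<subseteq> \<phi> w \<and> \<phi> w \<subseteq> \<phi> b} = {a, b}"
  proof -
    have "\<phi> w = \<phi> a \<or> \<phi> w = \<phi> b" if "\<phi> a \<subseteq> \<phi> w" "\<phi> w \<subseteq> \<phi> b" for w
      using that i by (cases "i \<in> \<phi> w") auto
    then have "w = a \<or> w = b" if "w \<in> C" "\<phi> a \<subseteq> \<phi> w" "\<phi> w \<subseteq> \<phi> b" for w
      using chart_eqI[OF that(1)] ab that by metis
    then show ?thesis using ab i by auto
  qed
  moreover have "{w \<in> C. \<phi> a \<subseteq> \<phi> w \<and> \<phi> w \<subseteq> \<phi> b} \<in> K"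
    using chart_interval[of "\<phi> a" "\<phi> b"] chart_sub ab i by blast
  ultimately show ?thesis using i unfolding edges_def by auto
qed

lemma chart_edge:
  assumes ab: "a \<in> C" "b \<in> C"
  shows "(a, b) \<in> edges K \<longleftrightarrow> (\<exists>i<n. \<phi> b = sym_diff (\<phi> a) {i})"
proof
  assume e: "(a, b) \<in> edges K"
  then have K: "{a, b} \<in> K" and ne: "a \<noteq> b" by (auto simp: edges_def)
  obtain A B where AB: "A \<subseteq> B" "B \<subseteq> {..<n}" "{a, b} = {w \<in> C. A \<subseteq> \<phi> w \<and> \<phi> w \<subseteq> B}"
    using chart_face[OF K] ab by blast
  have only: "w = a \<or> w = b" if "w \<in> C" "A \<subseteq> \<phi> w" "\<phi> w \<subseteq> B" for w
    using AB that by blast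
  have "A \<subseteq> \<phi> a" "\<phi> a \<subseteq> B" "A \<subseteq> \<phi> b" "\<phi> b \<subseteq> B" using AB(3) by auto
  moreover have "\<phi> a \<noteq> \<phi> b" using ne ab chart_eqI by blast
  ultimately obtain i where i: "i \<in> B" "i \<notin> A" by blast
  have iB: "insert i A \<subseteq> {..<n}" using i AB by auto
  obtain wA where wA: "wA \<in> C" "\<phi> wA = A" using chart_ex AB by (meson subset_trans)
  obtain wi where wi: "wi \<in> C" "\<phi> wi = insert i A" using chart_ex iB by blast
  have "wA \<noteq> wi" using wA wi i by auto
  moreover have "wA \<in> {a, b}" "wi \<in> {a, b}" using only[of wA] only[of wi] wA wi i AB by auto
  ultimately have "(wA = a \<and> wi = b) \<or> (wA = b \<and> wi = a)" by auto
  then have "\<phi> b = sym_diff (\<phi> a) {i}" using wA wi i by auto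
  then show "\<exists>i<n. \<phi> b = sym_diff (\<phi> a) {i}" using i AB by auto
next
  assume "\<exists>i<n. \<phi> b = sym_diff (\<phi> a) {i}"
  then obtain i where i: "i < n" "\<phi> b = sym_diff (\<phi> a) {i}" by auto
  show "(a, b) \<in> edges K"
  proof (cases "i \<in> \<phi> a")
    case True
    then have "i \<notin> \<phi> b" "\<phi> a = insert i (\<phi> b)" using i by auto
    then show ?thesis using chart_edge1 ab edges_sym by metis
  next
    case False
    then have "\<phi> b = insert i (\<phi> a)" using i by auto
    then show ?thesis using chart_edge1 ab False by metis
  qed
qed

end

lemma set_between_doubleton:
  assumes "A \<subseteq> W" "W \<subseteq> insert i (insert j A)"
  shows "W = A \<or> W = insert i A \<or> W = insert i (insert j A) \<or> W = insert j A"
proof -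
  have "W = A \<union> (W \<inter> {i, j})" using assms by blast
  then show ?thesis by (cases "i \<in> W"; cases "j \<in> W") auto
qed

lemma inj_on_image_sym_diff:
  assumes "inj_on f S" "X \<subseteq> S" "Y \<subseteq> S"
  shows "f ` sym_diff X Y = sym_diff (f ` X) (f ` Y)"
proof -
  have "f ` (X - Y) = f ` X - f ` Y" "f ` (Y - X) = f ` Y - f ` X"
    using assms by (auto intro!: inj_on_image_set_diff[OF assms(1)])
  then show ?thesis by (simp add: image_Un)
qed

lemma sym_diff_eq_iff: "sym_diff M B = sym_diff (sym_diff M A) I \<longleftrightarrow> B = sym_diff A I"
  unfolding set_eq_iff by (rule arg_cong[where f = All], rule ext, auto)

lemma sym_diff_cancel: "sym_diff A (sym_diff A B) = B"
  by auto

section \<open>Cubes described by the neighbours of a corner\<close>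

locale cubical =
  fixes K :: "'v set set"
  assumes cubical: "cubical_complex K"
begin

abbreviation "E \<equiv> edges K"
abbreviation "mc \<equiv> min_cube K"

lemma chartE:
  assumes "C \<in> K" obtains n \<phi> where "cube_chart K n C \<phi>"
  using assms cubical unfolding cubical_complex_def by blast

lemma cube_Int: "C \<in> K \<Longrightarrow> D \<in> K \<Longrightarrow> x \<in> C \<Longrightarrow> x \<in> D \<Longrightarrow> C \<inter> D \<in> K"
  using cubical unfolding cubical_complex_def by blast

lemma cube_finite: "C \<in> K \<Longrightarrow> finite C"
  using chartE chart_finite by metis

lemma cube_nonempty: "C \<in> K \<Longrightarrow> C \<noteq> {}"
  using chartE chart_card by (metis card.empty power_not_zero zero_neq_numeral)

text \<open>Any cube through \<open>a\<close> and \<open>b\<close> meets \<open>C\<close> in a face.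
  A face is an interval of the subset order, so it contains everything between
  \<open>\<phi> a\<close> and \<open>\<phi> b\<close>. Hence the intersection over all cubes can be
  read off in one chart.\<close>

lemma chart_min_cube:
  assumes c: "cube_chart K n C \<phi>" "C \<in> K" and ab: "a \<in> C" "b \<in> C"
  shows "mc a b = {w \<in> C. \<phi> a \<inter> \<phi> b \<subseteq> \<phi> w \<and> \<phi> w \<subseteq> \<phi> a \<union> \<phi> b}" (is "_ = ?I")
proof
  have "?I \<in> K" using chart_interval[OF c(1), of "\<phi> a \<inter> \<phi> b" "\<phi> a \<union> \<phi> b"] chart_sub[OF c(1)] ab by blast
  then show "mc a b \<subseteq> ?I" using min_cube_subset[of ?I K a b] ab by blast
  show "?I \<subseteq> mc a b" unfolding min_cube_def
  proof safe
    fix w D assume w: "w \<in> C" "\<phi> a \<inter> \<phi> b \<subseteq> \<phi> w" "\<phi> w \<subseteq> \<phi> a \<union> \<phi> b" and D: "D \<in> K" "a \<in> D" "b \<in> D"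
    have "C \<inter> D \<in> K" using cube_Int c(2) D ab by blast
    then obtain A B where AB: "C \<inter> D = {w \<in> C. A \<subseteq> \<phi> w \<and> \<phi> w \<subseteq> B}"
      by (rule chart_face[OF c(1) _ Int_lower1])
    have "a \<in> C \<inter> D" "b \<in> C \<inter> D" using ab D by auto
    then have "A \<subseteq> \<phi> a" "\<phi> a \<subseteq> B" "A \<subseteq> \<phi> b" "\<phi> b \<subseteq> B" unfolding AB by auto
    then have "w \<in> C \<inter> D" unfolding AB using w by blast
    then show "w \<in> D" by blast
  qed
qed

lemma min_cube_in: "C \<in> K \<Longrightarrow> a \<in> C \<Longrightarrow> b \<in> C \<Longrightarrow> mc a b \<in> K"
proof -
  assume C: "C \<in> K" "a \<in> C" "b \<in> C"
  obtain n \<phi> where c: "cube_chart K n C \<phi>" using chartE C by blast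
  show ?thesis unfolding chart_min_cube[OF c C]
    using chart_interval[OF c, of "\<phi> a \<inter> \<phi> b" "\<phi> a \<union> \<phi> b"] chart_sub[OF c] C by blast
qed

text \<open>\<open>\<beta> i\<close> is the corner of \<open>C\<close> reached from \<open>v\<close>
  by changing coordinate \<open>i\<close>. Up to this renaming of coordinates, labels are the chart
  shifted so that \<open>v\<close> becomes the origin.\<close>

lemma chart_lab:
  assumes c: "cube_chart K n C \<phi>" "C \<in> K" and v: "v \<in> C"
  obtains \<beta> where "bij_betw \<beta> {..<n} (nbc K v C)"
    "\<And>w. w \<in> C \<Longrightarrow> lab K v w = \<beta> ` sym_diff (\<phi> v) (\<phi> w)"
    "\<And>i. i < n \<Longrightarrow> \<beta> i \<in> C \<and> \<phi> (\<beta> i) = sym_diff (\<phi> v) {i}"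
proof -
  define \<beta> where "\<beta> i = inv_into C \<phi> (sym_diff (\<phi> v) {i})" for i
  have \<beta>: "\<beta> i \<in> C \<and> \<phi> (\<beta> i) = sym_diff (\<phi> v) {i}" if "i < n" for i
  proof -
    have "sym_diff (\<phi> v) {i} \<in> \<phi> ` C"
      using chart_ex[OF c(1), of "sym_diff (\<phi> v) {i}"] chart_sub[OF c(1) v] that by auto
    then show ?thesis unfolding \<beta>_def by (simp add: f_inv_into_f inv_into_into)
  qed
  have inj: "inj_on \<beta> {..<n}"
  proof (rule inj_onI)
    fix i j assume ij: "i \<in> {..<n}" "j \<in> {..<n}" "\<beta> i = \<beta> j"
    then have "sym_diff (\<phi> v) {i} = sym_diff (\<phi> v) {j}" using \<beta> by (metis lessThan_iff)
    then have "sym_diff (\<phi> v) (sym_diff (\<phi> v) {i}) = sym_diff (\<phi> v) (sym_diff (\<phi> v) {j})" by (rule arg_cong)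
    then show "i = j" unfolding sym_diff_cancel by simp
  qed
  have nb: "u \<in> C \<and> (v, u) \<in> E \<longleftrightarrow> (\<exists>i<n. u = \<beta> i)" for u
    using chart_edge[OF c(1) v] \<beta> chart_eqI[OF c(1)] by metis
  have "\<beta> ` {..<n} = nbc K v C" unfolding nbc_def using nb by auto
  then have 1: "bij_betw \<beta> {..<n} (nbc K v C)" using inj by (simp add: bij_betw_def)
  have 2: "lab K v w = \<beta> ` sym_diff (\<phi> v) (\<phi> w)" if w: "w \<in> C" for w
  proof -
    have sub: "sym_diff (\<phi> v) (\<phi> w) \<subseteq> {..<n}" using chart_sub[OF c(1)] v w by blast
    have "u \<in> lab K v w \<longleftrightarrow> (\<exists>i\<in>sym_diff (\<phi> v) (\<phi> w). u = \<beta> i)" for u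
    proof
      assume "u \<in> lab K v w"
      then have u: "u \<in> C" "(v, u) \<in> E" "\<phi> v \<inter> \<phi> w \<subseteq> \<phi> u" "\<phi> u \<subseteq> \<phi> v \<union> \<phi> w"
        unfolding lab_def nbc_def chart_min_cube[OF c v w] by auto
      then obtain i where i: "i < n" "u = \<beta> i" using nb by blast
      then have "i \<in> sym_diff (\<phi> v) (\<phi> w)" using u \<beta>[OF i(1)] by auto
      then show "\<exists>i\<in>sym_diff (\<phi> v) (\<phi> w). u = \<beta> i" using i by blast
    next
      assume "\<exists>i\<in>sym_diff (\<phi> v) (\<phi> w). u = \<beta> i"
      then obtain i where i: "i \<in> sym_diff (\<phi> v) (\<phi> w)" "u = \<beta> i" by blast
      then have n: "i < n" using sub by blast
      then have "u \<in> C \<and> (v, u) \<in> E" using nb i by blast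
      then show "u \<in> lab K v w" unfolding lab_def nbc_def chart_min_cube[OF c v w]
        using \<beta>[OF n] i by auto
    qed
    then show ?thesis by blast
  qed
  show ?thesis using that 1 2 \<beta> by blast
qed

lemma nbc_finite: "C \<in> K \<Longrightarrow> finite (nbc K v C)"
  using cube_finite unfolding nbc_def by simp

lemma lab_bij:
  assumes C: "C \<in> K" "v \<in> C"
  shows "bij_betw (lab K v) C (Pow (nbc K v C))"
proof -
  obtain n \<phi> where c: "cube_chart K n C \<phi>" using chartE C by blast
  obtain \<beta> where b: "bij_betw \<beta> {..<n} (nbc K v C)"
    "\<And>w. w \<in> C \<Longrightarrow> lab K v w = \<beta> ` sym_diff (\<phi> v) (\<phi> w)" using chart_lab[OF c C] by metis
  have vn: "\<phi> v \<subseteq> {..<n}" using chart_sub[OF c C(2)] .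
  have 1: "bij_betw (sym_diff (\<phi> v)) (Pow {..<n}) (Pow {..<n})"
    by (rule bij_betw_byWitness[where f' = "sym_diff (\<phi> v)"])
      (simp_all only: sym_diff_cancel, simp_all, (use vn in blast)+)
  have 2: "bij_betw (image \<beta>) (Pow {..<n}) (Pow (nbc K v C))" using bij_betw_Pow[OF b(1)] .
  have "bij_betw (image \<beta> \<circ> (sym_diff (\<phi> v) \<circ> \<phi>)) C (Pow (nbc K v C))"
    by (rule bij_betw_trans[OF bij_betw_trans[OF chart_bij[OF c] 1] 2])
  moreover have "lab K v w = (image \<beta> \<circ> (sym_diff (\<phi> v) \<circ> \<phi>)) w" if "w \<in> C" for w
    using b(2)[OF that] by simp
  ultimately show ?thesis using bij_betw_cong by blast
qed

lemma lab_self: "v \<in> verts K \<Longrightarrow> lab K v v = {}"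
proof -
  assume "v \<in> verts K"
  then obtain C where C: "C \<in> K" "v \<in> C" unfolding verts_def by auto
  obtain n \<phi> where c: "cube_chart K n C \<phi>" using chartE C by blast
  obtain \<beta> where b: "\<And>w. w \<in> C \<Longrightarrow> lab K v w = \<beta> ` sym_diff (\<phi> v) (\<phi> w)" using chart_lab[OF c C] by metis
  show ?thesis using b[OF C(2)] by simp
qed

lemma lab_subset: "C \<in> K \<Longrightarrow> v \<in> C \<Longrightarrow> w \<in> C \<Longrightarrow> lab K v w \<subseteq> nbc K v C"
  using bij_betw_apply[OF lab_bij, of C v w] by simp

lemma lab_inj: "C \<in> K \<Longrightarrow> v \<in> C \<Longrightarrow> a \<in> C \<Longrightarrow> b \<in> C \<Longrightarrow> lab K v a = lab K v b \<Longrightarrow> a = b"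
  using bij_betw_imp_inj_on[OF lab_bij, of C v] by (simp add: inj_on_eq_iff)

lemma lab_ex: "C \<in> K \<Longrightarrow> v \<in> C \<Longrightarrow> A \<subseteq> nbc K v C \<Longrightarrow> \<exists>w\<in>C. lab K v w = A"
  using bij_betw_imp_surj_on[OF lab_bij, of C v] by (metis PowI imageE)

lemma lab_card: "C \<in> K \<Longrightarrow> v \<in> C \<Longrightarrow> card C = 2 ^ card (nbc K v C)"
  using bij_betw_same_card[OF lab_bij, of C v] card_Pow[OF nbc_finite, of C v] by simp

text \<open>The definite description in \<open>cube_dim\<close> is meaningful because a chart of
  dimension n forces 2 ^ n corners.\<close>

lemma cube_dim_eq: "C \<in> K \<Longrightarrow> v \<in> C \<Longrightarrow> cube_dim K C = card (nbc K v C)"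
proof -
  assume C: "C \<in> K" "v \<in> C"
  obtain n \<phi> where c: "cube_chart K n C \<phi>" using chartE C by blast
  have eq: "m = card (nbc K v C)" if "cube_chart K m C \<psi>" for m \<psi>
    using chart_card[OF that] lab_card[OF C] by simp
  show ?thesis unfolding cube_dim_def using c eq by blast
qed

lemma lab_interval:
  assumes C: "C \<in> K" "v \<in> C" and AB: "A \<subseteq> B" "B \<subseteq> nbc K v C"
  shows "{w \<in> C. A \<subseteq> lab K v w \<and> lab K v w \<subseteq> B} \<in> K"
proof -
  obtain n \<phi> where c: "cube_chart K n C \<phi>" using chartE C by blast
  obtain \<beta> where b: "bij_betw \<beta> {..<n} (nbc K v C)"
    "\<And>w. w \<in> C \<Longrightarrow> lab K v w = \<beta> ` sym_diff (\<phi> v) (\<phi> w)" using chart_lab[OF c C] by metis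
  have vn: "\<phi> v \<subseteq> {..<n}" using chart_sub[OF c C(2)] .
  define A' where "A' = {i. i < n \<and> \<beta> i \<in> A}"
  define B' where "B' = {i. i < n \<and> \<beta> i \<in> B}"
  have inj: "inj_on \<beta> {..<n}" and im: "\<beta> ` {..<n} = nbc K v C" using b by (auto simp: bij_betw_def)
  have "S = \<beta> ` {i. i < n \<and> \<beta> i \<in> S}" if "S \<subseteq> nbc K v C" for S
    using that unfolding im[symmetric] by blast
  then have A: "A = \<beta> ` A'" "B = \<beta> ` B'" using AB unfolding A'_def B'_def by auto
  define M where "M = \<phi> v"
  \<comment> \<open>Recentring at \<open>v\<close> exchanges 0 and 1 on the coordinates in
    \<open>M\<close>: those in \<open>A'\<close> must differ from \<open>v\<close>, those outside
    \<open>B'\<close> must agree with it, and those in \<open>B' - A'\<close> are free.\<close>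
  have "{w \<in> C. A \<subseteq> lab K v w \<and> lab K v w \<subseteq> B} =
    {w \<in> C. (A' - M) \<union> (M - B') \<subseteq> \<phi> w \<and> \<phi> w \<subseteq> (A' - M) \<union> (B' - A') \<union> (M - A')}"
  proof (rule Collect_cong, rule conj_cong[OF HOL.refl])
    fix w assume w: "w \<in> C"
    then have wn: "\<phi> w \<subseteq> {..<n}" using chart_sub[OF c] by blast
    have s: "sym_diff M (\<phi> w) \<subseteq> {..<n}" using vn wn M_def by blast
    have "A \<subseteq> lab K v w \<longleftrightarrow> A' \<subseteq> sym_diff M (\<phi> w)"
      unfolding A b(2)[OF w] M_def[symmetric]
      using inj_on_image_subset_iff[OF inj _ s, of A'] by (auto simp: A'_def)
    moreover have "lab K v w \<subseteq> B \<longleftrightarrow> sym_diff M (\<phi> w) \<subseteq> B'"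
      unfolding A b(2)[OF w] M_def[symmetric]
      using inj_on_image_subset_iff[OF inj s, of B'] by (auto simp: B'_def)
    moreover have "A' \<subseteq> sym_diff M (\<phi> w) \<and> sym_diff M (\<phi> w) \<subseteq> B' \<longleftrightarrow>
      (A' - M) \<union> (M - B') \<subseteq> \<phi> w \<and> \<phi> w \<subseteq> (A' - M) \<union> (B' - A') \<union> (M - A')"
    proof -
      have "A' \<subseteq> B'" using AB A'_def B'_def by auto
      then show ?thesis by blast
    qed
    ultimately show "(A \<subseteq> lab K v w \<and> lab K v w \<subseteq> B) = ((A' - M) \<union> (M - B') \<subseteq> \<phi> w \<and> \<phi> w \<subseteq> (A' - M) \<union> (B' - A') \<union> (M - A'))"
      by simp
  qed
  moreover have "\<dots> \<in> K"
    by (rule chart_interval[OF c]) (use vn AB in \<open>auto simp: M_def A'_def B'_def\<close>)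
  ultimately show ?thesis by simp
qed

lemma lab_edge:
  assumes C: "C \<in> K" "v \<in> C" and ab: "a \<in> C" "b \<in> C"
  shows "(a, b) \<in> E \<longleftrightarrow> (\<exists>i\<in>nbc K v C. lab K v b = sym_diff (lab K v a) {i})"
proof -
  obtain n \<phi> where c: "cube_chart K n C \<phi>" using chartE C by blast
  obtain \<beta> where b: "bij_betw \<beta> {..<n} (nbc K v C)"
    "\<And>w. w \<in> C \<Longrightarrow> lab K v w = \<beta> ` sym_diff (\<phi> v) (\<phi> w)" using chart_lab[OF c C] by metis
  have inj: "inj_on \<beta> {..<n}" and im: "\<beta> ` {..<n} = nbc K v C" using b by (auto simp: bij_betw_def)
  have sub: "\<phi> v \<subseteq> {..<n}" "\<phi> a \<subseteq> {..<n}" "\<phi> b \<subseteq> {..<n}" using chart_sub[OF c] C ab by auto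
  have "lab K v b = sym_diff (lab K v a) {\<beta> i} \<longleftrightarrow> \<phi> b = sym_diff (\<phi> a) {i}" if i: "i < n" for i
  proof -
    have s: "sym_diff (\<phi> v) (\<phi> a) \<subseteq> {..<n}" "sym_diff (\<phi> v) (\<phi> b) \<subseteq> {..<n}" "{i} \<subseteq> {..<n}" using sub i by auto
    have s2: "sym_diff (sym_diff (\<phi> v) (\<phi> a)) {i} \<subseteq> {..<n}" by (intro Un_least) (use s in auto)
    have eq: "sym_diff (lab K v a) {\<beta> i} = \<beta> ` (sym_diff (sym_diff (\<phi> v) (\<phi> a)) {i})"
      unfolding b(2)[OF ab(1)]
      using inj_on_image_sym_diff[OF inj s(1,3)] by simp
    have "lab K v b = sym_diff (lab K v a) {\<beta> i} \<longleftrightarrow>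
       sym_diff (\<phi> v) (\<phi> b) = sym_diff (sym_diff (\<phi> v) (\<phi> a)) {i}"
      unfolding eq unfolding b(2)[OF ab(2)] by (rule inj_on_image_eq_iff[OF inj s(2) s2])
    also have "\<dots> \<longleftrightarrow> \<phi> b = sym_diff (\<phi> a) {i}" by (rule sym_diff_eq_iff)
    finally show ?thesis .
  qed
  then show ?thesis unfolding chart_edge[OF c ab] im[symmetric] by auto
qed

lemma lab_nb: "C \<in> K \<Longrightarrow> v \<in> C \<Longrightarrow> u \<in> nbc K v C \<Longrightarrow> lab K v u = {u}"
proof -
  assume C: "C \<in> K" "v \<in> C" and u: "u \<in> nbc K v C"
  have v: "lab K v v = {}" using lab_self C by (auto simp: verts_def)
  have uC: "u \<in> C" "(v, u) \<in> E" using u by (auto simp: nbc_def)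
  have "lab K v u \<subseteq> {u}"
  proof -
    have "{v, u} \<in> K" using uC by (simp add: edges_def)
    then have "nbc K v {v, u} = {u}" using uC by (auto simp: nbc_def edges_def)
    then show ?thesis using lab_subset[of "{v, u}" v u] \<open>{v, u} \<in> K\<close> by simp
  qed
  moreover have "lab K v u \<noteq> {}" using lab_inj[OF C uC(1) C(2)] v edges_neq[OF uC(2)] by auto
  ultimately show ?thesis by blast
qed

lemma vert_single: "v \<in> verts K \<Longrightarrow> {v} \<in> K"
proof -
  assume v: "v \<in> verts K"
  then obtain C where C: "C \<in> K" "v \<in> C" unfolding verts_def by auto
  have "{w \<in> C. {} \<subseteq> lab K v w \<and> lab K v w \<subseteq> {}} = {v}"
    using lab_self[OF v] lab_inj[OF C] C by auto
  then show ?thesis using lab_interval[OF C, of "{}" "{}"] by simp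
qed

text \<open>The intersection is a cube, so its number of corners is a power of 2, and three common
  corners force at least four. Consequently three corners of a square determine the fourth.\<close>

lemma three_of_square:
  assumes C: "C \<in> K" "D \<in> K" and xyz: "x \<in> C \<inter> D" "y \<in> C \<inter> D" "z \<in> C \<inter> D" "x \<noteq> y" "y \<noteq> z" "x \<noteq> z"
    and card: "card C \<le> 4"
  shows "C \<subseteq> D"
proof -
  have I: "C \<inter> D \<in> K" using cube_Int C xyz by blast
  have f: "finite C" using cube_finite C by blast
  have "card {x, y, z} \<le> card (C \<inter> D)" by (rule card_mono) (use f xyz in auto)
  then have 3: "3 \<le> card (C \<inter> D)" using xyz by simp
  obtain k where k: "card (C \<inter> D) = 2 ^ k" using lab_card[OF I xyz(1)] by blast
  have "k \<ge> 2"
  proof (rule ccontr)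
    assume "\<not> k \<ge> 2" then have "k = 0 \<or> k = 1" by auto
    then show False using 3 k by auto
  qed
  then have "(2::nat) ^ 2 \<le> 2 ^ k" by (intro power_increasing) auto
  then have "card C \<le> card (C \<inter> D)" using k card by simp
  then have "C \<inter> D = C" using f by (intro card_subset_eq) (auto intro: antisym card_mono)
  then show ?thesis by blast
qed

lemma sq_mem:
  assumes s: "sq K x u y w" and C: "C \<in> K" "x \<in> C" "u \<in> C" "w \<in> C"
  shows "y \<in> C"
proof -
  have "{x, u, y, w} \<subseteq> C"
    by (rule three_of_square[where x = x and y = u and z = w])
      (use s C in \<open>auto simp: sq_def edges_def card_insert_if\<close>)
  then show ?thesis by blast
qed

lemma sq_unique:
  assumes s: "sq K x u y w" "sq K x u y' w"
  shows "y = y'"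
proof -
  have "y \<in> {x, u, y', w}" by (rule sq_mem[OF s(1)]) (use s in \<open>auto simp: sq_def\<close>)
  then show ?thesis using s by (auto simp: sq_def edges_def)
qed

lemma sq_lab:
  assumes s: "sq K x u y w" and C: "C \<in> K" "x \<in> C" "u \<in> C" "w \<in> C"
  shows "y \<in> C" "lab K x y = {u, w}"
proof -
  show y: "y \<in> C" using sq_mem assms by blast
  have nb: "u \<in> nbc K x C" "w \<in> nbc K x C" using s C by (auto simp: sq_def nbc_def edges_sym)
  have l: "lab K x u = {u}" "lab K x w = {w}" "lab K x x = {}"
    using lab_nb[OF C(1,2)] C nb lab_self[of x] by (auto simp: verts_def)
  have e: "(u, y) \<in> E" "(w, y) \<in> E" "u \<noteq> w" "x \<noteq> y" using s edges_sym by (auto simp: sq_def)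
  obtain i where i: "lab K x y = sym_diff {u} {i}" using lab_edge[OF C(1,2) C(3) y] e l by auto
  obtain j where j: "lab K x y = sym_diff {w} {j}" using lab_edge[OF C(1,2) C(4) y] e l by auto
  have "lab K x y \<noteq> {}" using lab_inj[OF C(1,2) y C(2)] l e by auto
  then show "lab K x y = {u, w}" using i j e by (auto split: if_splits)
qed

lemma lab_sq:
  assumes C: "C \<in> K" "v \<in> C" and m: "a \<in> C" "b \<in> C" "c \<in> C" "d \<in> C"
    and ij: "i \<in> nbc K v C" "j \<in> nbc K v C" "i \<noteq> j" "i \<notin> lab K v a" "j \<notin> lab K v a"
    and l: "lab K v b = insert i (lab K v a)" "lab K v c = insert i (insert j (lab K v a))" "lab K v d = insert j (lab K v a)"
  shows "sq K a b c d"
proof -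
  have la: "lab K v a \<subseteq> nbc K v C" using lab_subset C m by blast
  have "{w \<in> C. lab K v a \<subseteq> lab K v w \<and> lab K v w \<subseteq> lab K v c} = {a, b, c, d}"
  proof -
    have "lab K v w = lab K v a \<or> lab K v w = lab K v b \<or> lab K v w = lab K v c \<or> lab K v w = lab K v d"
      if "lab K v a \<subseteq> lab K v w" "lab K v w \<subseteq> lab K v c" for w
      using set_between_doubleton[OF that(1), of i j] that(2) unfolding l by blast
    then have "w \<in> {a, b, c, d}" if "w \<in> C" "lab K v a \<subseteq> lab K v w" "lab K v w \<subseteq> lab K v c" for w
      using lab_inj[OF C that(1)] m that by (metis insert_iff)
    moreover have "lab K v a \<subseteq> lab K v w \<and> lab K v w \<subseteq> lab K v c" if "w \<in> {a, b, c, d}" for w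
      using that unfolding l by (auto simp: l)
    ultimately show ?thesis using m by blast
  qed
  moreover have "{w \<in> C. lab K v a \<subseteq> lab K v w \<and> lab K v w \<subseteq> lab K v c} \<in> K"
    by (rule lab_interval[OF C]) (use l la ij in auto)
  ultimately have "{a, b, c, d} \<in> K" by simp
  moreover have "(a, b) \<in> E" unfolding lab_edge[OF C m(1,2)] using ij l by (intro bexI[of _ i]) auto
  moreover have "(b, c) \<in> E" unfolding lab_edge[OF C m(2,3)] using ij l by (intro bexI[of _ j]) auto
  moreover have "(d, c) \<in> E" unfolding lab_edge[OF C m(4,3)] using ij l by (intro bexI[of _ i]) auto
  moreover have "(a, d) \<in> E" unfolding lab_edge[OF C m(1,4)] using ij l by (intro bexI[of _ j]) auto
  moreover have "a \<noteq> c" using l ij by auto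
  moreover have "b \<noteq> d" using l ij by auto
  ultimately show ?thesis unfolding sq_def using edges_sym by metis
qed

lemma nbc_face:
  assumes C: "C \<in> K" "v \<in> C" and U: "U \<subseteq> nbc K v C"
  shows "{w \<in> C. lab K v w \<subseteq> U} \<in> K" "nbc K v {w \<in> C. lab K v w \<subseteq> U} = U"
proof -
  show "{w \<in> C. lab K v w \<subseteq> U} \<in> K" using lab_interval[OF C, of "{}" U] U by simp
  show "nbc K v {w \<in> C. lab K v w \<subseteq> U} = U"
    using U lab_nb[OF C] by (auto simp: nbc_def)
qed

text \<open>The directions of \<open>w\<close> at \<open>v\<close> belong to the cube
  \<open>C \<inter> D\<close>, which therefore has a corner with the same label; labels are
  injective on \<open>C\<close>.\<close>

lemma lab_mem:
  assumes C: "C \<in> K" "D \<in> K" "v \<in> C" "v \<in> D" "w \<in> C" and "lab K v w \<subseteq> D"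
  shows "w \<in> D"
proof -
  have I: "C \<inter> D \<in> K" "v \<in> C \<inter> D" using cube_Int C by auto
  have "lab K v w \<subseteq> nbc K v (C \<inter> D)" using assms lab_subset[OF C(1,3,5)] by (auto simp: nbc_def)
  then obtain w' where "w' \<in> C \<inter> D" "lab K v w' = lab K v w" using lab_ex[OF I] by metis
  then show ?thesis using lab_inj[OF C(1,3), of w' w] C by auto
qed

text \<open>A cube through \<open>v\<close> is thus known from its directions at \<open>v\<close>,
  which turns sums over cubes at a vertex into sums over sets of neighbours.\<close>

lemma cube_subset_iff_nbc:
  assumes C: "C \<in> K" "D \<in> K" "v \<in> C" "v \<in> D"
  shows "C \<subseteq> D \<longleftrightarrow> nbc K v C \<subseteq> nbc K v D"
proof
  assume "nbc K v C \<subseteq> nbc K v D"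
  then show "C \<subseteq> D" using lab_mem[OF C] lab_subset[OF C(1,3)] by (auto simp: nbc_def) blast
qed (auto simp: nbc_def)

lemma cube_eq_iff_nbc:
  assumes C: "C \<in> K" "D \<in> K" "v \<in> C" "v \<in> D"
  shows "C = D \<longleftrightarrow> nbc K v C = nbc K v D"
  using cube_subset_iff_nbc[OF C] cube_subset_iff_nbc[OF C(2,1,4,3)] by blast

end

section \<open>Coordinates of points\<close>

text \<open>This expansion serves three times: to recover a coordinate from the weights, to factor
  the sum over the corners of a cube, and to evaluate an alternating sum over subsets.\<close>

lemma sum_Pow_prod:
  assumes "finite N"
  shows "(\<Sum>A\<in>Pow N. \<Prod>u\<in>N. if u \<in> A then f u else g u) = (\<Prod>u\<in>N. f u + g u :: 'a::comm_ring_1)"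
proof -
  have "(\<Prod>u\<in>N. if u \<in> A then f u else g u) = prod f A * prod g (N - A)" if "A \<in> Pow N" for A
  proof -
    have "A \<subseteq> N" using that by auto
    from prod.subset_diff[OF this assms, of "\<lambda>u. if u \<in> A then f u else g u"]
    have "(\<Prod>u\<in>N. if u \<in> A then f u else g u) =
        (\<Prod>u\<in>A. if u \<in> A then f u else g u) * (\<Prod>u\<in>N - A. if u \<in> A then f u else g u)"
      by (simp add: mult.commute)
    also have "\<dots> = prod f A * prod g (N - A)"
      by (rule arg_cong2[where f = "(*)"]) (auto intro!: prod.cong)
    finally show ?thesis .
  qed
  then show ?thesis using prod_add[OF assms, of f g] by simp
qed

definition nbs :: "'v set set \<Rightarrow> 'v \<Rightarrow> 'v set" where
  "nbs K v = {u. (v, u) \<in> edges K}"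

text \<open>The coordinate of the point \<open>p\<close> in the direction \<open>u\<close> at \<open>v\<close>, which is 0 at \<open>v\<close>.\<close>

definition crd :: "'v set set \<Rightarrow> 'v \<Rightarrow> ('v \<Rightarrow> real) \<Rightarrow> 'v \<Rightarrow> real" where
  "crd K v p u = (\<Sum>w | p w \<noteq> 0 \<and> in_common_cube K v w \<and> u \<in> lab K v w. p w)"

text \<open>These are the weights of \<open>cube_point\<close> with coordinates measured from
  \<open>v\<close> and indexed by neighbours of \<open>v\<close>, so that points in different cubes
  at \<open>v\<close> have comparable coordinates.\<close>

definition corner_point :: "'v set set \<Rightarrow> 'v \<Rightarrow> 'v set \<Rightarrow> ('v \<Rightarrow> real) \<Rightarrow> 'v \<Rightarrow> real" where
  "corner_point K v C \<xi> =
     (\<lambda>w. if w \<in> C then \<Prod>u\<in>nbc K v C. if u \<in> lab K v w then \<xi> u else 1 - \<xi> u else 0)"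

context cubical
begin

text \<open>\<open>T\<close> reflects the coordinates in which \<open>v\<close> has value 1; this is
  an isometry of the standard cube that moves \<open>v\<close> to the origin.\<close>

lemma corner_chart:
  assumes c: "cube_chart K n C \<phi>" "C \<in> K" and v: "v \<in> C"
  obtains T where "\<And>x. cube_point n C \<phi> x = corner_point K v C (T x)"
    "\<And>x u. u \<in> nbc K v C \<Longrightarrow> \<exists>i<n. T x u = (if i \<in> \<phi> v then 1 - x i else x i)"
    "\<And>x y. L2_set (\<lambda>i. x i - y i) {..<n} = L2_set (\<lambda>u. T x u - T y u) (nbc K v C)"
    "\<forall>\<xi>. (\<forall>u\<in>nbc K v C. 0 \<le> \<xi> u \<and> \<xi> u \<le> 1) \<longrightarrow>
        (\<exists>x\<in>unit_cube n. \<forall>u\<in>nbc K v C. T x u = \<xi> u)"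
proof -
  obtain \<beta> where b: "bij_betw \<beta> {..<n} (nbc K v C)"
    "\<And>w. w \<in> C \<Longrightarrow> lab K v w = \<beta> ` sym_diff (\<phi> v) (\<phi> w)" using chart_lab[OF c v] by metis
  have inj: "inj_on \<beta> {..<n}" and im: "\<beta> ` {..<n} = nbc K v C" using b by (auto simp: bij_betw_def)
  define T where "T x u = (let i = inv_into {..<n} \<beta> u in if i \<in> \<phi> v then 1 - x i else x i)" for x :: "nat \<Rightarrow> real" and u
  have T: "T x (\<beta> i) = (if i \<in> \<phi> v then 1 - x i else x i)" if "i < n" for i x
    using that inj by (simp add: T_def)
  have mem: "\<beta> i \<in> lab K v w \<longleftrightarrow> (i \<in> \<phi> w) \<noteq> (i \<in> \<phi> v)" if "i < n" "w \<in> C" for i w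
  proof -
    have s: "sym_diff (\<phi> v) (\<phi> w) \<subseteq> {..<n}" using chart_sub[OF c(1) v] chart_sub[OF c(1) that(2)] by (intro Un_least) auto
    show ?thesis unfolding b(2)[OF that(2)] using inj_on_image_mem_iff[OF inj _ s, of i] that by auto
  qed
  have "cube_point n C \<phi> x w = corner_point K v C (T x) w" for x w
  proof (cases "w \<in> C")
    case True
    have "(\<Prod>i<n. if i \<in> \<phi> w then x i else 1 - x i) = (\<Prod>i<n. if \<beta> i \<in> lab K v w then T x (\<beta> i) else 1 - T x (\<beta> i))"
      by (rule prod.cong) (use True mem T in auto)
    also have "\<dots> = (\<Prod>u\<in>nbc K v C. if u \<in> lab K v w then T x u else 1 - T x u)"
      by (rule prod.reindex_bij_betw[OF b(1)])
    finally show ?thesis using True by (simp add: cube_point_def corner_point_def)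
  qed (simp add: cube_point_def corner_point_def)
  then have 1: "cube_point n C \<phi> x = corner_point K v C (T x)" for x by blast
  have 2: "\<exists>i<n. T x u = (if i \<in> \<phi> v then 1 - x i else x i)" if u: "u \<in> nbc K v C" for x u
    using u T unfolding im[symmetric] by auto
  have 3: "L2_set (\<lambda>i. x i - y i) {..<n} = L2_set (\<lambda>u. T x u - T y u) (nbc K v C)" for x y
  proof -
    have "(\<Sum>i<n. (x i - y i)\<^sup>2) = (\<Sum>i<n. (T x (\<beta> i) - T y (\<beta> i))\<^sup>2)"
      by (rule sum.cong) (auto simp: T power2_commute)
    also have "\<dots> = (\<Sum>u\<in>nbc K v C. (T x u - T y u)\<^sup>2)"
      by (rule sum.reindex_bij_betw[OF b(1)])
    finally show ?thesis by (simp add: L2_set_def)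
  qed
  have 4: "\<forall>\<xi>. (\<forall>u\<in>nbc K v C. 0 \<le> \<xi> u \<and> \<xi> u \<le> 1) \<longrightarrow>
        (\<exists>x\<in>unit_cube n. \<forall>u\<in>nbc K v C. T x u = \<xi> u)"
  proof (intro allI impI)
    fix \<xi> :: "'v \<Rightarrow> real" assume \<xi>: "\<forall>u\<in>nbc K v C. 0 \<le> \<xi> u \<and> \<xi> u \<le> 1"
    define x where "x i = (if i \<in> \<phi> v then 1 - \<xi> (\<beta> i) else \<xi> (\<beta> i))" for i
    have "0 \<le> \<xi> (\<beta> i) \<and> \<xi> (\<beta> i) \<le> 1" if "i < n" for i
      using \<xi> that im by auto
    then have "x \<in> unit_cube n" unfolding unit_cube_def x_def by auto
    moreover have "\<forall>u\<in>nbc K v C. T x u = \<xi> u"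
      unfolding im[symmetric] using T by (auto simp: x_def)
    ultimately show "\<exists>x\<in>unit_cube n. \<forall>u\<in>nbc K v C. T x u = \<xi> u" by blast
  qed
  show ?thesis by (rule that[OF 1 2 3 4])
qed

lemma corner_point_cong:
  "(\<And>u. u \<in> nbc K v C \<Longrightarrow> \<xi> u = \<eta> u) \<Longrightarrow> corner_point K v C \<xi> = corner_point K v C \<eta>"
  unfolding corner_point_def by (intro ext if_cong prod.cong) auto

lemma corner_point_realization:
  assumes C: "C \<in> K" "v \<in> C" and \<xi>: "\<And>u. u \<in> nbc K v C \<Longrightarrow> 0 \<le> \<xi> u \<and> \<xi> u \<le> 1"
  shows "corner_point K v C \<xi> \<in> realization K"
proof -
  obtain n \<phi> where c: "cube_chart K n C \<phi>" using chartE C by blast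
  obtain T where T: "\<And>x. cube_point n C \<phi> x = corner_point K v C (T x)"
    "\<forall>\<xi>. (\<forall>u\<in>nbc K v C. 0 \<le> \<xi> u \<and> \<xi> u \<le> 1) \<longrightarrow>
        (\<exists>x\<in>unit_cube n. \<forall>u\<in>nbc K v C. T x u = \<xi> u)" by (rule corner_chart[OF c C]) (rule that)
  obtain x where x: "x \<in> unit_cube n" "\<forall>u\<in>nbc K v C. T x u = \<xi> u" using T(2) \<xi> by blast
  have "cube_point n C \<phi> x = corner_point K v C \<xi>" unfolding T(1) by (rule corner_point_cong) (use x in auto)
  then show ?thesis unfolding realization_def
    by (intro CollectI exI conjI) (erule sym, rule C(1), rule c, rule x(1))
qed

lemma crd_corner_point:
  assumes C: "C \<in> K" "v \<in> C"
  shows "crd K v (corner_point K v C \<xi>) u = (if u \<in> nbc K v C then \<xi> u else 0)"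
proof -
  define N where "N = nbc K v C"
  have fN: "finite N" using nbc_finite C by (simp add: N_def)
  let ?p = "corner_point K v C \<xi>"
  let ?g = "\<lambda>A. \<Prod>u\<in>N. if u \<in> A then \<xi> u else 1 - \<xi> u"
  have "crd K v ?p u = (\<Sum>w\<in>{w \<in> C. u \<in> lab K v w}. ?p w)"
    unfolding crd_def
  proof (rule sum.mono_neutral_left)
    show "finite {w \<in> C. u \<in> lab K v w}" using cube_finite C by simp
    show "{w. ?p w \<noteq> 0 \<and> in_common_cube K v w \<and> u \<in> lab K v w} \<subseteq> {w \<in> C. u \<in> lab K v w}"
      by (auto simp: corner_point_def)
    show "\<forall>i\<in>{w \<in> C. u \<in> lab K v w} - {w. ?p w \<noteq> 0 \<and> in_common_cube K v w \<and> u \<in> lab K v w}. ?p i = 0"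
      using C by (auto simp: in_common_cube_def)
  qed
  also have "\<dots> = (\<Sum>w\<in>C. if u \<in> lab K v w then ?g (lab K v w) else 0)"
    using cube_finite[OF C(1)] unfolding sum.inter_filter[OF cube_finite[OF C(1)], symmetric]
    by (intro sum.cong) (auto simp: corner_point_def N_def)
  also have "\<dots> = (\<Sum>A\<in>Pow N. if u \<in> A then ?g A else 0)"
    unfolding N_def by (rule sum.reindex_bij_betw[OF lab_bij[OF C]])
  also have "\<dots> = (if u \<in> N then \<xi> u else 0)"
  proof (cases "u \<in> N")
    case True
    \<comment> \<open>Putting 0 for \<open>1 - \<xi> u\<close> at the one direction \<open>u\<close>
      kills exactly the terms with \<open>u\<close> outside \<open>A\<close>. After expansion every
      other direction contributes the factor 1.\<close>
    have "(\<Sum>A\<in>Pow N. if u \<in> A then ?g A else 0) =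
       (\<Sum>A\<in>Pow N. \<Prod>w\<in>N. if w \<in> A then \<xi> w else (if w = u then 0 else 1 - \<xi> w))"
    proof (rule sum.cong[OF HOL.refl])
      fix A assume "A \<in> Pow N"
      show "(if u \<in> A then ?g A else 0) = (\<Prod>w\<in>N. if w \<in> A then \<xi> w else (if w = u then 0 else 1 - \<xi> w))"
      proof (cases "u \<in> A")
        case True
        then show ?thesis by (auto intro!: prod.cong)
      next
        case False
        then have "(\<Prod>w\<in>N. if w \<in> A then \<xi> w else (if w = u then 0 else 1 - \<xi> w)) = 0"
          using fN \<open>u \<in> N\<close> by (intro prod_zero) auto
        then show ?thesis using False by simp
      qed
    qed
    also have "\<dots> = (\<Prod>w\<in>N. \<xi> w + (if w = u then 0 else 1 - \<xi> w))" by (rule sum_Pow_prod[OF fN])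
    also have "\<dots> = (\<Prod>w\<in>N. if w = u then \<xi> u else 1)" by (rule prod.cong) auto
    also have "\<dots> = \<xi> u" using fN True by simp
    finally show ?thesis using True by simp
  next
    case False
    then have "(if u \<in> A then ?g A else 0) = 0" if "A \<in> Pow N" for A using that by auto
    then show ?thesis using False by simp
  qed
  finally show ?thesis by (simp add: N_def)
qed

lemma corner_point_nz:
  assumes C: "C \<in> K" "v \<in> C" and \<xi>: "\<And>u. u \<in> nbc K v C \<Longrightarrow> \<xi> u < 1"
  shows "corner_point K v C \<xi> v \<noteq> 0"
proof -
  have "lab K v v = {}" using lab_self C by (auto simp: verts_def)
  moreover have "(\<Prod>u\<in>nbc K v C. 1 - \<xi> u) > 0" by (rule prod_pos) (use \<xi> in auto)
  ultimately show ?thesis using C by (simp add: corner_point_def)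
qed

text \<open>A direction of \<open>C\<close> that leaves \<open>D\<close> has coordinate 0. It gives
  the factor 1 at the corners of \<open>D\<close>, while each corner of \<open>C\<close> outside
  \<open>D\<close> has such a direction in its label and so receives a factor 0.\<close>

lemma corner_point_face:
  assumes C: "C \<in> K" "D \<in> K" "v \<in> C" "v \<in> D" and D: "D \<subseteq> C"
    and \<xi>: "\<And>u. u \<in> nbc K v C \<Longrightarrow> u \<notin> D \<Longrightarrow> \<xi> u = 0"
  shows "corner_point K v C \<xi> = corner_point K v D \<xi>"
proof
  fix w
  have sub: "nbc K v D \<subseteq> nbc K v C" using D by (auto simp: nbc_def)
  have f: "finite (nbc K v C)" using nbc_finite C by blast
  show "corner_point K v C \<xi> w = corner_point K v D \<xi> w"
  proof (cases "w \<in> D")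
    case True
    have "(\<Prod>u\<in>nbc K v C. if u \<in> lab K v w then \<xi> u else 1 - \<xi> u) = (\<Prod>u\<in>nbc K v D. if u \<in> lab K v w then \<xi> u else 1 - \<xi> u)"
    proof (rule prod.mono_neutral_right[OF f sub], rule ballI)
      fix u assume u: "u \<in> nbc K v C - nbc K v D"
      then have "u \<notin> D" by (auto simp: nbc_def)
      moreover have "u \<notin> lab K v w" using u lab_subset[OF C(2,4) True] by auto
      ultimately show "(if u \<in> lab K v w then \<xi> u else 1 - \<xi> u) = 1" using \<xi> u by auto
    qed
    then show ?thesis using True D by (auto simp: corner_point_def)
  next
    case False
    show ?thesis
    proof (cases "w \<in> C")
      case True
      then obtain u where u: "u \<in> lab K v w" "u \<notin> D" using lab_mem[OF C True] False by blast
      then have n: "u \<in> nbc K v C" using lab_subset[OF C(1,3) True] by auto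
      then have "\<xi> u = 0" using \<xi> u by blast
      then have "(\<Prod>u\<in>nbc K v C. if u \<in> lab K v w then \<xi> u else 1 - \<xi> u) = 0"
        using f u n by (intro prod_zero) auto
      then show ?thesis using True False by (simp add: corner_point_def)
    next
      case False
      then show ?thesis using \<open>w \<notin> D\<close> by (simp add: corner_point_def)
    qed
  qed
qed

section \<open>Carriers of points and strings near a vertex\<close>

definition carrier_of :: "('v \<Rightarrow> real) \<Rightarrow> 'v set" where
  "carrier_of p = {v. p v \<noteq> 0}"

text \<open>A corner has nonzero weight exactly when it contains all coordinates equal to 1 and
  avoids all those equal to 0; such corners form an interval.\<close>

lemma carrier_of_cube: "p \<in> realization K \<Longrightarrow> carrier_of p \<in> K"
proof -
  assume "p \<in> realization K"
  then obtain n C \<phi> x where p: "p = cube_point n C \<phi> x" "C \<in> K" "cube_chart K n C \<phi>" "x \<in> unit_cube n"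
    unfolding realization_def by auto
  let ?A = "{i. i < n \<and> x i = 1}" and ?B = "{i. i < n \<and> x i \<noteq> 0}"
  have "carrier_of p = {w \<in> C. ?A \<subseteq> \<phi> w \<and> \<phi> w \<subseteq> ?B}"
  proof -
    have "p w \<noteq> 0 \<longleftrightarrow> ?A \<subseteq> \<phi> w \<and> \<phi> w \<subseteq> ?B" if w: "w \<in> C" for w
    proof -
      have "p w \<noteq> 0 \<longleftrightarrow> (\<forall>i<n. (if i \<in> \<phi> w then x i else 1 - x i) \<noteq> 0)"
        unfolding p(1) cube_point_def using w by auto
      also have "\<dots> \<longleftrightarrow> ?A \<subseteq> \<phi> w \<and> \<phi> w \<subseteq> ?B"
        using chart_sub[OF p(3) w] by (auto split: if_splits)
      finally show ?thesis .
    qed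
    moreover have "p w = 0" if "w \<notin> C" for w using that by (simp add: p(1) cube_point_def)
    ultimately show ?thesis unfolding carrier_of_def by blast
  qed
  moreover have "{w \<in> C. ?A \<subseteq> \<phi> w \<and> \<phi> w \<subseteq> ?B} \<in> K" by (rule chart_interval[OF p(3)]) auto
  ultimately show ?thesis by simp
qed

lemma string_nonneg: "string_between K p q l \<Longrightarrow> 0 \<le> l"
  by (induction rule: string_between.induct) (auto intro: add_nonneg_nonneg)

lemma string_realization: "string_between K p q l \<Longrightarrow> p \<in> realization K \<and> q \<in> realization K"
  by (induction rule: string_between.induct) (auto simp: realization_def)

end

locale locally_finite_cubical = cubical K for K :: "'v set set" +
  assumes locfin: "locally_finite_complex K"
begin

lemma finite_cubes_at: "v \<in> verts K \<Longrightarrow> finite {C \<in> K. v \<in> C}"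
  using locfin by (simp add: locally_finite_complex_def)

lemma finite_nbs: "finite (nbs K v)"
proof (cases "v \<in> verts K")
  case True
  have "finite (\<Union>{C \<in> K. v \<in> C})" using finite_cubes_at[OF True] cube_finite by auto
  moreover have "nbs K v \<subseteq> \<Union>{C \<in> K. v \<in> C}" by (auto simp: nbs_def edges_def)
  ultimately show ?thesis using finite_subset by blast
next
  case False
  then have "nbs K v = {}" using edges_verts by (fastforce simp: nbs_def)
  then show ?thesis by simp
qed

lemma L2_crd_corner:
  assumes C: "C \<in> K" "v \<in> C"
  shows "L2_set (\<lambda>u. crd K v (corner_point K v C \<xi>) u - crd K v (corner_point K v C \<eta>) u) (nbs K v) =
     L2_set (\<lambda>u. \<xi> u - \<eta> u) (nbc K v C)"
proof -
  have "(\<Sum>u\<in>nbs K v. (crd K v (corner_point K v C \<xi>) u - crd K v (corner_point K v C \<eta>) u)\<^sup>2) =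
    (\<Sum>u\<in>nbc K v C. (\<xi> u - \<eta> u)\<^sup>2)"
    by (rule sum.mono_neutral_cong_right[OF finite_nbs])
      (auto simp: crd_corner_point[OF C] nbc_def nbs_def)
  then show ?thesis by (simp add: L2_set_def)
qed

text \<open>While the point reached has nonzero weight at \<open>v\<close>, the next step takes
  place in a cube containing \<open>v\<close> and is measured exactly by coordinates. A coordinate
  grows by at most the length used up, so the margin below 1 lasts for the whole string and the
  weight at \<open>v\<close> never vanishes.\<close>

lemma string_crd:
  assumes "string_between K p q l" "p v \<noteq> 0" "\<And>u. crd K v p u + l < 1"
  shows "q v \<noteq> 0 \<and> (\<forall>u. crd K v q u \<le> crd K v p u + l) \<and>
     L2_set (\<lambda>u. crd K v p u - crd K v q u) (nbs K v) \<le> l"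
  using assms
proof (induction rule: string_between.induct)
  case (refl p)
  then show ?case by (simp add: L2_set_def)
next
  case (step C n \<phi> x y q l)
  have vC: "v \<in> C" using step.prems(1) by (auto simp: cube_point_def split: if_splits)
  obtain T where T: "\<And>x. cube_point n C \<phi> x = corner_point K v C (T x)"
    "\<And>x y. L2_set (\<lambda>i. x i - y i) {..<n} = L2_set (\<lambda>u. T x u - T y u) (nbc K v C)"
    by (rule corner_chart[OF step.hyps(2,1) vC]) (rule that)
  let ?p = "cube_point n C \<phi> x" and ?m = "cube_point n C \<phi> y"
  define e where "e = L2_set (\<lambda>i. x i - y i) {..<n}"
  have fN: "finite (nbc K v C)" using nbc_finite step.hyps by blast
  have l: "0 \<le> l" using string_nonneg step.hyps by blast
  have e0: "0 \<le> e" by (simp add: e_def)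
  have crd: "crd K v (cube_point n C \<phi> x) u = (if u \<in> nbc K v C then T x u else 0)" for x u
    unfolding T(1) by (rule crd_corner_point[OF step.hyps(1) vC])
  have d: "L2_set (\<lambda>u. crd K v ?p u - crd K v ?m u) (nbs K v) = e"
    unfolding T(1) e_def T(2) by (rule L2_crd_corner[OF step.hyps(1) vC])
  have le: "crd K v ?m u \<le> crd K v ?p u + e" for u
  proof (cases "u \<in> nbc K v C")
    case True
    have "\<bar>T x u - T y u\<bar> \<le> L2_set (\<lambda>u. \<bar>T x u - T y u\<bar>) (nbc K v C)" by (rule member_le_L2_set[OF fN True])
    also have "\<dots> = e" unfolding e_def T(2) by (simp add: L2_set_def)
    finally show ?thesis using True unfolding crd by auto
  qed (use e0 crd in auto)
  have lt: "crd K v ?m u + l < 1" for u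
    using le[of u] step.prems(2)[of u] by (simp add: e_def)
  have "?m v \<noteq> 0" unfolding T(1)
  proof (rule corner_point_nz[OF step.hyps(1) vC])
    fix u assume "u \<in> nbc K v C"
    then show "T y u < 1" using lt[of u] l crd[of y u] by simp
  qed
  from step.IH[OF this lt] have IH: "q v \<noteq> 0" "\<And>u. crd K v q u \<le> crd K v ?m u + l"
    "L2_set (\<lambda>u. crd K v ?m u - crd K v q u) (nbs K v) \<le> l" by auto
  have "L2_set (\<lambda>u. crd K v ?p u - crd K v q u) (nbs K v) \<le> e + l"
    using L2_set_triangle_ineq[of "\<lambda>u. crd K v ?p u - crd K v ?m u" "\<lambda>u. crd K v ?m u - crd K v q u" "nbs K v"] d IH(3) by simp
  moreover have "crd K v q u \<le> crd K v ?p u + (e + l)" for u using IH(2)[of u] le[of u] by linarith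
  ultimately show ?case using IH(1) by (simp add: e_def[symmetric])
qed

end

section \<open>The length metric near a vertex\<close>

locale cat0_cubical = locally_finite_cubical K for K :: "'v set set" +
  assumes cat0: "CAT0_cubical_complex K"
begin

abbreviation "X \<equiv> realization K"
abbreviation "ld \<equiv> length_dist K"

lemma metric: "Metric_space X ld"
  using cat0 by (simp add: CAT0_cubical_complex_def CAT0_space_def)

sublocale M: Metric_space X ld
  by (rule metric)

lemma string_ex: "p \<in> X \<Longrightarrow> q \<in> X \<Longrightarrow> \<exists>l. string_between K p q l"
  using cat0 by (simp add: CAT0_cubical_complex_def)

lemma ld_le: "string_between K p q l \<Longrightarrow> ld p q \<le> l"
  unfolding length_dist_def using string_realization[of p q l]
  by (auto intro!: cInf_lower bdd_belowI[of _ 0] dest: string_nonneg)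

lemma ld_less:
  assumes "p \<in> X" "q \<in> X" "ld p q < r"
  obtains l where "string_between K p q l" "l < r"
proof -
  have "Inf {l. string_between K p q l} < r" using assms by (simp add: length_dist_def)
  then have "\<exists>l\<in>{l. string_between K p q l}. l < r"
    by (subst (asm) cInf_less_iff) (use string_ex[OF assms(1,2)] string_nonneg in \<open>auto intro: bdd_belowI[of _ 0]\<close>)
  then show ?thesis using that by blast
qed

lemma ld_corner:
  assumes C: "C \<in> K" "v \<in> C" and \<xi>: "\<And>u. u \<in> nbc K v C \<Longrightarrow> 0 \<le> \<xi> u \<and> \<xi> u \<le> 1"
    and \<eta>: "\<And>u. u \<in> nbc K v C \<Longrightarrow> 0 \<le> \<eta> u \<and> \<eta> u \<le> 1"
  shows "ld (corner_point K v C \<xi>) (corner_point K v C \<eta>) \<le> L2_set (\<lambda>u. \<xi> u - \<eta> u) (nbc K v C)"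
proof -
  obtain n \<phi> where c: "cube_chart K n C \<phi>" using chartE C by blast
  obtain T where T: "\<And>x. cube_point n C \<phi> x = corner_point K v C (T x)"
    "\<And>x y. L2_set (\<lambda>i. x i - y i) {..<n} = L2_set (\<lambda>u. T x u - T y u) (nbc K v C)"
    "\<forall>\<xi>. (\<forall>u\<in>nbc K v C. 0 \<le> \<xi> u \<and> \<xi> u \<le> 1) \<longrightarrow>
        (\<exists>x\<in>unit_cube n. \<forall>u\<in>nbc K v C. T x u = \<xi> u)" by (rule corner_chart[OF c C]) (rule that)
  obtain x where x: "x \<in> unit_cube n" "\<forall>u\<in>nbc K v C. T x u = \<xi> u" using T(3) \<xi> by blast
  obtain y where y: "y \<in> unit_cube n" "\<forall>u\<in>nbc K v C. T y u = \<eta> u" using T(3) \<eta> by blast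
  have px: "cube_point n C \<phi> x = corner_point K v C \<xi>" unfolding T(1) by (rule corner_point_cong) (use x in auto)
  have py: "cube_point n C \<phi> y = corner_point K v C \<eta>" unfolding T(1) by (rule corner_point_cong) (use y in auto)
  have "string_between K (cube_point n C \<phi> x) (cube_point n C \<phi> y) (L2_set (\<lambda>i. x i - y i) {..<n} + 0)"
    by (rule string_between.step[OF C(1) c x(1) y(1)], rule string_between.refl)
      (use py corner_point_realization[OF C \<eta>] in auto)
  then have "ld (corner_point K v C \<xi>) (corner_point K v C \<eta>) \<le> L2_set (\<lambda>i. x i - y i) {..<n}"
    using ld_le px py by simp
  also have "\<dots> = L2_set (\<lambda>u. \<xi> u - \<eta> u) (nbc K v C)" unfolding T(2) using x y by (auto simp: L2_set_def intro!: sum.cong)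
  finally show ?thesis .
qed

text \<open>A string shorter than the coordinate distance would be too short to leave the star of
  \<open>v\<close>, and \<open>string_crd\<close> would bound the coordinate distance by the length
  of that string.\<close>

lemma ld_crd_lower:
  assumes "p \<in> X" "q \<in> X" "p v \<noteq> 0"
    and "L2_set (\<lambda>u. crd K v p u - crd K v q u) (nbs K v) \<le> c" "\<And>u. crd K v p u + c < 1"
  shows "L2_set (\<lambda>u. crd K v p u - crd K v q u) (nbs K v) \<le> ld p q"
proof (rule ccontr)
  assume "\<not> ?thesis"
  then have "ld p q < L2_set (\<lambda>u. crd K v p u - crd K v q u) (nbs K v)" by simp
  then obtain l where l: "string_between K p q l" "l < L2_set (\<lambda>u. crd K v p u - crd K v q u) (nbs K v)"
    using ld_less assms by blast
  have "crd K v p u + l < 1" for u using assms(5)[of u] l(2) assms(4) by linarith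
  from string_crd[OF l(1) assms(3) this] l(2) show False by simp
qed

lemma open_star:
  assumes "p \<in> X" "q \<in> X" "p v \<noteq> 0" "ld p q < r" "\<And>u. crd K v p u + r \<le> 1"
  shows "q v \<noteq> 0" "crd K v q u \<le> crd K v p u + r"
    "L2_set (\<lambda>u. crd K v p u - crd K v q u) (nbs K v) \<le> ld p q"
proof -
  obtain l where l: "string_between K p q l" "l < r" using ld_less assms by blast
  have "crd K v p u + l < 1" for u using assms(5)[of u] l(2) by linarith
  note s = string_crd[OF l(1) assms(3) this]
  show "q v \<noteq> 0" using s by simp
  have "crd K v q u \<le> crd K v p u + l" using s by simp
  then show "crd K v q u \<le> crd K v p u + r" using l(2) by linarith
  show "L2_set (\<lambda>u. crd K v p u - crd K v q u) (nbs K v) \<le> ld p q"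
  proof (rule field_le_epsilon)
    fix e :: real assume "0 < e"
    then have "ld p q < min r (ld p q + e)" using assms(4) by simp
    then obtain l where l: "string_between K p q l" "l < min r (ld p q + e)" using ld_less assms(1,2) by blast
    have "crd K v p u + l < 1" for u using assms(5)[of u] l(2) by linarith
    from string_crd[OF l(1) assms(3) this] l(2)
    show "L2_set (\<lambda>u. crd K v p u - crd K v q u) (nbs K v) \<le> ld p q + e" by simp
  qed
qed

text \<open>Rounding each coordinate to the nearer end gives a corner from which no coordinate
  exceeds 1/2. This makes 1/2 a radius that works at every point.\<close>

lemma near_corner:
  assumes "p \<in> X"
  obtains v where "p v \<noteq> 0" "\<And>u. crd K v p u \<le> 1/2"
proof -
  obtain n C \<phi> x where p: "p = cube_point n C \<phi> x" "C \<in> K" "cube_chart K n C \<phi>" "x \<in> unit_cube n"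
    using assms unfolding realization_def by auto
  obtain v where v: "v \<in> C" "\<phi> v = {i. i < n \<and> x i > 1/2}" using chart_ex[OF p(3), of "{i. i < n \<and> x i > 1/2}"] by auto
  have "p v \<noteq> 0" unfolding p(1) cube_point_def using v by auto
  moreover have "crd K v p u \<le> 1/2" for u
  proof -
    obtain T where T: "\<And>x. cube_point n C \<phi> x = corner_point K v C (T x)"
      "\<And>x u. u \<in> nbc K v C \<Longrightarrow> \<exists>i<n. T x u = (if i \<in> \<phi> v then 1 - x i else x i)"
      by (rule corner_chart[OF p(3,2) v(1)]) (rule that)
    have "T x u \<le> 1/2" if u: "u \<in> nbc K v C"
    proof -
      obtain i where i: "i < n" "T x u = (if i \<in> \<phi> v then 1 - x i else x i)" using T(2)[OF u, of x] by blast
      have "i \<in> \<phi> v \<longleftrightarrow> x i > 1/2" using i(1) v(2) by simp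
      then show ?thesis using i(2) by (cases "i \<in> \<phi> v") simp_all
    qed
    then show ?thesis unfolding p(1) T(1) crd_corner_point[OF p(2) v(1)] by simp
  qed
  ultimately show ?thesis using that by blast
qed

end

section \<open>The flag condition\<close>

text \<open>\<open>CAT0_space\<close> makes a claim about every comparison triangle; to use it, one
  with the given sides has to be exhibited.\<close>

lemma comparison_triangle:
  fixes a b c :: real
  assumes "0 \<le> a" "0 \<le> b" "0 \<le> c" "c \<le> a + b" "a \<le> b + c" "b \<le> a + c"
  obtains p q r :: "real^2" where "dist p q = a" "dist p r = b" "dist q r = c"
proof (cases "a = 0")
  case True
  then have "b = c" using assms by simp
  have "dist (0 :: real^2) (vector [b, 0]) = b"
    using assms(2) by (simp add: dist_norm norm_vec_def L2_set_def sum_2)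
  then show ?thesis using that[of 0 0 "vector [b, 0]"] True \<open>b = c\<close> by simp
next
  case False
  then have a: "a > 0" using assms by simp
  \<comment> \<open>By the law of cosines, this is the first coordinate of the third vertex when the
    other two are the origin and (a, 0).\<close>
  define x where "x = (a\<^sup>2 + b\<^sup>2 - c\<^sup>2) / (2 * a)"
  have xa: "2 * a * x = a\<^sup>2 + b\<^sup>2 - c\<^sup>2" using a by (simp add: x_def)
  have "(a - b)\<^sup>2 \<le> c\<^sup>2" using assms by (intro power2_le_iff_abs_le[THEN iffD2]) auto
  then have "a\<^sup>2 + b\<^sup>2 - c\<^sup>2 \<le> 2 * a * b" by (simp add: power2_diff)
  then have x1: "x \<le> b" using a xa by (metis mult_le_cancel_left_pos mult_pos_pos zero_less_numeral)
  have "c\<^sup>2 \<le> (a + b)\<^sup>2" using assms by (intro power_mono) auto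
  then have "2 * a * (- b) \<le> 2 * a * x" unfolding xa by (simp add: power2_sum)
  then have x2: "- b \<le> x" using a by (metis mult_le_cancel_left_pos mult_pos_pos zero_less_numeral)
  have xb: "x\<^sup>2 \<le> b\<^sup>2" using x1 x2 assms(2) by (intro power2_le_iff_abs_le[THEN iffD2]) auto
  define y where "y = sqrt (b\<^sup>2 - x\<^sup>2)"
  have y: "y\<^sup>2 = b\<^sup>2 - x\<^sup>2" using xb by (simp add: y_def)
  have "dist (0 :: real^2) (vector [a, 0]) = a"
    using assms(1) by (simp add: dist_norm norm_vec_def L2_set_def sum_2)
  moreover have "dist (0 :: real^2) (vector [x, y]) = b"
    using assms(2) y by (simp add: dist_norm norm_vec_def L2_set_def sum_2)
  moreover have "dist (vector [a, 0] :: real^2) (vector [x, y]) = c"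
  proof -
    have "(a - x)\<^sup>2 + y\<^sup>2 = c\<^sup>2" using y xa by (simp add: power2_diff algebra_simps)
    then show ?thesis using assms(3) by (simp add: dist_norm norm_vec_def L2_set_def sum_2)
  qed
  ultimately show ?thesis using that by blast
qed

lemma L2_set_restrict:
  assumes "finite A" "finite B" "\<And>u. f u \<noteq> 0 \<Longrightarrow> u \<in> A \<inter> B"
  shows "L2_set f A = L2_set f B"
proof -
  have "(\<Sum>u\<in>A. (f u)\<^sup>2) = (\<Sum>u\<in>A \<inter> B. (f u)\<^sup>2)"
    by (rule sum.mono_neutral_right) (use assms in auto)
  also have "\<dots> = (\<Sum>u\<in>B. (f u)\<^sup>2)"
    by (rule sum.mono_neutral_left) (use assms in auto)
  finally show ?thesis by (simp add: L2_set_def)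
qed

text \<open>By the parallelogram identity the squared norm of \<open>f + h - 2 * g\<close> is at
  most 2 * (D/2)^2 + 2 * (D/2)^2 - D^2 = 0.\<close>

lemma L2_set_midpoint:
  assumes A: "finite A" and fg: "L2_set (\<lambda>u. f u - g u) A \<le> D / 2" and hg: "L2_set (\<lambda>u. h u - g u) A \<le> D / 2"
    and fh: "L2_set (\<lambda>u. f u - h u) A = D" and u: "u \<in> A"
  shows "g u = (f u + h u) / 2"
proof -
  have sq: "(L2_set k A)\<^sup>2 = (\<Sum>u\<in>A. (k u)\<^sup>2)" for k
    by (simp add: L2_set_def sum_nonneg)
  have "(L2_set (\<lambda>u. f u - g u) A)\<^sup>2 \<le> (D / 2)\<^sup>2" "(L2_set (\<lambda>u. h u - g u) A)\<^sup>2 \<le> (D / 2)\<^sup>2"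
    using fg hg by (auto intro!: power_mono)
  then have 1: "(\<Sum>u\<in>A. (f u - g u)\<^sup>2) \<le> D\<^sup>2 / 4" "(\<Sum>u\<in>A. (h u - g u)\<^sup>2) \<le> D\<^sup>2 / 4"
    unfolding sq by (simp_all add: power_divide)
  have 2: "(\<Sum>u\<in>A. (f u - h u)\<^sup>2) = D\<^sup>2" using sq[of "\<lambda>u. f u - h u"] fh by simp
  have "(\<Sum>u\<in>A. (f u + h u - 2 * g u)\<^sup>2) = (\<Sum>u\<in>A. 2 * (f u - g u)\<^sup>2 + 2 * (h u - g u)\<^sup>2 - (f u - h u)\<^sup>2)"
    by (rule sum.cong) (auto simp: power2_eq_square algebra_simps)
  also have "\<dots> = 2 * (\<Sum>u\<in>A. (f u - g u)\<^sup>2) + 2 * (\<Sum>u\<in>A. (h u - g u)\<^sup>2) - (\<Sum>u\<in>A. (f u - h u)\<^sup>2)"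
    by (simp add: sum_subtractf sum.distrib sum_distrib_left)
  also have "\<dots> \<le> 0" using 1 2 by simp
  finally have "(\<Sum>u\<in>A. (f u + h u - 2 * g u)\<^sup>2) = 0" by (simp add: sum_nonneg order.antisym)
  then have "(f u + h u - 2 * g u)\<^sup>2 = 0" using A u by (simp add: sum_nonneg_eq_0_iff)
  then show ?thesis by simp
qed

context cat0_cubical
begin

abbreviation "geo \<equiv> geodesic_from_to X ld"

lemma geo_ex: "p \<in> X \<Longrightarrow> q \<in> X \<Longrightarrow> \<exists>\<sigma>. geo \<sigma> p q"
  using cat0 by (simp add: CAT0_cubical_complex_def CAT0_space_def)

lemma geo_mem: "geo \<sigma> p q \<Longrightarrow> s \<in> {0..1} \<Longrightarrow> \<sigma> s \<in> X"
  by (auto simp: geodesic_from_to_def)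

lemma geo_dist: "geo \<sigma> p q \<Longrightarrow> s \<in> {0..1} \<Longrightarrow> t \<in> {0..1} \<Longrightarrow> ld (\<sigma> s) (\<sigma> t) = \<bar>s - t\<bar> * ld p q"
  by (auto simp: geodesic_from_to_def)

lemma geo_compare:
  assumes g: "geo \<sigma> p q" "geo \<tau> p r" and st: "s \<in> {0..1}" "t \<in> {0..1}"
  obtains p' q' r' :: "real^2" where "dist p' q' = ld p q" "dist p' r' = ld p r" "dist q' r' = ld q r"
    "ld (\<sigma> s) (\<tau> t) \<le> dist (p' + s *\<^sub>R (q' - p')) (p' + t *\<^sub>R (r' - p'))"
proof -
  have X: "p \<in> X" "q \<in> X" "r \<in> X" using g geo_mem[OF g(1), of 0] geo_mem[OF g(1), of 1] geo_mem[OF g(2), of 1]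
    by (auto simp: geodesic_from_to_def)
  obtain p' q' r' :: "real^2" where d: "dist p' q' = ld p q" "dist p' r' = ld p r" "dist q' r' = ld q r"
  proof (rule comparison_triangle[of "ld p q" "ld p r" "ld q r"])
    show "ld q r \<le> ld p q + ld p r" using M.triangle[of q p r] X M.commute by metis
    show "ld p q \<le> ld p r + ld q r" using M.triangle[of p r q] X M.commute by metis
    show "ld p r \<le> ld p q + ld q r" using M.triangle[of p q r] X by metis
  qed (auto intro: M.nonneg)
  have "CAT0_space X ld" using cat0 by (simp add: CAT0_cubical_complex_def)
  then have "ld (\<sigma> s) (\<tau> t) \<le> dist (p' + s *\<^sub>R (q' - p')) (p' + t *\<^sub>R (r' - p'))"
    unfolding CAT0_space_def using X g d st by blast
  with d show ?thesis using that by blast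
qed

text \<open>In the plane, points with equal parameter on two sides issuing from \<open>p'\<close>
  span a segment parallel to the third side and scaled by \<open>s\<close>.\<close>

lemma geo_convex:
  assumes g: "geo \<sigma> p q" "geo \<tau> p r" and s: "s \<in> {0..1}"
  shows "ld (\<sigma> s) (\<tau> s) \<le> ld q r"
proof -
  obtain p' q' r' :: "real^2" where d: "dist q' r' = ld q r"
    "ld (\<sigma> s) (\<tau> s) \<le> dist (p' + s *\<^sub>R (q' - p')) (p' + s *\<^sub>R (r' - p'))"
    using geo_compare[OF g s s] by metis
  note d(2)
  also have "dist (p' + s *\<^sub>R (q' - p')) (p' + s *\<^sub>R (r' - p')) = norm (s *\<^sub>R (q' - r'))"
    by (simp add: dist_norm algebra_simps)
  also have "\<dots> \<le> ld q r" using s d(1) by (simp add: dist_norm mult_left_le_one_le)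
  finally show ?thesis .
qed

text \<open>The midpoint of one side is compared with the far end of another. In the plane the
  median has exactly this length, so the result is the inequality of Bruhat and Tits.\<close>

lemma geo_median:
  assumes g: "geo \<sigma> p q" and r: "r \<in> X"
  shows "(ld (\<sigma> (1/2)) r)\<^sup>2 \<le> ((ld p r)\<^sup>2 + (ld q r)\<^sup>2) / 2 - (ld p q)\<^sup>2 / 4"
proof -
  have p: "p \<in> X" using g geo_mem[OF g, of 0] by (auto simp: geodesic_from_to_def)
  obtain \<tau> where t: "geo \<tau> p r" using geo_ex[OF p r] by blast
  then have t1: "\<tau> 1 = r" by (simp add: geodesic_from_to_def)
  obtain p' q' r' :: "real^2" where d: "dist p' q' = ld p q" "dist p' r' = ld p r" "dist q' r' = ld q r"
    "ld (\<sigma> (1/2)) (\<tau> 1) \<le> dist (p' + (1/2) *\<^sub>R (q' - p')) (p' + 1 *\<^sub>R (r' - p'))"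
    by (rule geo_compare[OF g t, of "1/2" 1]) auto
  have "(ld (\<sigma> (1/2)) r)\<^sup>2 \<le> (dist (p' + (1/2) *\<^sub>R (q' - p')) r')\<^sup>2"
    using d(4) unfolding t1 by (intro power_mono) (auto intro: M.nonneg)
  also have "p' + (1/2) *\<^sub>R (q' - p') = (1/2) *\<^sub>R (p' + q')"
    by (simp add: vec_eq_iff field_simps)
  also have "(dist ((1/2) *\<^sub>R (p' + q')) r')\<^sup>2 = ((dist p' r')\<^sup>2 + (dist q' r')\<^sup>2) / 2 - (dist p' q')\<^sup>2 / 4"
    unfolding dist_norm power2_norm_eq_inner by (simp add: inner_diff inner_add inner_commute field_simps)
  finally show ?thesis unfolding d .
qed

lemma crd_corner_fun:
  assumes C: "C \<in> K" "v \<in> C" and \<xi>: "\<And>u. \<xi> u \<noteq> 0 \<Longrightarrow> u \<in> nbc K v C"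
  shows "crd K v (corner_point K v C \<xi>) = \<xi>"
  using crd_corner_point[OF C] \<xi> by fastforce

lemma corner_point_indep:
  assumes C: "C \<in> K" "D \<in> K" "v \<in> C" "v \<in> D" and \<xi>: "\<And>u. \<xi> u \<noteq> 0 \<Longrightarrow> u \<in> C \<and> u \<in> D"
  shows "corner_point K v C \<xi> = corner_point K v D \<xi>"
proof -
  have I: "C \<inter> D \<in> K" "v \<in> C \<inter> D" using cube_Int C by auto
  have "corner_point K v C \<xi> = corner_point K v (C \<inter> D) \<xi>"
    by (rule corner_point_face[OF C(1) I(1) C(3) I(2)]) (use \<xi> in auto)
  moreover have "corner_point K v D \<xi> = corner_point K v (C \<inter> D) \<xi>"
    by (rule corner_point_face[OF C(2) I(1) C(4) I(2)]) (use \<xi> in auto)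
  ultimately show ?thesis by simp
qed

text \<open>The segment in \<open>C\<close> gives the upper bound and the coordinates at
  \<open>v\<close> give the lower one. The bounds 1/4 and 1/2 add up to less than 1, as
  \<open>ld_crd_lower\<close> demands.\<close>

lemma ld_corner_eq:
  assumes C: "C \<in> K" "v \<in> C" and \<xi>: "\<And>u. u \<in> nbc K v C \<Longrightarrow> 0 \<le> \<xi> u \<and> \<xi> u \<le> 1/4"
    and \<eta>: "\<And>u. u \<in> nbc K v C \<Longrightarrow> 0 \<le> \<eta> u \<and> \<eta> u \<le> 1/4"
    and c: "L2_set (\<lambda>u. \<xi> u - \<eta> u) (nbc K v C) \<le> 1/2"
  shows "ld (corner_point K v C \<xi>) (corner_point K v C \<eta>) = L2_set (\<lambda>u. \<xi> u - \<eta> u) (nbc K v C)"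
proof (rule order.antisym)
  have \<xi>1: "0 \<le> \<xi> u \<and> \<xi> u \<le> 1" if "u \<in> nbc K v C" for u using \<xi>[OF that] by auto
  have \<eta>1: "0 \<le> \<eta> u \<and> \<eta> u \<le> 1" if "u \<in> nbc K v C" for u using \<eta>[OF that] by auto
  show "ld (corner_point K v C \<xi>) (corner_point K v C \<eta>) \<le> L2_set (\<lambda>u. \<xi> u - \<eta> u) (nbc K v C)"
    by (rule ld_corner[OF C \<xi>1 \<eta>1])
  have "L2_set (\<lambda>u. crd K v (corner_point K v C \<xi>) u - crd K v (corner_point K v C \<eta>) u) (nbs K v)
      \<le> ld (corner_point K v C \<xi>) (corner_point K v C \<eta>)"
  proof (rule ld_crd_lower[where c = "1/2"])
    show "corner_point K v C \<xi> v \<noteq> 0" by (rule corner_point_nz[OF C]) (use \<xi> in force)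
    show "crd K v (corner_point K v C \<xi>) u + 1/2 < 1" for u
      unfolding crd_corner_point[OF C] using \<xi>[of u] by auto
  qed (use c L2_crd_corner[OF C] corner_point_realization[OF C] \<xi>1 \<eta>1 in auto)
  then show "L2_set (\<lambda>u. \<xi> u - \<eta> u) (nbc K v C) \<le> ld (corner_point K v C \<xi>) (corner_point K v C \<eta>)"
    unfolding L2_crd_corner[OF C] .
qed

text \<open>The point with coordinate \<open>b\<close> on the edge \<open>u3\<close> and the point with all other coordinates \<open>b\<close>
  are, by the median inequality, no farther apart than they would be in a cube spanned by all of \<open>U\<close>.
  Coordinates at \<open>v\<close> do not expand distances, so the midpoint of the two has all coordinates
  \<open>b / 2\<close>, and the cube carrying it contains \<open>U\<close>.\<close>

lemma flag_step:
  assumes U: "finite U" "\<And>a. a \<in> U \<Longrightarrow> (v, a) \<in> E"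
    and u: "u1 \<in> U" "u2 \<in> U" "u3 \<in> U" "u1 \<noteq> u2" "u1 \<noteq> u3" "u2 \<noteq> u3"
    and C1: "C1 \<in> K" "v \<in> C1" "U - {u1} \<subseteq> C1"
    and C2: "C2 \<in> K" "v \<in> C2" "U - {u2} \<subseteq> C2"
    and C3: "C3 \<in> K" "v \<in> C3" "U - {u3} \<subseteq> C3"
  shows "\<exists>C\<in>K. v \<in> C \<and> U \<subseteq> C"
proof -
  define R where "R = U - {u1, u2, u3}"
  have UR: "U = insert u1 (insert u2 (insert u3 R))" using u by (auto simp: R_def)
  have R: "finite R" "u1 \<notin> R" "u2 \<notin> R" "u3 \<notin> R" using U by (auto simp: R_def)
  define m where "m = real (card R)"
  have m0: "m \<ge> 0" by (simp add: m_def)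
  have sumU: "(\<Sum>u\<in>U. f u) = f u1 + f u2 + f u3 + (\<Sum>u\<in>R. f u)" for f :: "'v \<Rightarrow> real"
    unfolding UR using R u by simp
  \<comment> \<open>The points below have coordinates 0, \<open>b\<close> or \<open>2 * b\<close>.
    With this \<open>b\<close>, a coordinate distance sqrt (k * b^2) with k at most (m + 3)^2 does
    not exceed 1/8, well within the range where coordinates determine distances.\<close>
  define b where "b = 1 / (8 * (m + 3))"
  have b: "b > 0" "b * (m + 3) = 1 / 8" using m0 by (auto simp: b_def)
  have b8: "b \<le> 1/24"
  proof -
    have "b * 3 \<le> b * (m + 3)" using b(1) m0 by simp
    then show ?thesis using b by simp
  qed
  have sqrt_le: "sqrt (k * b\<^sup>2) \<le> 1/2" if "0 \<le> k" "k \<le> (m + 3)\<^sup>2" for k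
  proof -
    have "k * b\<^sup>2 \<le> (m + 3)\<^sup>2 * b\<^sup>2" using that by (intro mult_right_mono) auto
    also have "\<dots> = (1/8)\<^sup>2" using b(2) by (simp add: power_mult_distrib[symmetric] mult.commute)
    finally have "sqrt (k * b\<^sup>2) \<le> sqrt ((1/8)\<^sup>2)" by (rule real_sqrt_le_mono)
    then show ?thesis by simp
  qed
  \<comment> \<open>\<open>q1\<close> and \<open>q2\<close> are chosen to have midpoint
    \<open>q\<close>. Each pair among \<open>p\<close>, \<open>q1\<close>, \<open>q2\<close> avoids
    one of \<open>u1\<close>, \<open>u2\<close>, \<open>u3\<close> and so lies in one of the three
    given cubes. In units of b^2 the squared sides from \<open>p\<close> are at most m + 5 and the
    third is 8; the median inequality gives m + 5 - 8/4 = m + 3, the value that a cube spanned by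
    \<open>U\<close> would have.\<close>
  define \<xi>p where "\<xi>p u = (if u = u3 then b else 0)" for u
  define \<xi>1 where "\<xi>1 u = (if u = u2 then 2 * b else if u \<in> R then b else 0)" for u
  define \<xi>2 where "\<xi>2 u = (if u = u1 then 2 * b else if u \<in> R then b else 0)" for u
  define \<xi>q where "\<xi>q u = (if u \<in> U - {u3} then b else 0)" for u
  note defs = \<xi>p_def \<xi>1_def \<xi>2_def \<xi>q_def
  have bd: "0 \<le> \<xi>p u \<and> \<xi>p u \<le> 1/4" "0 \<le> \<xi>1 u \<and> \<xi>1 u \<le> 1/4" "0 \<le> \<xi>2 u \<and> \<xi>2 u \<le> 1/4" "0 \<le> \<xi>q u \<and> \<xi>q u \<le> 1/4" for u
    using b b8 by (auto simp: defs)
  have bd1: "0 \<le> \<xi>p u \<and> \<xi>p u \<le> 1" "0 \<le> \<xi>1 u \<and> \<xi>1 u \<le> 1" "0 \<le> \<xi>2 u \<and> \<xi>2 u \<le> 1" "0 \<le> \<xi>q u \<and> \<xi>q u \<le> 1" for u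
    using bd[of u] by auto
  have sp: "\<xi>p u \<noteq> 0 \<Longrightarrow> u = u3" "\<xi>1 u \<noteq> 0 \<Longrightarrow> u \<in> insert u2 R" "\<xi>2 u \<noteq> 0 \<Longrightarrow> u \<in> insert u1 R" "\<xi>q u \<noteq> 0 \<Longrightarrow> u \<in> U - {u3}" for u
    by (auto simp: defs split: if_splits)
  have in1: "insert u2 (insert u3 R) \<subseteq> C1" and in2: "insert u1 (insert u3 R) \<subseteq> C2" and in3: "insert u1 (insert u2 R) \<subseteq> C3"
    using C1(3) C2(3) C3(3) u by (auto simp: R_def)
  have nb1: "insert u2 (insert u3 R) \<subseteq> nbc K v C1" and nb2: "insert u1 (insert u3 R) \<subseteq> nbc K v C2" and nb3: "insert u1 (insert u2 R) \<subseteq> nbc K v C3"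
    using in1 in2 in3 U(2) UR by (auto simp: nbc_def)
  have fn: "finite (nbc K v C1)" "finite (nbc K v C2)" "finite (nbc K v C3)" using nbc_finite C1 C2 C3 by auto
  define p where "p = corner_point K v C1 \<xi>p"
  define q1 where "q1 = corner_point K v C3 \<xi>1"
  define q2 where "q2 = corner_point K v C3 \<xi>2"
  define q where "q = corner_point K v C3 \<xi>q"
  have p2: "p = corner_point K v C2 \<xi>p" unfolding p_def
    by (rule corner_point_indep[OF C1(1) C2(1) C1(2) C2(2)], drule sp(1)) (use in1 in2 in auto)
  have q11: "q1 = corner_point K v C1 \<xi>1" unfolding q1_def
    by (rule corner_point_indep[OF C3(1) C1(1) C3(2) C1(2)], drule sp(2)) (use in1 in3 in auto)
  have q22: "q2 = corner_point K v C2 \<xi>2" unfolding q2_def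
    by (rule corner_point_indep[OF C3(1) C2(1) C3(2) C2(2)], drule sp(3)) (use in2 in3 in auto)
  have X: "p \<in> X" "q1 \<in> X" "q2 \<in> X" "q \<in> X"
    unfolding p_def q1_def q2_def q_def using corner_point_realization C1 C3 bd1 by auto
  have cp: "crd K v p = \<xi>p" unfolding p_def
    by (rule crd_corner_fun[OF C1(1,2)], drule sp(1)) (use nb1 in auto)
  have cq: "crd K v q = \<xi>q" unfolding q_def
    by (rule crd_corner_fun[OF C3(1,2)], drule sp(4)) (use nb3 UR in auto)
  have lt1: "\<xi>p u < 1" "\<xi>q u < 1" for u using bd(1,4)[of u] by auto
  have pv: "p v \<noteq> 0" unfolding p_def by (rule corner_point_nz[OF C1(1,2)]) (rule lt1)
  have qv: "q v \<noteq> 0" unfolding q_def by (rule corner_point_nz[OF C3(1,2)]) (rule lt1)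
  have toU: "L2_set f A = sqrt ((f u1)\<^sup>2 + (f u2)\<^sup>2 + (f u3)\<^sup>2 + (\<Sum>u\<in>R. (f u)\<^sup>2))"
    if "finite A" "\<And>u. f u \<noteq> 0 \<Longrightarrow> u \<in> A \<inter> U" for f A
    using L2_set_restrict[OF that(1) U(1) that(2)] unfolding L2_set_def sumU by simp
  have sumR: "(\<Sum>u\<in>R. (f u)\<^sup>2) = m * b\<^sup>2" if "\<And>u. u \<in> R \<Longrightarrow> (f u)\<^sup>2 = b\<^sup>2" for f
    using that by (simp add: m_def)
  have sumR0: "(\<Sum>u\<in>R. (f u)\<^sup>2) = 0" if "\<And>u. u \<in> R \<Longrightarrow> f u = 0" for f :: "'v \<Rightarrow> real"
    using that by simp
  have ne: "u1 \<noteq> u2" "u2 \<noteq> u1" "u1 \<noteq> u3" "u3 \<noteq> u1" "u2 \<noteq> u3" "u3 \<noteq> u2" using u by auto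
  have L1: "L2_set (\<lambda>u. \<xi>p u - \<xi>1 u) (nbc K v C1) = sqrt ((m + 5) * b\<^sup>2)"
  proof -
    have s: "(\<Sum>u\<in>R. (\<xi>p u - \<xi>1 u)\<^sup>2) = m * b\<^sup>2" by (rule sumR) (use R in \<open>auto simp: defs\<close>)
    show ?thesis by (subst toU[OF fn(1)]) (use nb1 UR s R ne in \<open>auto simp: defs algebra_simps split: if_splits\<close>)
  qed
  have L2: "L2_set (\<lambda>u. \<xi>p u - \<xi>2 u) (nbc K v C2) = sqrt ((m + 5) * b\<^sup>2)"
  proof -
    have s: "(\<Sum>u\<in>R. (\<xi>p u - \<xi>2 u)\<^sup>2) = m * b\<^sup>2" by (rule sumR) (use R in \<open>auto simp: defs\<close>)
    show ?thesis by (subst toU[OF fn(2)]) (use nb2 UR s R ne in \<open>auto simp: defs algebra_simps split: if_splits\<close>)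
  qed
  have L3: "L2_set (\<lambda>u. \<xi>1 u - \<xi>2 u) (nbc K v C3) = sqrt (8 * b\<^sup>2)"
  proof -
    have s: "(\<Sum>u\<in>R. (\<xi>1 u - \<xi>2 u)\<^sup>2) = 0" by (rule sumR0) (use R in \<open>auto simp: defs\<close>)
    show ?thesis by (subst toU[OF fn(3)]) (use nb3 UR s R ne in \<open>auto simp: defs algebra_simps split: if_splits\<close>)
  qed
  define D where "D = sqrt ((m + 3) * b\<^sup>2)"
  have LD: "L2_set (\<lambda>u. \<xi>p u - \<xi>q u) (nbs K v) = D"
  proof -
    have s: "(\<Sum>u\<in>R. (\<xi>p u - \<xi>q u)\<^sup>2) = m * b\<^sup>2" by (rule sumR) (use R UR in \<open>auto simp: defs\<close>)
    show ?thesis unfolding D_def by (subst toU[OF finite_nbs]) (use U(2) UR s R ne in \<open>auto simp: defs nbs_def algebra_simps split: if_splits\<close>)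
  qed
  have d1: "ld p q1 \<le> sqrt ((m + 5) * b\<^sup>2)"
    unfolding p_def q11 L1[symmetric] by (rule ld_corner[OF C1(1,2)]) (rule bd1)+
  have d2: "ld p q2 \<le> sqrt ((m + 5) * b\<^sup>2)"
    unfolding p2 q22 L2[symmetric] by (rule ld_corner[OF C2(1,2)]) (rule bd1)+
  \<comment> \<open>The straight segment in \<open>C3\<close>. Its distances must be known exactly:
    the median inequality requires a geodesic, and its length enters with a minus sign.\<close>
  define \<sigma> where "\<sigma> t = corner_point K v C3 (\<lambda>u. (1 - t) * \<xi>1 u + t * \<xi>2 u)" for t
  have \<sigma>b: "0 \<le> (1 - t) * \<xi>1 u + t * \<xi>2 u \<and> (1 - t) * \<xi>1 u + t * \<xi>2 u \<le> 1/4" if "t \<in> {0..1}" for t u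
  proof -
    have "(1 - t) * \<xi>1 u + t * \<xi>2 u \<le> (1 - t) * (1/4) + t * (1/4)"
      using that bd(2,3)[of u] by (intro add_mono mult_left_mono) auto
    also have "\<dots> = 1/4" by (simp add: field_simps)
    finally show ?thesis using that bd(2,3)[of u] by simp
  qed
  have s8: "sqrt (8 * b\<^sup>2) \<le> 1/2"
  proof (rule sqrt_le)
    have "(3::real)\<^sup>2 \<le> (m + 3)\<^sup>2" using m0 by (intro power_mono) auto
    then show "8 \<le> (m + 3)\<^sup>2" by simp
  qed simp
  have \<sigma>d: "ld (\<sigma> s) (\<sigma> t) = \<bar>s - t\<bar> * sqrt (8 * b\<^sup>2)" if st: "s \<in> {0..1}" "t \<in> {0..1}" for s t
  proof -
    have "L2_set (\<lambda>u. ((1 - s) * \<xi>1 u + s * \<xi>2 u) - ((1 - t) * \<xi>1 u + t * \<xi>2 u)) (nbc K v C3)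
        = L2_set (\<lambda>u. \<bar>s - t\<bar> * (\<xi>1 u - \<xi>2 u)) (nbc K v C3)"
      unfolding L2_set_def
    proof (intro arg_cong[where f = sqrt] sum.cong HOL.refl)
      fix u
      have "((1 - s) * \<xi>1 u + s * \<xi>2 u) - ((1 - t) * \<xi>1 u + t * \<xi>2 u) = (t - s) * (\<xi>1 u - \<xi>2 u)"
        by (simp add: algebra_simps)
      then show "(((1 - s) * \<xi>1 u + s * \<xi>2 u) - ((1 - t) * \<xi>1 u + t * \<xi>2 u))\<^sup>2 = (\<bar>s - t\<bar> * (\<xi>1 u - \<xi>2 u))\<^sup>2"
        by (simp add: power_mult_distrib power2_commute)
    qed
    also have "\<dots> = \<bar>s - t\<bar> * sqrt (8 * b\<^sup>2)"
      unfolding L3[symmetric] by (rule L2_set_right_distrib[symmetric]) simp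
    finally have L: "L2_set (\<lambda>u. ((1 - s) * \<xi>1 u + s * \<xi>2 u) - ((1 - t) * \<xi>1 u + t * \<xi>2 u)) (nbc K v C3)
        = \<bar>s - t\<bar> * sqrt (8 * b\<^sup>2)" .
    have "\<bar>s - t\<bar> * sqrt (8 * b\<^sup>2) \<le> 1 * (1/2)" using st s8 by (intro mult_mono) auto
    then show ?thesis unfolding \<sigma>_def using ld_corner_eq[OF C3(1,2) \<sigma>b[OF st(1)] \<sigma>b[OF st(2)]] L by simp
  qed
  have \<sigma>0: "\<sigma> 0 = q1" "\<sigma> 1 = q2" by (simp_all add: \<sigma>_def q1_def q2_def)
  have \<sigma>h: "\<sigma> (1/2) = q" unfolding \<sigma>_def q_def
    by (rule corner_point_cong) (use R UR ne in \<open>auto simp: defs\<close>, (use nb3 in \<open>auto simp: UR\<close>)?)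
  have dq: "ld q1 q2 = sqrt (8 * b\<^sup>2)" using \<sigma>d[of 0 1] \<sigma>0 by simp
  have "geo \<sigma> q1 q2" unfolding geodesic_from_to_def
  proof (intro conjI ballI)
    show "\<sigma> ` {0..1} \<subseteq> X"
    proof safe
      fix t :: real assume t: "t \<in> {0..1}"
      have "0 \<le> (1 - t) * \<xi>1 u + t * \<xi>2 u \<and> (1 - t) * \<xi>1 u + t * \<xi>2 u \<le> 1" for u using \<sigma>b[OF t, of u] by simp
      then show "\<sigma> t \<in> X" unfolding \<sigma>_def by (rule corner_point_realization[OF C3(1,2)])
    qed
  qed (use \<sigma>0 \<sigma>d dq in auto)
  from geo_median[OF this X(1)] have "(ld q p)\<^sup>2 \<le> ((ld q1 p)\<^sup>2 + (ld q2 p)\<^sup>2) / 2 - (ld q1 q2)\<^sup>2 / 4" unfolding \<sigma>h .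
  moreover have "(ld q1 p)\<^sup>2 \<le> (m + 5) * b\<^sup>2"
    using power_mono[OF d1, of 2] m0 by (simp add: M.commute)
  moreover have "(ld q2 p)\<^sup>2 \<le> (m + 5) * b\<^sup>2"
    using power_mono[OF d2, of 2] m0 by (simp add: M.commute)
  moreover have "(ld q1 q2)\<^sup>2 = 8 * b\<^sup>2" using dq by simp
  ultimately have "(ld q p)\<^sup>2 \<le> (m + 3) * b\<^sup>2" by (simp add: algebra_simps)
  then have "ld q p \<le> D" unfolding D_def by (rule real_le_rsqrt)
  then have upper: "ld p q \<le> D" by (simp add: M.commute)
  have D2: "D \<le> 1/2" unfolding D_def
  proof (rule sqrt_le)
    have "(m + 3) * 1 \<le> (m + 3) * (m + 3)" using m0 by (intro mult_left_mono) auto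
    then show "m + 3 \<le> (m + 3)\<^sup>2" by (simp add: power2_eq_square)
  qed (use m0 in simp)
  have D0: "0 < D" unfolding D_def using m0 b by simp
  obtain \<tau> where \<tau>: "geo \<tau> p q" using geo_ex X by blast
  \<comment> \<open>This midpoint is within 1/4 of both ends, hence in the open star of
    \<open>v\<close>. The coordinate vectors of the ends are exactly \<open>D\<close> apart, so
    those of the midpoint are forced.\<close>
  define y where "y = \<tau> (1/2)"
  have yX: "y \<in> X" unfolding y_def by (rule geo_mem[OF \<tau>]) simp
  have \<tau>01: "\<tau> 0 = p" "\<tau> 1 = q" using \<tau> by (auto simp: geodesic_from_to_def)
  have py: "ld p y \<le> D / 2" using geo_dist[OF \<tau>, of 0 "1/2"] \<tau>01 upper by (simp add: y_def)
  have qy: "ld q y \<le> D / 2" using geo_dist[OF \<tau>, of 1 "1/2"] \<tau>01 upper by (simp add: y_def)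
  have r: "crd K v p u + 1/2 \<le> 1" "crd K v q u + 1/2 \<le> 1" for u unfolding cp cq using bd[of u] by auto
  have l: "ld p y < 1/2" "ld q y < 1/2" using py qy D2 D0 by auto
  have yv: "y v \<noteq> 0" using open_star(1)[OF X(1) yX pv l(1) r(1)] .
  have mid: "crd K v y u = (\<xi>p u + \<xi>q u) / 2" if "u \<in> nbs K v" for u
  proof (rule L2_set_midpoint[OF finite_nbs _ _ LD that])
    show "L2_set (\<lambda>u. \<xi>p u - crd K v y u) (nbs K v) \<le> D / 2"
      using open_star(3)[OF X(1) yX pv l(1) r(1)] py unfolding cp by simp
    show "L2_set (\<lambda>u. \<xi>q u - crd K v y u) (nbs K v) \<le> D / 2"
      using open_star(3)[OF X(4) yX qv l(2) r(2)] qy unfolding cq by simp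
  qed
  have pos: "crd K v y u \<noteq> 0" if "u \<in> U" for u
  proof -
    have "\<xi>p u + \<xi>q u = b" using that by (auto simp: defs)
    then show ?thesis using mid[of u] U(2)[OF that] b(1) by (simp add: nbs_def)
  qed
  have "u \<in> carrier_of y" if uU: "u \<in> U" for u
  proof -
    obtain w where w: "y w \<noteq> 0" "u \<in> lab K v w"
      using pos[OF uU] unfolding crd_def by (metis (mono_tags, lifting) mem_Collect_eq sum.neutral)
    have "mc v w \<subseteq> carrier_of y"
      by (rule min_cube_subset[OF carrier_of_cube[OF yX]]) (use yv w in \<open>auto simp: carrier_of_def\<close>)
    then show ?thesis using w(2) by (auto simp: lab_def nbc_def)
  qed
  then show ?thesis using carrier_of_cube[OF yX] yv by (intro bexI[of _ "carrier_of y"]) (auto simp: carrier_of_def)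
qed

text \<open>Sets with at most two elements are immediate. In a larger set, deleting any one of three
  chosen directions leaves a set covered by induction, and \<open>flag_step\<close> joins the three
  resulting cubes.\<close>

lemma flag:
  assumes "v \<in> verts K" "finite U" "\<And>a. a \<in> U \<Longrightarrow> (v, a) \<in> E"
    "\<And>a b. a \<in> U \<Longrightarrow> b \<in> U \<Longrightarrow> a \<noteq> b \<Longrightarrow> \<exists>C\<in>K. v \<in> C \<and> a \<in> C \<and> b \<in> C"
  shows "\<exists>C\<in>K. v \<in> C \<and> U \<subseteq> C"
  using assms(2-)
proof (induction "card U" arbitrary: U rule: less_induct)
  case less
  consider "card U = 0" | "card U = 1" | "card U = 2" | "card U \<ge> 3" by linarith
  then show ?case
  proof cases
    case 1
    then have "U = {}" using less.prems by simp
    then show ?thesis using vert_single[OF assms(1)] by auto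
  next
    case 2
    then obtain a where "U = {a}" by (meson card_1_singletonE)
    then show ?thesis using less.prems(2)[of a] by (auto simp: edges_def)
  next
    case 3
    then obtain a b where "U = {a, b}" "a \<noteq> b" by (meson card_2_iff)
    then show ?thesis using less.prems(3)[of a b] by auto
  next
    case 4
    have "\<exists>A\<subseteq>U. card A = 3" using 4 by (meson obtain_subset_with_card_n)
    then obtain u1 u2 u3 where u: "u1 \<in> U" "u2 \<in> U" "u3 \<in> U" "u1 \<noteq> u2" "u1 \<noteq> u3" "u2 \<noteq> u3"
      by (auto simp: card_3_iff)
    have "\<exists>C\<in>K. v \<in> C \<and> U - {w} \<subseteq> C" if "w \<in> U" for w
    proof (rule less.hyps)
      show "card (U - {w}) < card U" using less.prems(1) that by (rule card_Diff1_less)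
    qed (use less.prems in auto)
    note C = this
    obtain C1 where C1: "C1 \<in> K" "v \<in> C1" "U - {u1} \<subseteq> C1" using C[OF u(1)] by blast
    obtain C2 where C2: "C2 \<in> K" "v \<in> C2" "U - {u2} \<subseteq> C2" using C[OF u(2)] by blast
    obtain C3 where C3: "C3 \<in> K" "v \<in> C3" "U - {u3} \<subseteq> C3" using C[OF u(3)] by blast
    show ?thesis by (rule flag_step[OF less.prems(1) less.prems(2) u C1 C2 C3])
  qed
qed

end

section \<open>Local systems\<close>

context cubical
begin

lemma lab_edge_insert:
  assumes C: "C \<in> K" "v \<in> C" and ab: "a \<in> C" "b \<in> C" and i: "i \<notin> lab K v a" "lab K v b = insert i (lab K v a)"
  shows "(a, b) \<in> E"
proof -
  have "i \<in> nbc K v C" using lab_subset[OF C ab(2)] i by auto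
  then show ?thesis unfolding lab_edge[OF C ab] using i by (intro bexI[of _ i]) auto
qed

lemma lab_edge_cases:
  assumes C: "C \<in> K" "v \<in> C" and ab: "a \<in> C" "b \<in> C" and e: "(a, b) \<in> E"
  obtains i where "i \<in> nbc K v C" "i \<notin> lab K v a" "lab K v b = insert i (lab K v a)"
  | i where "i \<in> nbc K v C" "i \<notin> lab K v b" "lab K v a = insert i (lab K v b)"
proof -
  obtain i where i: "i \<in> nbc K v C" "lab K v b = sym_diff (lab K v a) {i}"
    using e unfolding lab_edge[OF C ab] by blast
  show ?thesis
  proof (cases "i \<in> lab K v a")
    case True
    then have "i \<notin> lab K v b" "lab K v a = insert i (lab K v b)" using i(2) by auto
    then show ?thesis using that(2) i(1) by blast
  next
    case False
    then have "lab K v b = insert i (lab K v a)" using i(2) by auto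
    then show ?thesis using that(1) i(1) False by blast
  qed
qed

lemma cube_induct [consumes 3, case_names base step]:
  assumes C: "C \<in> K" "v \<in> C" "u \<in> C" and base: "P v"
    and step: "\<And>a b. a \<in> C \<Longrightarrow> b \<in> C \<Longrightarrow> (a, b) \<in> E \<Longrightarrow> P a \<Longrightarrow> P b"
  shows "P u"
  using C(3)
proof (induction "card (lab K v u)" arbitrary: u rule: less_induct)
  case less
  have l: "lab K v u \<subseteq> nbc K v C" by (rule lab_subset[OF C(1,2) less.prems])
  then have f: "finite (lab K v u)" using nbc_finite[OF C(1)] finite_subset by blast
  have vv: "lab K v v = {}" using lab_self C by (auto simp: verts_def)
  show ?case
  proof (cases "lab K v u = {}")
    case True
    then have "u = v" using lab_inj[OF C(1,2) less.prems C(2)] vv by simp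
    then show ?thesis using base by simp
  next
    case False
    then obtain i where i: "i \<in> lab K v u" by blast
    obtain a where a: "a \<in> C" "lab K v a = lab K v u - {i}" using lab_ex[OF C(1,2), of "lab K v u - {i}"] l by auto
    have "card (lab K v a) < card (lab K v u)" unfolding a using f i by (rule card_Diff1_less)
    then have "P a" using less.hyps a(1) by blast
    moreover have "(a, u) \<in> E" by (rule lab_edge_insert[OF C(1,2) a(1) less.prems, of i]) (use a i in auto)
    ultimately show ?thesis using step a(1) less.prems by blast
  qed
qed

lemma cube_connected: "C \<in> K \<Longrightarrow> u \<in> C \<Longrightarrow> v \<in> C \<Longrightarrow> (u, v) \<in> E\<^sup>*"
  by (induction rule: cube_induct) (auto intro: rtrancl_into_rtrancl)

text \<open>Consecutive points of a string have their carriers inside one cube, whose corners are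
  joined by edges.\<close>

lemma string_connected:
  assumes "string_between K p q l" "u \<in> carrier_of p" "w \<in> carrier_of q"
  shows "(u, w) \<in> E\<^sup>*"
  using assms
proof (induction arbitrary: u rule: string_between.induct)
  case (refl p)
  then show ?case using cube_connected carrier_of_cube by blast
next
  case (step C n \<phi> x y q l)
  let ?m = "cube_point n C \<phi> y"
  have "?m \<in> realization K" using string_realization[OF step.hyps(5)] by blast
  then obtain w0 where w0: "w0 \<in> carrier_of ?m" using cube_nonempty carrier_of_cube by blast
  have "u \<in> C" "w0 \<in> C" using w0 step.prems by (auto simp: carrier_of_def cube_point_def split: if_splits)
  then have "(u, w0) \<in> E\<^sup>*" using cube_connected step.hyps by blast
  also have "(w0, w) \<in> E\<^sup>*" using step.IH w0 step.prems by blast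
  finally show ?case .
qed

end

text \<open>These are the data of a covering of the 2-skeleton, described by fibres over the
  vertices and bijections along the edges rather than by a covering complex.\<close>

locale local_system = cubical K for K :: "'v set set" +
  fixes S :: "'v \<Rightarrow> 'a set" and \<tau> :: "'v \<Rightarrow> 'v \<Rightarrow> 'a \<Rightarrow> 'a"
  assumes inverse: "(u, v) \<in> edges K \<Longrightarrow> a \<in> S u \<Longrightarrow> \<tau> u v a \<in> S v \<and> \<tau> v u (\<tau> u v a) = a"
    and square: "sq K x u y w \<Longrightarrow> a \<in> S x \<Longrightarrow> \<tau> u y (\<tau> x u a) = \<tau> w y (\<tau> x w a)"
begin

definition flat :: "'v set \<Rightarrow> ('v \<Rightarrow> 'a) \<Rightarrow> bool" where
  "flat C f \<longleftrightarrow> (\<forall>u\<in>C. f u \<in> S u) \<and> (\<forall>u\<in>C. \<forall>v\<in>C. (u, v) \<in> E \<longrightarrow> f v = \<tau> u v (f u))"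

lemma flat_subset: "flat C f \<Longrightarrow> D \<subseteq> C \<Longrightarrow> flat D f"
  unfolding flat_def by blast

lemma flat_single: "a \<in> S v \<Longrightarrow> flat {v} (\<lambda>_. a)"
  unfolding flat_def by (auto simp: edges_def)

lemma flat_unique:
  assumes C: "C \<in> K" "v \<in> C" "u \<in> C" and f: "flat C f" "flat C g" and v: "f v = g v"
  shows "f u = g u"
  using C by (induction rule: cube_induct) (use f v in \<open>auto simp: flat_def\<close>)

lemma flat_agree:
  assumes C: "C \<in> K" "D \<in> K" and f: "flat C f" "flat D g" and v: "v \<in> C" "v \<in> D" "f v = g v" and u: "u \<in> C" "u \<in> D"
  shows "f u = g u"
  by (rule flat_unique[of "C \<inter> D" v]) (use assms cube_Int flat_subset in auto)

text \<open>The section is extended over the cube one direction at a time: at a corner whose label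
  contains the new direction, its value is transported from the neighbour without that
  direction.\<close>

lemma flat_ex:
  assumes C: "C \<in> K" "v \<in> C" and a: "a \<in> S v"
  shows "\<exists>f. flat C f \<and> f v = a"
proof -
  have vv: "lab K v v = {}" using lab_self C by (auto simp: verts_def)
  have "\<exists>f. flat {w \<in> C. lab K v w \<subseteq> U} f \<and> f v = a" if "finite U" "U \<subseteq> nbc K v C" for U
    using that
  proof (induction rule: finite_induct)
    case empty
    have "{w \<in> C. lab K v w \<subseteq> {}} = {v}" using vv lab_inj[OF C _ C(2)] C by auto
    then show ?case using flat_single[OF a] by auto
  next
    case (insert i U)
    then obtain f where f: "flat {w \<in> C. lab K v w \<subseteq> U} f" "f v = a" by auto
    let ?D = "{w \<in> C. lab K v w \<subseteq> insert i U}"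
    define lo where "lo w = (SOME w'. w' \<in> C \<and> lab K v w' = lab K v w - {i})" for w
    have lo: "lo w \<in> C" "lab K v (lo w) = lab K v w - {i}" if "w \<in> C" for w
    proof -
      have "\<exists>w'. w' \<in> C \<and> lab K v w' = lab K v w - {i}"
        using lab_ex[OF C, of "lab K v w - {i}"] lab_subset[OF C that] by blast
      from someI_ex[OF this] show "lo w \<in> C" "lab K v (lo w) = lab K v w - {i}" unfolding lo_def by auto
    qed
    have loU: "lo w \<in> {w \<in> C. lab K v w \<subseteq> U}" if "w \<in> ?D" for w using lo[of w] that by auto
    have lo_edge: "(lo w, w) \<in> E" if "w \<in> C" "i \<in> lab K v w" for w
      by (rule lab_edge_insert[OF C lo(1) _, of w w i]) (use lo[of w] that in auto)
    define g where "g w = (if i \<in> lab K v w then \<tau> (lo w) w (f (lo w)) else f w)" for w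
    have gS: "g w \<in> S w" if "w \<in> ?D" for w
    proof (cases "i \<in> lab K v w")
      case True
      have "f (lo w) \<in> S (lo w)" using f(1) loU[OF that] unfolding flat_def by blast
      then show ?thesis unfolding g_def using inverse[OF lo_edge] that True by simp
    next
      case False
      then show ?thesis using that f(1) unfolding g_def flat_def by auto
    qed
    have up: "g w = \<tau> u w (g u)"
      if u: "u \<in> ?D" "w \<in> ?D" and k: "k \<in> nbc K v C" "k \<notin> lab K v u" "lab K v w = Set.insert k (lab K v u)" for u w k
    proof -
      have uC: "u \<in> C" "w \<in> C" using u by auto
      have e: "(u, w) \<in> E" by (rule lab_edge_insert[OF C uC k(2,3)])
      consider "k = i" | "k \<noteq> i" "i \<notin> lab K v u" | "k \<noteq> i" "i \<in> lab K v u" by blast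
      then show ?thesis
      proof cases
        case 1
        have "lo w = u" by (rule lab_inj[OF C lo(1)[OF uC(2)] uC(1)]) (use lo(2)[OF uC(2)] k 1 in auto)
        then show ?thesis unfolding g_def using k 1 by simp
      next
        case 2
        then have "u \<in> {w \<in> C. lab K v w \<subseteq> U}" "w \<in> {w \<in> C. lab K v w \<subseteq> U}" using u k by auto
        then show ?thesis using f(1) e 2 k unfolding g_def flat_def by auto
      next
        \<comment> \<open>The edge from \<open>u\<close> to \<open>w\<close> and its copy without
          direction \<open>i\<close> are opposite sides of a square, across which flatness is passed
          on.\<close>
        case 3
        have lw: "lab K v (lo w) = Set.insert k (lab K v (lo u))" using lo(2)[OF uC(1)] lo(2)[OF uC(2)] k 3 by auto
        have "sq K (lo u) u w (lo w)"
          by (rule lab_sq[OF C lo(1)[OF uC(1)] uC lo(1)[OF uC(2)], of i k])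
            (use insert.prems k 3 lo(2)[OF uC(1)] lo(2)[OF uC(2)] in auto)
        moreover have fl: "f (lo u) \<in> S (lo u)" using f(1) loU[OF u(1)] unfolding flat_def by blast
        ultimately have "\<tau> u w (\<tau> (lo u) u (f (lo u))) = \<tau> (lo w) w (\<tau> (lo u) (lo w) (f (lo u)))"
          by (rule square)
        moreover have "(lo u, lo w) \<in> E"
          by (rule lab_edge_insert[OF C lo(1)[OF uC(1)] lo(1)[OF uC(2)] _ lw]) (use k lo(2)[OF uC(1)] in auto)
        then have "f (lo w) = \<tau> (lo u) (lo w) (f (lo u))" using f(1) loU[OF u(1)] loU[OF u(2)] unfolding flat_def by blast
        ultimately show ?thesis unfolding g_def using 3 k by simp
      qed
    qed
    have "flat ?D g" unfolding flat_def
    proof (intro conjI ballI impI)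
      fix u w assume u: "u \<in> ?D" "w \<in> ?D" and e: "(u, w) \<in> E"
      have uC: "u \<in> C" "w \<in> C" using u by auto
      from C uC e show "g w = \<tau> u w (g u)"
      proof (cases rule: lab_edge_cases)
        case (1 i)
        then show ?thesis using up[OF u] by blast
      next
        case (2 i)
        then have "g u = \<tau> w u (g w)" using up[OF u(2,1)] by blast
        then show ?thesis using inverse[OF edges_sym[OF e] gS[OF u(2)]] by simp
      qed
    qed (rule gS)
    moreover have "g v = a" unfolding g_def using vv f(2) by simp
    ultimately show ?case by blast
  qed
  from this[OF nbc_finite[OF C(1)] order.refl] obtain f where f: "flat {w \<in> C. lab K v w \<subseteq> nbc K v C} f" "f v = a" by blast
  moreover have "{w \<in> C. lab K v w \<subseteq> nbc K v C} = C" using lab_subset[OF C] by auto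
  ultimately show ?thesis by auto
qed

end

section \<open>Transport along geodesics\<close>

context cat0_cubical
begin

definition vpoint :: "'v \<Rightarrow> 'v \<Rightarrow> real" where
  "vpoint v = (\<lambda>w. if w = v then 1 else 0)"

lemma carrier_vpoint: "carrier_of (vpoint v) = {v}"
  by (auto simp: carrier_of_def vpoint_def)

definition epoint :: "'v \<Rightarrow> 'v \<Rightarrow> real \<Rightarrow> 'v \<Rightarrow> real" where
  "epoint u v t = corner_point K u {u, v} (\<lambda>_. t)"

lemma epoint_eq:
  assumes e: "(u, v) \<in> E"
  shows "epoint u v t = (\<lambda>w. if w = u then 1 - t else if w = v then t else 0)"
proof -
  have C: "{u, v} \<in> K" "u \<noteq> v" using e by (auto simp: edges_def)
  have n: "nbc K u {u, v} = {v}" using e by (auto simp: nbc_def edges_def)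
  have "lab K u v = {v}" "lab K u u = {}" using lab_nb[OF C(1), of u v] n lab_self[of u] C by (auto simp: verts_def)
  then show ?thesis unfolding epoint_def corner_point_def n using C by (intro ext) auto
qed

lemma epoint_X: "(u, v) \<in> E \<Longrightarrow> t \<in> {0..1} \<Longrightarrow> epoint u v t \<in> X"
  unfolding epoint_def by (rule corner_point_realization) (auto simp: edges_def)

lemma epoint_ends: "(u, v) \<in> E \<Longrightarrow> epoint u v 0 = vpoint u" "(u, v) \<in> E \<Longrightarrow> epoint u v 1 = vpoint v"
  by (auto simp: epoint_eq vpoint_def edges_def fun_eq_iff)

lemma ld_epoint: "(u, v) \<in> E \<Longrightarrow> s \<in> {0..1} \<Longrightarrow> t \<in> {0..1} \<Longrightarrow> ld (epoint u v s) (epoint u v t) \<le> \<bar>s - t\<bar>"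
proof -
  assume e: "(u, v) \<in> E" and st: "s \<in> {0..1}" "t \<in> {0..1}"
  have n: "nbc K u {u, v} = {v}" using e by (auto simp: nbc_def edges_def)
  have "ld (epoint u v s) (epoint u v t) \<le> L2_set (\<lambda>_. s - t) (nbc K u {u, v})"
    unfolding epoint_def by (rule ld_corner) (use e st in \<open>auto simp: edges_def\<close>)
  then show ?thesis by (simp add: n L2_set_def)
qed

lemma vpoint_X: "v \<in> verts K \<Longrightarrow> vpoint v \<in> X"
proof -
  assume v: "v \<in> verts K"
  have n: "nbc K v {v} = {}" by (auto simp: nbc_def edges_def)
  have "corner_point K v {v} (\<lambda>_. 0) \<in> X" by (rule corner_point_realization) (use v vert_single in auto)
  moreover have "corner_point K v {v} (\<lambda>_. 0) = vpoint v" by (auto simp: corner_point_def vpoint_def n fun_eq_iff)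
  ultimately show ?thesis by simp
qed

lemma connected:
  assumes "x \<in> verts K" "y \<in> verts K"
  shows "(x, y) \<in> E\<^sup>*"
proof -
  obtain l where "string_between K (vpoint x) (vpoint y) l" using string_ex vpoint_X assms by blast
  then show ?thesis using string_connected[of "vpoint x" "vpoint y"] by (simp add: carrier_vpoint)
qed

lemma ld_vpoint_relpow:
  assumes "x \<in> verts K" "(x, y) \<in> E ^^ n"
  shows "ld (vpoint x) (vpoint y) \<le> real n"
  using assms(2)
proof (induction n arbitrary: y)
  case 0
  then show ?case using vpoint_X[OF assms(1)] by simp
next
  case (Suc n)
  then obtain w where w: "(x, w) \<in> E ^^ n" "(w, y) \<in> E" by auto
  have "ld (vpoint w) (vpoint y) \<le> 1" using ld_epoint[OF w(2), of 0 1] epoint_ends[OF w(2)] by simp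
  moreover have "ld (vpoint x) (vpoint y) \<le> ld (vpoint x) (vpoint w) + ld (vpoint w) (vpoint y)"
    using M.triangle vpoint_X edges_verts[OF w(2)] assms(1) by blast
  ultimately show ?case using Suc.IH[OF w(1)] by simp
qed

lemma ld_vpoint_vdist:
  assumes "x \<in> verts K" "y \<in> verts K"
  shows "ld (vpoint x) (vpoint y) \<le> real (vdist K x y)"
proof -
  obtain n where "(x, y) \<in> E ^^ n" using connected[OF assms] rtrancl_imp_relpow by blast
  then have "(x, y) \<in> E ^^ vdist K x y" unfolding vdist_def by (rule LeastI)
  then show ?thesis using ld_vpoint_relpow assms by blast
qed

text \<open>One vertex serves all points of the ball at once, so the carriers of any number of
  points close to \<open>x\<close> have a vertex in common.\<close>

lemma near_common:
  assumes "x \<in> X"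
  obtains v where "\<And>y. y \<in> X \<Longrightarrow> ld x y < 1/2 \<Longrightarrow> v \<in> carrier_of y"
proof -
  obtain v where v: "x v \<noteq> 0" "\<And>u. crd K v x u \<le> 1/2" using near_corner assms by blast
  have r: "crd K v x u + 1/2 \<le> 1" for u using v(2)[of u] by simp
  show ?thesis
  proof (rule that)
    fix y assume "y \<in> X" "ld x y < 1/2"
    from open_star(1)[OF assms this(1) v(1) this(2) r] show "v \<in> carrier_of y" by (simp add: carrier_of_def)
  qed
qed

text \<open>The value at \<open>z\<close> is carried along subdivided geodesics issuing from \<open>z\<close>, through the
  carriers of the subdivision points. Geodesics to nearby points stay close, so the carriers of
  corresponding points meet and the values carried to nearby points agree.\<close>

theorem sections:
  fixes S :: "'v \<Rightarrow> 'a set" and R :: nat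
  assumes "local_system K S \<tau>" and z: "z \<in> verts K" and a: "a \<in> S z"
  shows "\<exists>s. s z = a \<and> (\<forall>u v. (u, v) \<in> E \<longrightarrow> vdist K z u \<le> R \<longrightarrow> vdist K z v \<le> R \<longrightarrow> s v = \<tau> u v (s u))"
proof -
  interpret local_system K S \<tau> by fact
  \<comment> \<open>Geodesics of length at most \<open>R + 1\<close> are cut into steps shorter than
    1/6. End points to be compared are at most 1/3 apart, and 1/3 + 1/6 is the radius 1/2 of
    \<open>near_common\<close>. The extra 1 in \<open>R + 1\<close> makes room for the interior
    points of edges.\<close>
  define N where "N = 6 * R + 7"
  have N0: "0 < real N" and NR: "6 * (real R + 1) < real N" by (simp_all add: N_def)
  define \<gamma> where "\<gamma> p = (SOME \<sigma>. geo \<sigma> (vpoint z) p)" for p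
  have \<gamma>: "geo (\<gamma> p) (vpoint z) p" if "p \<in> X" for p
    unfolding \<gamma>_def using geo_ex[OF vpoint_X[OF z] that] by (rule someI_ex)
  define pt where "pt p j = \<gamma> p (real j / real N)" for p j
  have unit: "real j / real N \<in> {0..1}" if "j \<le> N" for j using that N0 by simp
  have ptX: "pt p j \<in> X" if "p \<in> X" "j \<le> N" for p j
    unfolding pt_def by (rule geo_mem[OF \<gamma>[OF that(1)] unit[OF that(2)]])
  have pt0: "pt p 0 = vpoint z" and ptN: "pt p N = p" if "p \<in> X" for p
    using \<gamma>[OF that] N0 by (auto simp: pt_def geodesic_from_to_def)
  define B where "B = {p \<in> X. ld (vpoint z) p \<le> real R + 1}"
  have BX: "p \<in> X" if "p \<in> B" for p using that by (simp add: B_def)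
  have pt_step: "ld (pt p j) (pt p (Suc j)) < 1/6" if "p \<in> B" "j < N" for p j
  proof -
    have "ld (pt p j) (pt p (Suc j)) = \<bar>real j / real N - real (Suc j) / real N\<bar> * ld (vpoint z) p"
      unfolding pt_def by (rule geo_dist[OF \<gamma>[OF BX[OF that(1)]]]) (use unit that in auto)
    also have "real j / real N - real (Suc j) / real N = - (1 / real N)"
      using N0 by (simp add: field_simps)
    finally have "ld (pt p j) (pt p (Suc j)) = ld (vpoint z) p / real N" by simp
    also have "\<dots> \<le> (real R + 1) / real N" using that N0 by (simp add: B_def divide_right_mono)
    also have "\<dots> < 1/6" using N0 NR by (simp add: field_simps)
    finally show ?thesis .
  qed
  have pt_close: "ld (pt p j) (pt q j) \<le> ld p q" if "p \<in> X" "q \<in> X" "j \<le> N" for p q j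
    unfolding pt_def by (rule geo_convex[OF \<gamma>[OF that(1)] \<gamma>[OF that(2)] unit[OF that(3)]])
  define cr where "cr p j = carrier_of (pt p j)" for p j
  have crK: "cr p j \<in> K" if "p \<in> X" "j \<le> N" for p j
    unfolding cr_def by (rule carrier_of_cube[OF ptX[OF that]])
  define ext where "ext C v b = (SOME f. flat C f \<and> f v = b)" for C v b
  have ext: "flat C (ext C v b) \<and> ext C v b v = b" if "C \<in> K" "v \<in> C" "b \<in> S v" for C v b
    unfolding ext_def using flat_ex[OF that] by (rule someI_ex)
  \<comment> \<open>\<open>F p j\<close> is to be a flat section over the carrier of the
    \<open>j\<close>-th point. It is continued from its value at an arbitrary vertex common to this
    carrier and the next.\<close>
  define F where "F p = rec_nat (\<lambda>_. a) (\<lambda>j f. let v = SOME v. v \<in> cr p j \<inter> cr p (Suc j) in ext (cr p (Suc j)) v (f v))" for p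
  have F0: "F p 0 = (\<lambda>_. a)" for p by (simp add: F_def)
  have FS: "F p (Suc j) = (let v = SOME v. v \<in> cr p j \<inter> cr p (Suc j) in ext (cr p (Suc j)) v (F p j v))" for p j
    by (simp add: F_def)
  have cr0: "cr p 0 = {z}" if "p \<in> X" for p by (simp add: cr_def pt0[OF that] carrier_vpoint)
  have Fstep: "flat (cr p (Suc j)) (F p (Suc j)) \<and> (\<forall>v\<in>cr p j \<inter> cr p (Suc j). F p (Suc j) v = F p j v)"
    if fl: "flat (cr p j) (F p j)" and p: "p \<in> B" and j: "j < N" for p j
  proof -
    define v where "v = (SOME v. v \<in> cr p j \<inter> cr p (Suc j))"
    have jN: "j \<le> N" "Suc j \<le> N" using j by auto
    obtain w where w: "\<And>y. y \<in> X \<Longrightarrow> ld (pt p j) y < 1/2 \<Longrightarrow> w \<in> carrier_of y"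
      by (rule near_common[OF ptX[OF BX[OF p] jN(1)]]) (rule that)
    have "w \<in> cr p j \<inter> cr p (Suc j)"
      using w[OF ptX[OF BX[OF p] jN(1)]] w[OF ptX[OF BX[OF p] jN(2)]] pt_step[OF p j] ptX[OF BX[OF p] jN(1)]
      by (simp add: cr_def)
    then have v: "v \<in> cr p j \<inter> cr p (Suc j)" unfolding v_def by (rule someI)
    have FSv: "F p (Suc j) = ext (cr p (Suc j)) v (F p j v)" unfolding FS Let_def v_def ..
    have "F p j v \<in> S v" using fl v by (simp add: flat_def)
    then have e: "flat (cr p (Suc j)) (F p (Suc j))" "F p (Suc j) v = F p j v"
      unfolding FSv using ext[OF crK[OF BX[OF p] jN(2)], of v] v by auto
    have "F p (Suc j) u = F p j u" if "u \<in> cr p j \<inter> cr p (Suc j)" for u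
      by (rule flat_agree[OF crK[OF BX[OF p] jN(2)] crK[OF BX[OF p] jN(1)] e(1) fl _ _ e(2)]) (use v that in auto)
    then show ?thesis using e(1) by blast
  qed
  have Fflat: "flat (cr p j) (F p j)" if "p \<in> B" "j \<le> N" for p j
    using that(2)
  proof (induction j)
    case 0
    then show ?case using flat_single[OF a] by (simp add: F0 cr0[OF BX[OF that(1)]])
  next
    case (Suc j)
    then show ?case using Fstep[of p j] that(1) by simp
  qed
  have Fagree: "F p (Suc j) v = F p j v" if "p \<in> B" "j < N" "v \<in> cr p j" "v \<in> cr p (Suc j)" for p j v
    using Fstep[OF Fflat[OF that(1)] that(1,2)] that by auto
  have close: "\<forall>v\<in>cr p j \<inter> cr q j. F p j v = F q j v" if p: "p \<in> B" "q \<in> B" "ld p q \<le> 1/3" and "j \<le> N" for p q j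
    using \<open>j \<le> N\<close>
  proof (induction j)
    case 0
    then show ?case by (simp add: F0)
  next
    case (Suc j)
    then have jN: "j \<le> N" "Suc j \<le> N" "j < N" by auto
    note X = BX[OF p(1)] BX[OF p(2)]
    note P = ptX[OF X(1) jN(1)] ptX[OF X(1) jN(2)] ptX[OF X(2) jN(1)] ptX[OF X(2) jN(2)]
    \<comment> \<open>One vertex lies in the carriers of two consecutive points of both geodesics.
      Agreement there at stage \<open>j\<close> gives agreement at the next stage, and flatness
      spreads it over the common face.\<close>
    obtain w where w: "\<And>y. y \<in> X \<Longrightarrow> ld (pt p j) y < 1/2 \<Longrightarrow> w \<in> carrier_of y"
      by (rule near_common[OF P(1)]) (rule that)
    have d: "ld (pt p j) (pt q j) \<le> 1/3" using pt_close[OF X jN(1)] p(3) by simp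
    have "ld (pt p j) (pt q (Suc j)) \<le> ld (pt p j) (pt q j) + ld (pt q j) (pt q (Suc j))"
      by (rule M.triangle[OF P(1,3,4)])
    then have d2: "ld (pt p j) (pt q (Suc j)) < 1/2" using d pt_step[OF p(2) jN(3)] by simp
    have ws: "w \<in> cr p j" "w \<in> cr p (Suc j)" "w \<in> cr q j" "w \<in> cr q (Suc j)"
      using w[OF P(1)] w[OF P(2)] w[OF P(3)] w[OF P(4)] d d2 pt_step[OF p(1) jN(3)] P(1) by (auto simp: cr_def)
    have "F p (Suc j) w = F q (Suc j) w"
      using Fagree[OF p(1) jN(3)] Fagree[OF p(2) jN(3)] Suc.IH[OF jN(1)] ws by auto
    then show ?case
      using flat_agree[OF crK[OF X(1) jN(2)] crK[OF X(2) jN(2)] Fflat[OF p(1) jN(2)] Fflat[OF p(2) jN(2)] ws(2,4)] by blast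
  qed
  define s where "s v = F (vpoint v) N v" for v
  have crN: "cr p N = carrier_of p" if "p \<in> X" for p by (simp add: cr_def ptN[OF that])
  have "s z = a"
  proof -
    have zB: "vpoint z \<in> B" using vpoint_X[OF z] by (simp add: B_def)
    \<comment> \<open>The geodesic chosen from \<open>z\<close> to itself is constant, so the value
      \<open>a\<close> is never moved.\<close>
    have cz: "cr (vpoint z) j = {z}" if "j \<le> N" for j
    proof -
      have "ld (\<gamma> (vpoint z) 0) (\<gamma> (vpoint z) (real j / real N)) = \<bar>0 - real j / real N\<bar> * ld (vpoint z) (vpoint z)"
        by (rule geo_dist[OF \<gamma>[OF BX[OF zB]]]) (use unit[OF that] in auto)
      then have "ld (pt (vpoint z) 0) (pt (vpoint z) j) = 0"
        using vpoint_X[OF z] by (simp add: pt_def)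
      then have "pt (vpoint z) j = vpoint z"
        using M.zero[OF ptX[OF BX[OF zB]] ptX[OF BX[OF zB] that], of 0] pt0[OF BX[OF zB]] by simp
      then show ?thesis by (simp add: cr_def carrier_vpoint)
    qed
    have "F (vpoint z) j z = a" if "j \<le> N" for j
      using that by (induction j) (use Fagree[OF zB] cz F0 in auto)
    then show ?thesis by (simp add: s_def)
  qed
  moreover have "s v = \<tau> u v (s u)" if e: "(u, v) \<in> E" and R: "vdist K z u \<le> R" "vdist K z v \<le> R" for u v
  proof -
    have uv: "u \<in> verts K" "v \<in> verts K" "u \<noteq> v" using edges_verts[OF e] edges_neq[OF e] by auto
    \<comment> \<open>Thirds of the edge meet the bound 1/3 in \<open>close\<close>. The two
      interior points have carrier \<open>{u, v}\<close>, so a flat section over the whole edge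
      performs the transport from \<open>u\<close> to \<open>v\<close>.\<close>
    define p where "p k = epoint u v (real k / 3)" for k :: nat
    have pX: "p k \<in> X" if "k \<le> 3" for k unfolding p_def by (rule epoint_X[OF e]) (use that in auto)
    have p03: "p 0 = vpoint u" "p 3 = vpoint v" using epoint_ends[OF e] by (simp_all add: p_def)
    have pB: "p k \<in> B" if "k \<le> 3" for k
    proof -
      have "ld (vpoint z) (p k) \<le> ld (vpoint z) (p 0) + ld (p 0) (p k)"
        by (rule M.triangle) (use pX that vpoint_X[OF z] in auto)
      moreover have "ld (p 0) (p k) \<le> \<bar>real 0 / 3 - real k / 3\<bar>"
        unfolding p_def by (rule ld_epoint[OF e]) (use that in auto)
      moreover have "ld (vpoint z) (p 0) \<le> real R" unfolding p03 using ld_vpoint_vdist[OF z uv(1)] R(1) by simp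
      ultimately show ?thesis using pX[OF that] that by (simp add: B_def)
    qed
    have pstep: "ld (p k) (p (Suc k)) \<le> 1/3" if "k < 3" for k
    proof -
      have "ld (p k) (p (Suc k)) \<le> \<bar>real k / 3 - real (Suc k) / 3\<bar>"
        unfolding p_def by (rule ld_epoint[OF e]) (use that in auto)
      then show ?thesis by (simp add: field_simps)
    qed
    have c0: "cr (p 0) N = {u}" "cr (p 3) N = {v}" using crN[OF pX[of 0]] crN[OF pX[of 3]] by (simp_all add: p03 carrier_vpoint)
    have c12: "cr (p k) N = {u, v}" if "k = 1 \<or> k = 2" for k
    proof -
      have "k \<le> 3" "real k / 3 \<noteq> 0" "real k / 3 \<noteq> 1" using that by auto
      moreover have "cr (p k) N = carrier_of (p k)" by (rule crN[OF pX[OF \<open>k \<le> 3\<close>]])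
      moreover have "carrier_of (p k) = {w. (if w = u then 1 - real k / 3 else if w = v then real k / 3 else 0) \<noteq> 0}"
        unfolding p_def carrier_of_def epoint_eq[OF e] ..
      ultimately show ?thesis using uv(3) by auto
    qed
    have "F (p 0) N u = F (p 1) N u" using close[OF pB[of 0] pB[of 1]] pstep[of 0] c0 c12[of 1] by simp
    moreover have "F (p 1) N v = F (p 2) N v" using close[OF pB[of 1] pB[of 2]] pstep[of 1] c12 by (simp add: numeral_2_eq_2)
    moreover have "F (p 2) N v = F (p 3) N v" using close[OF pB[of 2] pB[of 3]] pstep[of 2] c0 c12[of 2] by (simp add: numeral_3_eq_3 numeral_2_eq_2)
    moreover have "F (p 1) N v = \<tau> u v (F (p 1) N u)" using Fflat[OF pB[of 1], of N] e c12[of 1] by (simp add: flat_def)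
    ultimately show ?thesis by (simp add: s_def p03)
  qed
  ultimately show ?thesis by blast
qed

end

section \<open>Finiteness of the set of orbits\<close>

context cat0_cubical
begin

lemma crd_less_one:
  assumes p: "p \<in> X" "p v \<noteq> 0"
  shows "crd K v p u < 1"
proof -
  obtain n C \<psi> x where x: "p = cube_point n C \<psi> x" "C \<in> K" "cube_chart K n C \<psi>" "x \<in> unit_cube n"
    using p(1) unfolding realization_def by auto
  have v: "v \<in> C" using p(2) unfolding x(1) cube_point_def by (auto split: if_splits)
  obtain T where T: "\<And>x. cube_point n C \<psi> x = corner_point K v C (T x)"
    "\<And>x u. u \<in> nbc K v C \<Longrightarrow> \<exists>i<n. T x u = (if i \<in> \<psi> v then 1 - x i else x i)"
    by (rule corner_chart[OF x(3,2) v]) (rule that)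
  have "T x u < 1" if u: "u \<in> nbc K v C"
  proof -
    have "lab K v v = {}" using lab_self v x(2) by (auto simp: verts_def)
    then have "(\<Prod>u\<in>nbc K v C. 1 - T x u) \<noteq> 0"
      using p(2) v unfolding x(1) T(1) corner_point_def by simp
    then have "T x u \<noteq> 1" using u nbc_finite[OF x(2)] by auto
    moreover obtain i where "i < n" "T x u = (if i \<in> \<psi> v then 1 - x i else x i)" using T(2)[OF u, of x] by blast
    then have "T x u \<le> 1" using x(4) by (cases "i \<in> \<psi> v") (auto simp: unit_cube_def)
    ultimately show ?thesis by simp
  qed
  then show ?thesis unfolding x(1) T(1) crd_corner_point[OF x(2) v] by simp
qed

text \<open>By local finiteness the coordinates of \<open>p\<close> at \<open>v\<close> have a
  maximum, which is below 1; its distance from 1 is the radius.\<close>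

lemma star_radius:
  assumes p: "p \<in> X" "p v \<noteq> 0"
  shows "\<exists>r>0. \<forall>q\<in>X. ld p q < r \<longrightarrow> q v \<noteq> 0"
proof -
  define m where "m = Max (insert 0 (crd K v p ` nbs K v))"
  have f: "finite (insert 0 (crd K v p ` nbs K v))" using finite_nbs by simp
  have "m < 1" unfolding m_def using f crd_less_one[OF p] by (subst Max_less_iff) auto
  have le: "crd K v p u \<le> m" for u
  proof (cases "u \<in> nbs K v")
    case True
    then show ?thesis unfolding m_def using f by (intro Max_ge) auto
  next
    case False
    then have "crd K v p u = 0" unfolding crd_def lab_def nbc_def nbs_def by simp
    moreover have "0 \<le> m" unfolding m_def using f by (intro Max_ge) auto
    ultimately show ?thesis by simp
  qed
  have r: "crd K v p u + (1 - m) \<le> 1" for u using le[of u] by simp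
  show ?thesis
    by (intro exI[of _ "1 - m"] conjI ballI impI) (use \<open>m < 1\<close> open_star(1)[OF p(1) _ p(2) _ r] in auto)
qed

text \<open>The saturations of the open stars \<open>{p. p v \<noteq> 0}\<close> of vertices have open images in the compact
  quotient, and the only vertex in the open star of \<open>v\<close> is \<open>v\<close> itself.\<close>

lemma finite_vert_orbits:
  assumes cell: "cellular_action G K \<phi>" and coc: "cocompact_action G K \<phi>"
  shows "finite (vert_orbits G K \<phi>)"
proof -
  interpret group_action G "verts K" \<phi> using cell by (simp add: cellular_action_def)
  interpret group G using group_hom group_hom.axioms(1) by blast
  let ?\<psi> = "point_action G K \<phi>"
  obtain Y where Y: "quotient_map M.mtopology Y (orbit G ?\<psi>)" "compact_space Y"
    using coc unfolding cocompact_action_def by blast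
  have top: "topspace Y = orbit G ?\<psi> ` X" using Y(1) by (simp add: quotient_map_def)
  define N where "N v = {p \<in> X. \<exists>w\<in>orbit G \<phi> v. p w \<noteq> 0}" for v
  define W where "W v = orbit G ?\<psi> ` N v" for v
  have supp: "p w \<noteq> 0 \<Longrightarrow> w \<in> verts K" if "p \<in> X" for p w
    using carrier_of_cube[OF that] by (auto simp: carrier_of_def verts_def)
  have one: "\<phi> \<one>\<^bsub>G\<^esub> v = v" if "v \<in> verts K" for v using id_eq_one that by (metis restrict_apply')
  have self: "p \<in> orbit G ?\<psi> p" if "p \<in> X" for p
  proof -
    have "?\<psi> \<one>\<^bsub>G\<^esub> p = p" unfolding point_action_def using supp[OF that] one by (auto simp: fun_eq_iff)
    then show ?thesis unfolding orbit_def by (metis (mono_tags, lifting) mem_Collect_eq one_closed)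
  qed
  have orbit_verts: "w \<in> verts K" if "w \<in> orbit G \<phi> v" "v \<in> verts K" for v w
    using that element_image by (auto simp: orbit_def)
  have pre: "{p \<in> X. orbit G ?\<psi> p \<in> W v} = N v" if v: "v \<in> verts K" for v
  proof (intro equalityI subsetI)
    fix p assume "p \<in> {p \<in> X. orbit G ?\<psi> p \<in> W v}"
    then obtain p' where p: "p \<in> X" "orbit G ?\<psi> p = orbit G ?\<psi> p'" "p' \<in> N v" by (auto simp: W_def)
    then have "p \<in> orbit G ?\<psi> p'" using self by blast
    then obtain g where g: "g \<in> carrier G" "p = ?\<psi> g p'" by (auto simp: orbit_def)
    obtain w where w: "w \<in> orbit G \<phi> v" "p' w \<noteq> 0" using p(3) by (auto simp: N_def)
    obtain h where h: "h \<in> carrier G" "w = \<phi> h v" using w(1) by (auto simp: orbit_def)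
    have wv: "w \<in> verts K" by (rule orbit_verts[OF w(1) v])
    have "\<phi> (inv\<^bsub>G\<^esub> g) (\<phi> g w) = w" by (rule orbit_sym_aux[OF g(1) wv HOL.refl])
    moreover have gw: "\<phi> g w \<in> verts K" by (rule element_image[OF g(1) wv HOL.refl])
    ultimately have "p (\<phi> g w) \<noteq> 0" using w(2) g(2) by (simp add: point_action_def)
    moreover have "\<phi> g w = \<phi> (g \<otimes>\<^bsub>G\<^esub> h) v" using composition_rule[OF v g(1) h(1)] h(2) by simp
    then have "\<phi> g w \<in> orbit G \<phi> v" using g(1) h(1) by (auto simp: orbit_def)
    ultimately show "p \<in> N v" using p(1) by (auto simp: N_def)
  next
    fix p assume "p \<in> N v"
    then show "p \<in> {p \<in> X. orbit G ?\<psi> p \<in> W v}" by (auto simp: N_def W_def)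
  qed
  have Nopen: "openin M.mtopology (N v)" for v
    unfolding M.openin_mtopology
  proof (intro conjI allI impI)
    show "N v \<subseteq> X" by (auto simp: N_def)
    fix p assume "p \<in> N v"
    then obtain w where w: "p \<in> X" "w \<in> orbit G \<phi> v" "p w \<noteq> 0" by (auto simp: N_def)
    then obtain r where r: "r > 0" "\<forall>q\<in>X. ld p q < r \<longrightarrow> q w \<noteq> 0" using star_radius by blast
    then have "M.mball p r \<subseteq> N v" using w(2) by (auto simp: N_def)
    then show "\<exists>r>0. M.mball p r \<subseteq> N v" using r(1) by blast
  qed
  have Wopen: "openin Y (W v)" if v: "v \<in> verts K" for v
  proof -
    have "W v \<subseteq> topspace Y" by (auto simp: top W_def N_def)
    then have "openin M.mtopology {p \<in> topspace M.mtopology. orbit G ?\<psi> p \<in> W v} \<longleftrightarrow> openin Y (W v)"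
      using Y(1) unfolding quotient_map_def by blast
    then show ?thesis using pre[OF v] Nopen[of v] by simp
  qed
  have "topspace Y \<subseteq> \<Union>(W ` verts K)"
  proof
    fix y assume "y \<in> topspace Y"
    then obtain p where p: "p \<in> X" "y = orbit G ?\<psi> p" by (auto simp: top)
    obtain v where v: "p v \<noteq> 0" using cube_nonempty[OF carrier_of_cube[OF p(1)]] by (auto simp: carrier_of_def)
    then have vK: "v \<in> verts K" using supp p by blast
    then have "p \<in> N v" using orbit_refl v p by (auto simp: N_def)
    then show "y \<in> \<Union>(W ` verts K)" using vK p by (auto simp: W_def)
  qed
  moreover have "compactin Y (topspace Y)" using Y(2) by (simp add: compact_space_def)
  ultimately obtain F where F: "finite F" "F \<subseteq> W ` verts K" "topspace Y \<subseteq> \<Union>F"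
    unfolding compactin_def using Wopen by (metis (no_types, lifting) imageE)
  then obtain V where V: "V \<subseteq> verts K" "finite V" "F = W ` V" by (meson finite_subset_image)
  have "vert_orbits G K \<phi> \<subseteq> orbit G \<phi> ` V"
  proof
    fix o' assume "o' \<in> vert_orbits G K \<phi>"
    then obtain w where w: "w \<in> verts K" "o' = orbit G \<phi> w" by (auto simp: vert_orbits_def orbits_def)
    have "orbit G ?\<psi> (vpoint w) \<in> topspace Y" using vpoint_X[OF w(1)] by (simp add: top)
    then obtain v where v: "v \<in> V" "orbit G ?\<psi> (vpoint w) \<in> W v" using F(3) V(3) by auto
    then have "vpoint w \<in> N v" using pre[of v] V(1) vpoint_X[OF w(1)] by blast
    then have wv: "w \<in> orbit G \<phi> v" by (auto simp: N_def vpoint_def split: if_splits)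
    have vK: "v \<in> verts K" using v V by blast
    have "orbit G \<phi> w = orbit G \<phi> v"
    proof (intro equalityI subsetI)
      fix u assume "u \<in> orbit G \<phi> w"
      then show "u \<in> orbit G \<phi> v" using orbit_trans[OF vK w(1) _ wv] orbit_verts w(1) by blast
    next
      fix u assume "u \<in> orbit G \<phi> v"
      then show "u \<in> orbit G \<phi> w" using orbit_trans[OF w(1) vK _ orbit_sym[OF vK w(1) wv]] orbit_verts vK by blast
    qed
    then show "o' \<in> orbit G \<phi> ` V" using v(1) w(2) by blast
  qed
  then show ?thesis using V(2) finite_surj by blast
qed

end

section \<open>Edge paths up to exchange across squares\<close>

text \<open>Edge paths are lists of vertices in reverse order: the head is the end of the path.\<close>

inductive swap :: "'v set set \<Rightarrow> 'v list \<Rightarrow> 'v list \<Rightarrow> bool" for K where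
  top: "sq K x w y v \<Longrightarrow> swap K (x # w # y # p) (x # v # y # p)"
| cons: "swap K p q \<Longrightarrow> swap K (x # p) (x # q)"

abbreviation sim :: "'v set set \<Rightarrow> 'v list \<Rightarrow> 'v list \<Rightarrow> bool" where
  "sim K \<equiv> (swap K)\<^sup>*\<^sup>*"

lemma swap_sym: "swap K p q \<Longrightarrow> swap K q p"
  by (induction rule: swap.induct) (auto intro: swap.intros sq_flip)

lemma sim_sym: "sim K p q \<Longrightarrow> sim K q p"
  by (induction rule: rtranclp_induct) (auto intro: converse_rtranclp_into_rtranclp swap_sym)

lemma sim_trans: "sim K p q \<Longrightarrow> sim K q r \<Longrightarrow> sim K p r"
  by (rule rtranclp_trans)

lemma sim_cons: "sim K p q \<Longrightarrow> sim K (x # p) (x # q)"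
  by (induction rule: rtranclp_induct) (auto intro: rtranclp.rtrancl_into_rtrancl swap.cons)

lemma swap_length: "swap K p q \<Longrightarrow> length p = length q"
  by (induction rule: swap.induct) auto

lemma sim_length: "sim K p q \<Longrightarrow> length p = length q"
  by (induction rule: rtranclp_induct) (auto dest: swap_length)

lemma swap_Cons: "swap K (x # p) q \<Longrightarrow> \<exists>q'. q = x # q'"
  by (auto elim: swap.cases)

lemma sim_Cons: "sim K (x # p) q \<Longrightarrow> \<exists>q'. q = x # q'"
  by (induction rule: rtranclp_induct) (auto dest: swap_Cons)

lemma swap_imp_sim: "swap K p q \<Longrightarrow> sim K p q"
  by (rule r_into_rtranclp)

section \<open>Walks, reduced paths and shortest paths\<close>

inductive walk :: "'v set set \<Rightarrow> 'v \<Rightarrow> 'v list \<Rightarrow> bool" for K z where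
  single: "z \<in> verts K \<Longrightarrow> walk K z [z]"
| snoc: "walk K z (x # p) \<Longrightarrow> (x, y) \<in> edges K \<Longrightarrow> walk K z (y # x # p)"

text \<open>A path is reduced if no sequence of exchanges leads to a backtrack; it is enough to require at
  each vertex that the path up to it cannot be exchanged into one that arrives from the next vertex.\<close>

inductive red :: "'v set set \<Rightarrow> 'v \<Rightarrow> 'v list \<Rightarrow> bool" for K z where
  single: "z \<in> verts K \<Longrightarrow> red K z [z]"
| snoc: "red K z (x # p) \<Longrightarrow> (x, y) \<in> edges K \<Longrightarrow> \<nexists>q. sim K (x # p) (x # y # q)
    \<Longrightarrow> red K z (y # x # p)"

inductive_cases walk_ConsE: "walk K z (y # x # p)"
inductive_cases red_ConsE: "red K z (y # x # p)"

lemma swap_walk: "swap K p q \<Longrightarrow> walk K z p \<Longrightarrow> walk K z q"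
proof (induction rule: swap.induct)
  case (top x w y v p)
  then show ?case by (auto elim!: walk_ConsE intro!: walk.snoc simp: sq_def dest: edges_sym)
next
  case (cons p q x)
  show ?case
  proof (cases p)
    case Nil
    then show ?thesis using cons by (auto elim: swap.cases)
  next
    case (Cons w p')
    obtain q' where "q = w # q'" using swap_Cons cons Cons by metis
    then show ?thesis using cons Cons by (auto elim!: walk_ConsE intro!: walk.snoc)
  qed
qed

lemma sim_walk: "sim K p q \<Longrightarrow> walk K z p \<Longrightarrow> walk K z q"
  by (induction rule: rtranclp_induct) (auto dest: swap_walk)

lemma walk_relpow: "walk K z p \<Longrightarrow> (z, hd p) \<in> edges K ^^ (length p - 1)"
  by (induction rule: walk.induct) auto

lemma relpow_walk: "z \<in> verts K \<Longrightarrow> (z, x) \<in> edges K ^^ n \<Longrightarrow> \<exists>p. walk K z (x # p) \<and> length p = n"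
proof (induction n arbitrary: x)
  case 0
  then show ?case by (auto intro: walk.single)
next
  case (Suc n)
  then obtain y where y: "(z, y) \<in> edges K ^^ n" "(y, x) \<in> edges K" by auto
  then obtain p where "walk K z (y # p)" "length p = n" using Suc by blast
  with y(2) show ?case by (intro exI[of _ "y # p"]) (auto intro: walk.snoc)
qed

lemma walk_vdist: "walk K z (x # p) \<Longrightarrow> vdist K z x \<le> length p"
  unfolding vdist_def using walk_relpow[of K z "x # p"] by (auto intro: Least_le)

lemma vdist_self [simp]: "vdist K x x = 0"
  unfolding vdist_def by simp

lemma relpow_edges_sym: "(x, y) \<in> edges K ^^ n \<Longrightarrow> (y, x) \<in> edges K ^^ n"
proof (induction n arbitrary: x)
  case (Suc n)
  obtain z where z: "(x, z) \<in> edges K" "(z, y) \<in> edges K ^^ n" using relpow_Suc_D2[OF Suc.prems] by blast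
  then show ?case using Suc.IH edges_sym by (metis relpow_Suc_I)
qed auto

lemma vdist_commute: "vdist K x y = vdist K y x"
proof -
  have "(x, y) \<in> edges K ^^ n \<longleftrightarrow> (y, x) \<in> edges K ^^ n" for n
    using relpow_edges_sym by metis
  then show ?thesis unfolding vdist_def by simp
qed

definition geod :: "'v set set \<Rightarrow> 'v \<Rightarrow> 'v list \<Rightarrow> bool" where
  "geod K z p \<longleftrightarrow> walk K z p \<and> length p = Suc (vdist K z (hd p))"

text \<open>An arbitrary representative, the same for all members of a class, so that equality of
  classes becomes equality of lists.\<close>

definition nf :: "'v set set \<Rightarrow> 'v list \<Rightarrow> 'v list" where
  "nf K p = (SOME q. sim K p q)"

lemma sim_nf: "sim K p (nf K p)"
  unfolding nf_def by (rule someI_ex) auto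

lemma nf_eq_iff: "nf K p = nf K q \<longleftrightarrow> sim K p q"
proof
  assume "nf K p = nf K q"
  then show "sim K p q" using sim_nf sim_sym sim_trans by metis
next
  assume "sim K p q"
  then have "sim K p = sim K q" using sim_sym sim_trans by blast
  then show "nf K p = nf K q" by (simp add: nf_def)
qed

text \<open>Appends the edge from \<open>x\<close> to \<open>y\<close> to a class of reduced paths ending in \<open>x\<close>; if some path
  in the class arrives from \<open>y\<close>, the last edge is cancelled instead.\<close>

definition transport :: "'v set set \<Rightarrow> 'v \<Rightarrow> 'v \<Rightarrow> 'v list \<Rightarrow> 'v list" where
  "transport K x y a = (if \<exists>q. sim K a (x # y # q)
     then nf K (y # (SOME q. sim K a (x # y # q))) else nf K (y # a))"

section \<open>Reduced paths under the flag condition\<close>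

locale flag_cubical = cubical K for K :: "'v set set" +
  assumes flag: "\<lbrakk>v \<in> verts K; finite U; \<And>a. a \<in> U \<Longrightarrow> (v, a) \<in> edges K;
      \<And>a b. a \<in> U \<Longrightarrow> b \<in> U \<Longrightarrow> a \<noteq> b \<Longrightarrow> \<exists>C\<in>K. v \<in> C \<and> a \<in> C \<and> b \<in> C\<rbrakk>
     \<Longrightarrow> \<exists>C\<in>K. v \<in> C \<and> U \<subseteq> C"
begin

text \<open>The squares show that the directions \<open>x\<close>, \<open>y\<close>,
  \<open>y'\<close> at \<open>w\<close> span pairwise, so by the flag condition they lie in one
  cube. The vertex sought is the one whose label at \<open>w\<close> consists of all three.\<close>

lemma cube_condition:
  assumes s: "sq K w x u y" "sq K w x v y'" "sq K w y t y'"
  shows "\<exists>s. sq K x u s v \<and> sq K y u s t \<and> sq K y' v s t"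
proof -
  have ne: "x \<noteq> y" "x \<noteq> y'" "y \<noteq> y'" using s by (auto simp: sq_def)
  have e: "(w, x) \<in> E" "(w, y) \<in> E" "(w, y') \<in> E" using s edges_sym by (auto simp: sq_def)
  have "\<exists>C\<in>K. w \<in> C \<and> {x, y, y'} \<subseteq> C"
  proof (rule flag)
    show "w \<in> verts K" using e edges_verts by metis
    show "(w, a) \<in> E" if "a \<in> {x, y, y'}" for a using that e by auto
    have c: "{w, x, u, y} \<in> K" "{w, x, v, y'} \<in> K" "{w, y, t, y'} \<in> K" using s by (auto simp: sq_def)
    show "\<exists>C\<in>K. w \<in> C \<and> a \<in> C \<and> b \<in> C" if "a \<in> {x, y, y'}" "b \<in> {x, y, y'}" "a \<noteq> b" for a b
    proof -
      have "{a, b} \<subseteq> {w, x, u, y} \<or> {a, b} \<subseteq> {w, x, v, y'} \<or> {a, b} \<subseteq> {w, y, t, y'}" using that by auto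
      then show ?thesis using c by (metis insert_subset insertI1)
    qed
  qed auto
  then obtain C where C: "C \<in> K" "w \<in> C" "x \<in> C" "y \<in> C" "y' \<in> C" by auto
  have nb: "x \<in> nbc K w C" "y \<in> nbc K w C" "y' \<in> nbc K w C" using C e by (auto simp: nbc_def)
  note l1 = lab_nb[OF C(1,2) nb(1)] lab_nb[OF C(1,2) nb(2)] lab_nb[OF C(1,2) nb(3)]
  note u = sq_lab[OF s(1) C(1,2,3,4)] and v = sq_lab[OF s(2) C(1,2,3,5)] and t = sq_lab[OF s(3) C(1,2,4,5)]
  obtain z where z: "z \<in> C" "lab K w z = {x, y, y'}" using lab_ex[OF C(1,2), of "{x, y, y'}"] nb by auto
  have "sq K x u z v"
    by (rule lab_sq[OF C(1,2) C(3) u(1) z(1) v(1) nb(2,3)]) (use ne l1 u v z in auto)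
  moreover have "sq K y u z t"
    by (rule lab_sq[OF C(1,2) C(4) u(1) z(1) t(1) nb(1,3)]) (use ne l1 u t z in auto)
  moreover have "sq K y' v z t"
    by (rule lab_sq[OF C(1,2) C(5) v(1) z(1) t(1) nb(1,2)]) (use ne l1 v t z in auto)
  ultimately show ?thesis by blast
qed

text \<open>Follow a chain of swaps and keep track of the last edge. Two successive changes of the last edge
  take place in two squares at the last edge but one of the path; by induction on the length the
  remaining directions span a third square, and the three squares lie in a cube.\<close>

lemma sim_last_edges:
  assumes "sim K (x # u # p) (x # w # q)"
  shows "(u = w \<and> sim K (u # p) (w # q)) \<or>
     (\<exists>y r. sq K x u y w \<and> sim K (u # p) (u # y # r) \<and> sim K (w # q) (w # y # r))"
  using assms
proof (induction "length p" arbitrary: x u p w q rule: less_induct)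
  case less
  have "\<forall>w q. B = x # w # q \<longrightarrow> (u = w \<and> sim K (u # p) (w # q)) \<or>
     (\<exists>y r. sq K x u y w \<and> sim K (u # p) (u # y # r) \<and> sim K (w # q) (w # y # r))"
    if "sim K (x # u # p) B" for B
    using that
  proof (induction rule: rtranclp_induct)
    case base
    then show ?case by auto
  next
    case (step B' B)
    have len: "length B' = length p + 2" using sim_length[OF step(1)] by simp
    obtain B'' where B'': "B' = x # B''" using sim_Cons[OF step(1)] by auto
    then obtain w q where B': "B' = x # w # q" using len by (cases B'') auto
    have lq: "length q = length p" using len B' by simp
    have IH: "(u = w \<and> sim K (u # p) (w # q)) \<or>
     (\<exists>y r. sq K x u y w \<and> sim K (u # p) (u # y # r) \<and> sim K (w # q) (w # y # r))"
      using step(3) B' by blast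
    show ?case
    proof (intro allI impI)
      fix v q2 assume B: "B = x # v # q2"
      from step(2)[unfolded B' B] show "(u = v \<and> sim K (u # p) (v # q2)) \<or>
         (\<exists>y r. sq K x u y v \<and> sim K (u # p) (u # y # r) \<and> sim K (v # q2) (v # y # r))"
      proof cases
        case (top y' q')
        note T = this
        from IH show ?thesis
        proof (elim disjE exE conjE)
          assume "u = w" "sim K (u # p) (w # q)"
          then show ?thesis using T by blast
        next
          fix y r assume a: "sq K x u y w" "sim K (u # p) (u # y # r)" "sim K (w # q) (w # y # r)"
          have b: "sim K (w # y' # q') (w # y # r)" using a T by simp
          have "length q' < length p" using lq T by simp
          from less(1)[OF this b] show ?thesis
          proof (elim disjE exE conjE)
            assume c: "y' = y" "sim K (y' # q') (y # r)"
            have "sq K w x u y" "sq K w x v y" using a(1) T c sq_rotate sq_flip by metis+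
            then have "u = v" using sq_unique by blast
            moreover have "sim K (u # p) (u # y' # q')"
              using a(2) sim_cons[OF sim_sym[OF c(2)]] sim_trans by metis
            ultimately show ?thesis using T by simp
          next
            fix t r' assume c: "sq K w y' t y" "sim K (y' # q') (y' # t # r')" "sim K (y # r) (y # t # r')"
            have "sq K w x u y" "sq K w x v y'" "sq K w y t y'" using a(1) T c(1) sq_rotate sq_flip by metis+
            from cube_condition[OF this] obtain s where s: "sq K x u s v" "sq K y u s t" "sq K y' v s t" by blast
            have "sq K u y t s" "sq K v y' t s" using s sq_rotate sq_flip by metis+
            then have "sim K (u # y # t # r') (u # s # t # r')" "sim K (v # y' # t # r') (v # s # t # r')"
              by (auto intro: swap_imp_sim swap.top)
            then have "sim K (u # p) (u # s # t # r')" "sim K (v # q2) (v # s # t # r')"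
              using a(2) sim_cons[OF c(3)] sim_cons[OF c(2)] sim_trans T by metis+
            then show ?thesis using s(1) by blast
          qed
        qed
      next
        case cons
        have "v = w" using swap_Cons[OF cons] by auto
        have s: "sim K (w # q) (v # q2)" using cons by (rule swap_imp_sim)
        from IH show ?thesis
        proof (elim disjE exE conjE)
          assume "u = w" "sim K (u # p) (w # q)"
          then show ?thesis using s \<open>v = w\<close> sim_trans by metis
        next
          fix y r assume "sq K x u y w" "sim K (u # p) (u # y # r)" "sim K (w # q) (w # y # r)"
          then show ?thesis using s \<open>v = w\<close> sim_trans sim_sym by metis
        qed
      qed
    qed
  qed
  then show ?case using less.prems by blast
qed

text \<open>The second alternative of \<open>sim_last_edges\<close> would make the two last but one
  vertices opposite, hence distinct, corners of a square, but here they coincide.\<close>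

lemma sim_cancel: "sim K (x # y # p) (x # y # q) \<Longrightarrow> sim K (y # p) (y # q)"
  using sim_last_edges[of x y p y q] by (auto simp: sq_def)

text \<open>Only an exchange of the last two edges needs an argument. If the path to
  \<open>y\<close> could arrive from \<open>v\<close>, an exchange would make the path to
  \<open>w\<close> arrive from \<open>x\<close>. If the path to \<open>v\<close> could arrive from
  \<open>x\<close>, the square behind this would be the given one, so the path to \<open>y\<close>
  could arrive from \<open>w\<close>. Reducedness excludes both.\<close>

lemma red_swap: "red K z p \<Longrightarrow> swap K p q \<Longrightarrow> red K z q"
proof (induction arbitrary: q rule: red.induct)
  case single
  from single(2) show ?case by (cases) (auto elim: swap.cases)
next
  case (snoc w p x)
  from snoc.prems show ?case
  proof cases
    case (top y v r)
    have p: "p = y # r" and q: "q = x # v # y # r" and s: "sq K x w y v" using top by auto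
    have r: "red K z (y # r)" "\<nexists>q. sim K (y # r) (y # w # q)"
      using snoc.hyps(1) unfolding p by (auto elim: red_ConsE)
    have n: "\<nexists>q. sim K (w # y # r) (w # x # q)" using snoc.hyps(3) p by simp
    have e: "(y, v) \<in> E" "(v, x) \<in> E" "x \<noteq> y" using s edges_sym by (auto simp: sq_def)
    have "red K z (v # y # r)"
    proof (rule red.snoc[OF r(1) e(1)], rule notI, elim exE)
      fix q' assume "sim K (y # r) (y # v # q')"
      then have "sim K (w # y # r) (w # y # v # q')" by (rule sim_cons)
      moreover have "sim K (w # y # v # q') (w # x # v # q')"
        by (rule swap_imp_sim, rule swap.top) (use s sq_rotate in metis)
      ultimately show False using n sim_trans by metis
    qed
    moreover have "\<nexists>q. sim K (v # y # r) (v # x # q)"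
    proof (rule notI, elim exE)
      fix q' assume "sim K (v # y # r) (v # x # q')"
      from sim_last_edges[OF this] e(3) obtain b r' where b: "sq K v y b x" "sim K (y # r) (y # b # r')" by auto
      have "sq K v y w x" using s sq_rotate sq_flip by metis
      then have "b = w" using b sq_unique by metis
      then show False using b(2) r(2) by blast
    qed
    ultimately show ?thesis unfolding q by (intro red.snoc[OF _ e(2)])
  next
    case (cons q1)
    obtain q' where q1: "q1 = w # q'" using swap_Cons cons by metis
    have "red K z (w # q')" using snoc.IH cons q1 by simp
    moreover have "sim K (w # p) (w # q')" using cons q1 swap_imp_sim by metis
    then have "\<nexists>q. sim K (w # q') (w # x # q)" using snoc.hyps(3) sim_trans by metis
    ultimately show ?thesis using cons q1 snoc.hyps(2) by (auto intro: red.snoc)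
  qed
qed

lemma red_sim: "sim K p q \<Longrightarrow> red K z p \<Longrightarrow> red K z q"
  by (induction rule: rtranclp_induct) (auto intro: red_swap)

text \<open>By \<open>sim_cancel\<close>, the class of the shortened path is independent of the
  choice made in \<open>transport\<close>.\<close>

lemma transport_back:
  assumes "sim K p (x # y # q)"
  shows "transport K x y (nf K p) = nf K (y # q)"
proof -
  have 1: "sim K (nf K p) (x # y # q)" using sim_trans[OF sim_sym[OF sim_nf] assms] .
  define q' where "q' = (SOME q. sim K (nf K p) (x # y # q))"
  have "sim K (nf K p) (x # y # q')" unfolding q'_def by (rule someI[of _ q]) (rule 1)
  then have "sim K (x # y # q') (x # y # q)" using 1 sim_sym sim_trans by metis
  then have "sim K (y # q') (y # q)" by (rule sim_cancel)
  moreover have "transport K x y (nf K p) = nf K (y # q')"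
    unfolding transport_def q'_def using 1 by auto
  ultimately show ?thesis by (simp add: nf_eq_iff)
qed

lemma transport_forth:
  assumes "\<nexists>q. sim K p (x # y # q)"
  shows "transport K x y (nf K p) = nf K (y # p)"
proof -
  have "\<nexists>q. sim K (nf K p) (x # y # q)" using assms sim_nf sim_trans by metis
  then have "transport K x y (nf K p) = nf K (y # nf K p)" unfolding transport_def by simp
  also have "\<dots> = nf K (y # p)" unfolding nf_eq_iff by (rule sim_cons[OF sim_sym[OF sim_nf]])
  finally show ?thesis .
qed

lemma red_edge_cases:
  assumes r: "red K z (x # p)" and e: "(x, y) \<in> E"
  obtains (backward) q where "sim K (x # p) (x # y # q)" "red K z (x # y # q)" "red K z (y # q)"
      "\<nexists>r. sim K (y # q) (y # x # r)" "transport K x y (nf K (x # p)) = nf K (y # q)"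
  | (forward) "\<nexists>q. sim K (x # p) (x # y # q)" "red K z (y # x # p)"
      "transport K x y (nf K (x # p)) = nf K (y # x # p)"
proof (cases "\<exists>q. sim K (x # p) (x # y # q)")
  case True
  then obtain q where q: "sim K (x # p) (x # y # q)" by blast
  then have r2: "red K z (x # y # q)" using red_sim r by blast
  then have "red K z (y # q)" "\<nexists>r. sim K (y # q) (y # x # r)" by (auto elim: red_ConsE)
  then show ?thesis using backward q r2 transport_back[OF q] by blast
next
  case False
  then show ?thesis using forward r e transport_forth[OF False] by (auto intro: red.snoc)
qed

definition red_classes :: "'v \<Rightarrow> 'v \<Rightarrow> 'v list set" where
  "red_classes z x = {nf K (x # p) | p. red K z (x # p)}"

lemma transport_inverse:
  assumes e: "(x, y) \<in> E" and a: "a \<in> red_classes z x"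
  shows "transport K x y a \<in> red_classes z y \<and> transport K y x (transport K x y a) = a"
proof -
  obtain p where p: "a = nf K (x # p)" "red K z (x # p)" using a unfolding red_classes_def by blast
  from p(2) e show ?thesis
  proof (cases rule: red_edge_cases)
    case (backward q)
    have "transport K y x (nf K (y # q)) = nf K (x # y # q)" by (rule transport_forth) (rule backward)
    also have "\<dots> = a" using backward p by (simp add: nf_eq_iff sim_sym)
    finally show ?thesis using backward p unfolding red_classes_def by auto
  next
    case forward
    have "transport K y x (nf K (y # x # p)) = nf K (x # p)" by (rule transport_back) simp
    then show ?thesis using forward p unfolding red_classes_def by auto
  qed
qed

text \<open>Through \<open>u\<close>, the last edge is cancelled and then \<open>y\<close> is
  appended. Through \<open>w\<close>, the path is lengthened, an exchange in the square makes it
  arrive from \<open>y\<close>, and this edge is cancelled. Both ways end in the class of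
  \<open>y # u # q\<close>.\<close>

lemma transport_square_half:
  assumes s: "sq K x u y w" and r: "red K z (x # p)"
    and b: "sim K (x # p) (x # u # q)" and f: "\<nexists>q. sim K (x # p) (x # w # q)"
  shows "transport K u y (transport K x u (nf K (x # p))) = transport K w y (transport K x w (nf K (x # p)))"
proof -
  have e: "(x, w) \<in> E" "(w, y) \<in> E" "(u, y) \<in> E" using s edges_sym by (auto simp: sq_def)
  have "sq K w x u y" using s sq_rotate by metis
  then have "sim K (w # x # u # q) (w # y # u # q)" by (intro swap_imp_sim swap.top)
  then have c: "sim K (w # x # p) (w # y # u # q)" using sim_cons[OF b, of w] sim_trans by metis
  have "red K z (w # x # p)" using r e(1) f by (rule red.snoc)
  then have "red K z (w # y # u # q)" using c red_sim by blast
  then have n: "\<nexists>r. sim K (u # q) (u # y # r)" by (auto elim!: red_ConsE)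
  have "transport K x u (nf K (x # p)) = nf K (u # q)" by (rule transport_back[OF b])
  moreover have "transport K u y (nf K (u # q)) = nf K (y # u # q)" by (rule transport_forth[OF n])
  moreover have "transport K x w (nf K (x # p)) = nf K (w # x # p)" by (rule transport_forth[OF f])
  moreover have "transport K w y (nf K (w # x # p)) = nf K (y # u # q)" by (rule transport_back[OF c])
  ultimately show ?thesis by simp
qed

lemma transport_square:
  assumes s: "sq K x u y w" and a: "a \<in> red_classes z x"
  shows "transport K u y (transport K x u a) = transport K w y (transport K x w a)"
proof -
  obtain p where p: "a = nf K (x # p)" and r: "red K z (x # p)" using a unfolding red_classes_def by blast
  have e: "(x, u) \<in> E" "(x, w) \<in> E" "(u, y) \<in> E" "(w, y) \<in> E" and ne: "u \<noteq> w" "x \<noteq> y"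
    using s edges_sym by (auto simp: sq_def)
  consider (ff) "\<nexists>q. sim K (x # p) (x # u # q)" "\<nexists>q. sim K (x # p) (x # w # q)"
    | (bf) q where "sim K (x # p) (x # u # q)" "\<nexists>q. sim K (x # p) (x # w # q)"
    | (fb) q where "\<nexists>q. sim K (x # p) (x # u # q)" "sim K (x # p) (x # w # q)"
    | (bb) q q' where "sim K (x # p) (x # u # q)" "sim K (x # p) (x # w # q')" by blast
  then show ?thesis
  proof cases
    case ff
    \<comment> \<open>After a lengthening step the second step is one too: a cancellation would come
      from a square on \<open>x\<close> and \<open>y\<close> at \<open>u\<close>, which is the given
      one, and then the original path could arrive from \<open>w\<close>.\<close>
    have fw: "\<nexists>q. sim K (u # x # p) (u # y # q)"
      if s: "sq K x u y w" and n: "\<nexists>q. sim K (x # p) (x # w # q)" for u w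
    proof (rule notI, elim exE)
      fix q assume q: "sim K (u # x # p) (u # y # q)"
      have sq: "sq K u x w y" using s sq_rotate sq_flip by metis
      from sim_last_edges[OF q] ne(2) obtain b r where "sq K u x b y" "sim K (x # p) (x # b # r)" by auto
      then show False using sq sq_unique n by metis
    qed
    have "transport K u y (transport K x u a) = nf K (y # u # x # p)"
      unfolding p transport_forth[OF ff(1)] by (rule transport_forth[OF fw[OF s ff(2)]])
    moreover have "transport K w y (transport K x w a) = nf K (y # w # x # p)"
      unfolding p transport_forth[OF ff(2)] by (rule transport_forth[OF fw[OF sq_flip[OF s] ff(1)]])
    moreover have "sim K (y # u # x # p) (y # w # x # p)"
      by (rule swap_imp_sim, rule swap.top) (use s sq_rotate sq_flip in metis)
    ultimately show ?thesis by (simp add: nf_eq_iff)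
  next
    case (bf q)
    then show ?thesis unfolding p using transport_square_half[OF s r] by blast
  next
    case (fb q)
    then show ?thesis unfolding p using transport_square_half[OF sq_flip[OF s] r] by metis
  next
    case (bb q q')
    \<comment> \<open>Both last edges can be removed; the square relating them is the given one, so
      each of the two shortened paths can be made to arrive from \<open>y\<close>.\<close>
    have "sim K (x # u # q) (x # w # q')" using bb sim_trans sim_sym by metis
    from sim_last_edges[OF this] ne obtain b r where b: "sq K x u b w" "sim K (u # q) (u # b # r)" "sim K (w # q') (w # b # r)" by auto
    have "b = y" using b(1) s sq_unique by metis
    then have "transport K u y (transport K x u a) = nf K (y # r)" "transport K w y (transport K x w a) = nf K (y # r)"
      unfolding p transport_back[OF bb(1)] transport_back[OF bb(2)] using transport_back b(2,3) by auto
    then show ?thesis by simp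
  qed
qed

lemma geod_tl: "geod K z (y # x # p) \<Longrightarrow> geod K z (x # p) \<and> vdist K z y = Suc (vdist K z x)"
proof -
  assume g: "geod K z (y # x # p)"
  then have w: "walk K z (x # p)" "(x, y) \<in> E" unfolding geod_def by (auto elim: walk_ConsE)
  have "vdist K z x \<le> length p" using walk_vdist[OF w(1)] .
  moreover have "\<exists>q. walk K z (x # q) \<and> length q = vdist K z x"
  proof (rule relpow_walk)
    show "z \<in> verts K" using w(1) by (induction rule: walk.induct) auto
    have "(z, x) \<in> E ^^ length p" using walk_relpow[OF w(1)] by simp
    then show "(z, x) \<in> E ^^ vdist K z x" unfolding vdist_def by (rule LeastI)
  qed
  then obtain q where q: "walk K z (x # q)" "length q = vdist K z x" by blast
  have "vdist K z y \<le> Suc (length q)" using walk_vdist[OF walk.snoc[OF q(1) w(2)]] by simp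
  ultimately show ?thesis using g w q unfolding geod_def by auto
qed

text \<open>A path to \<open>x\<close> arriving from \<open>y\<close> would contain a walk to
  \<open>y\<close> shorter by two edges than the shortest one.\<close>

lemma geod_red: "walk K z p \<Longrightarrow> geod K z p \<Longrightarrow> red K z p"
proof (induction rule: walk.induct)
  case single
  then show ?case by (auto intro: red.single)
next
  case (snoc x p y)
  have g: "geod K z (x # p)" "vdist K z y = Suc (vdist K z x)" using geod_tl[OF snoc.prems] by auto
  show ?case
  proof (rule red.snoc)
    show "red K z (x # p)" using snoc.IH g by simp
    show "\<nexists>q. sim K (x # p) (x # y # q)"
    proof (rule notI, elim exE)
      fix q assume s: "sim K (x # p) (x # y # q)"
      have "walk K z (x # y # q)" by (rule sim_walk[OF s snoc.hyps(1)])
      then have "walk K z (y # q)" by (auto elim: walk_ConsE)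
      then have "vdist K z y \<le> length q" by (rule walk_vdist)
      moreover have "length p = Suc (length q)" using sim_length[OF s] by simp
      moreover have "length p = vdist K z x" using g by (simp add: geod_def)
      ultimately show False using g by simp
    qed
  qed (use snoc in auto)
qed

end

text \<open>What the later arguments take from the metric. The fibres are fixed to the type
  \<open>'v list\<close>, which holds the coded path classes, since a locale assumption cannot
  quantify over types.\<close>

locale simply_connected_flag = flag_cubical K for K :: "'v set set" +
  assumes connected: "x \<in> verts K \<Longrightarrow> y \<in> verts K \<Longrightarrow> (x, y) \<in> (edges K)\<^sup>*"
  and sections: "\<And>(S :: 'v \<Rightarrow> 'v list set) \<tau> z a R. \<lbrakk>z \<in> verts K; a \<in> S z;
      \<And>u v a. (u, v) \<in> edges K \<Longrightarrow> a \<in> S u \<Longrightarrow> \<tau> u v a \<in> S v \<and> \<tau> v u (\<tau> u v a) = a;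
      \<And>x u y w a. sq K x u y w \<Longrightarrow> a \<in> S x \<Longrightarrow> \<tau> u y (\<tau> x u a) = \<tau> w y (\<tau> x w a)\<rbrakk>
     \<Longrightarrow> \<exists>s. s z = a \<and> (\<forall>u v. (u, v) \<in> edges K \<longrightarrow> vdist K z u \<le> R \<longrightarrow> vdist K z v \<le> R \<longrightarrow> s v = \<tau> u v (s u))"
begin

lemma geod_ex:
  assumes "z \<in> verts K" "x \<in> verts K"
  obtains p where "geod K z (x # p)" "length p = vdist K z x"
proof -
  obtain n where "(z, x) \<in> E ^^ n" using connected[OF assms] rtrancl_imp_relpow by blast
  then have "(z, x) \<in> E ^^ vdist K z x" unfolding vdist_def by (rule LeastI)
  then obtain p where "walk K z (x # p)" "length p = vdist K z x" using relpow_walk assms by metis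
  then show ?thesis using that by (auto simp: geod_def)
qed

text \<open>A shortest path is its own class, so a section of the system of classes is the class of every
  shortest path.\<close>

lemma geod_section:
  assumes z: "z \<in> verts K"
  obtains s where "\<And>p. geod K z p \<Longrightarrow> vdist K z (hd p) \<le> R \<Longrightarrow> s (hd p) = nf K p"
    "\<And>u v. (u, v) \<in> E \<Longrightarrow> vdist K z u \<le> R \<Longrightarrow> vdist K z v \<le> R \<Longrightarrow> s v = transport K u v (s u)"
proof -
  have nfz: "nf K [z] \<in> red_classes z z" unfolding red_classes_def using red.single[OF z] by blast
  have "\<exists>s. s z = nf K [z] \<and> (\<forall>u v. (u, v) \<in> E \<longrightarrow> vdist K z u \<le> R \<longrightarrow> vdist K z v \<le> R \<longrightarrow> s v = transport K u v (s u))"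
    by (rule sections[where S = "red_classes z"])
      (use z nfz in \<open>simp_all add: transport_inverse transport_square\<close>)
  then obtain s where s: "s z = nf K [z]"
    "\<And>u v. (u, v) \<in> E \<Longrightarrow> vdist K z u \<le> R \<Longrightarrow> vdist K z v \<le> R \<Longrightarrow> s v = transport K u v (s u)" by blast
  have "s (hd p) = nf K p" if "walk K z p" "geod K z p" "vdist K z (hd p) \<le> R" for p
    using that
  proof (induction rule: walk.induct)
    case single
    then show ?case using s by simp
  next
    case (snoc x p y)
    have g: "geod K z (x # p)" "vdist K z y = Suc (vdist K z x)" using geod_tl snoc by blast+
    have r: "red K z (y # x # p)" using geod_red snoc by (metis geod_def)
    then have "\<nexists>q. sim K (x # p) (x # y # q)" by (auto elim: red_ConsE)
    then have "transport K x y (nf K (x # p)) = nf K (y # x # p)" by (rule transport_forth)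
    moreover have "s x = nf K (x # p)" using snoc g by simp
    moreover have "s y = transport K x y (s x)" using s(2) snoc g by simp
    ultimately show ?case by simp
  qed
  then show ?thesis using that s(2) by (metis geod_def)
qed

lemma geod_sim:
  assumes "z \<in> verts K" "geod K z (x # p)" "geod K z (x # q)"
  shows "sim K (x # p) (x # q)"
proof -
  obtain s where "\<And>p. geod K z p \<Longrightarrow> vdist K z (hd p) \<le> vdist K z x \<Longrightarrow> s (hd p) = nf K p"
    "\<And>u v. (u, v) \<in> E \<Longrightarrow> vdist K z u \<le> vdist K z x \<Longrightarrow> vdist K z v \<le> vdist K z x \<Longrightarrow> s v = transport K u v (s u)"
    by (rule geod_section[OF assms(1), where R = "vdist K z x"]) (rule that)
  from this(1)[OF assms(2)] this(1)[OF assms(3)] show ?thesis by (simp add: nf_eq_iff)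
qed

text \<open>The section carries the class of a shortest path to \<open>x\<close> into that of a
  shortest path to \<open>y\<close>. Lengths are constant on classes, so the distances differ by the
  one edge that is appended or cancelled.\<close>

lemma vdist_adjacent:
  assumes z: "z \<in> verts K" and e: "(x, y) \<in> E"
  shows "vdist K z x = Suc (vdist K z y) \<or> vdist K z y = Suc (vdist K z x)"
proof -
  have v: "x \<in> verts K" "y \<in> verts K" using edges_verts e by metis+
  obtain p where p: "geod K z (x # p)" "length p = vdist K z x" using geod_ex z v by blast
  obtain q where q: "geod K z (y # q)" "length q = vdist K z y" using geod_ex z v by blast
  have w: "walk K z (y # x # p)" "walk K z (x # y # q)" using p q e edges_sym
    by (auto simp: geod_def intro!: walk.snoc)
  have le: "vdist K z y \<le> Suc (vdist K z x)" "vdist K z x \<le> Suc (vdist K z y)"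
    using walk_vdist[OF w(1)] walk_vdist[OF w(2)] p q by auto
  \<comment> \<open>The radius exceeds the distance of \<open>x\<close> by one because
    \<open>y\<close> may be the farther end of the edge.\<close>
  obtain s where s: "\<And>p. geod K z p \<Longrightarrow> vdist K z (hd p) \<le> Suc (vdist K z x) \<Longrightarrow> s (hd p) = nf K p"
    "\<And>u v. (u, v) \<in> E \<Longrightarrow> vdist K z u \<le> Suc (vdist K z x) \<Longrightarrow> vdist K z v \<le> Suc (vdist K z x) \<Longrightarrow> s v = transport K u v (s u)"
    by (rule geod_section[OF z, where R = "Suc (vdist K z x)"]) (rule that)
  have sxy: "s x = nf K (x # p)" "s y = nf K (y # q)" "s y = transport K x y (s x)"
    using s(1)[OF p(1)] s(1)[OF q(1)] s(2)[OF e] le by auto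
  have "red K z (x # p)" using geod_red p by (metis geod_def)
  then show ?thesis using e
  proof (cases rule: red_edge_cases)
    case (backward r)
    have "walk K z (y # r)" using sim_walk[OF backward(1)] p by (auto simp: geod_def elim: walk_ConsE)
    then have "vdist K z y \<le> length r" by (rule walk_vdist)
    moreover have "length p = Suc (length r)" using sim_length[OF backward(1)] by simp
    ultimately show ?thesis using le p by simp
  next
    case forward
    then have "sim K (y # x # p) (y # q)" using sxy by (simp add: nf_eq_iff)
    from sim_length[OF this] show ?thesis using p q by simp
  qed
qed

text \<open>The shortest paths to \<open>x\<close> through \<open>u\<close> and through
  \<open>w\<close> are related by exchanges, so \<open>sim_last_edges\<close> yields a square on
  their last edges, and a path to \<open>u\<close> of the same length as before that arrives from
  its fourth corner.\<close>

lemma quadrangle: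
  assumes z: "z \<in> verts K" and e: "(x, u) \<in> E" "(x, w) \<in> E" "u \<noteq> w"
    and d: "vdist K z x = Suc (vdist K z u)" "vdist K z x = Suc (vdist K z w)"
  shows "\<exists>y. sq K x u y w \<and> vdist K z u = Suc (vdist K z y)"
proof -
  have v: "u \<in> verts K" "w \<in> verts K" using edges_verts e by metis+
  obtain p where p: "geod K z (u # p)" "length p = vdist K z u" using geod_ex z v by blast
  obtain q where q: "geod K z (w # q)" "length q = vdist K z w" using geod_ex z v by blast
  have "geod K z (x # u # p)" "geod K z (x # w # q)"
    using p q e d edges_sym by (auto simp: geod_def intro!: walk.snoc)
  then have "sim K (x # u # p) (x # w # q)" using geod_sim z by blast
  from sim_last_edges[OF this] e(3) obtain y r where y: "sq K x u y w" "sim K (u # p) (u # y # r)" by auto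
  have "walk K z (y # r)" using sim_walk[OF y(2)] p by (auto simp: geod_def elim: walk_ConsE)
  then have "vdist K z y \<le> length r" by (rule walk_vdist)
  moreover have "length p = Suc (length r)" using sim_length[OF y(2)] by simp
  moreover have "(u, y) \<in> E" using y by (simp add: sq_def)
  ultimately show ?thesis using vdist_adjacent[OF z, of u y] y p by auto
qed

end

section \<open>The local identity\<close>

locale locally_finite_flag = simply_connected_flag K + locally_finite_cubical K for K :: "'v set set"
begin

text \<open>Otherwise both \<open>u\<close> and \<open>w\<close> are closer to \<open>z\<close> than
  \<open>x\<close>, while \<open>y\<close> is as far as \<open>x\<close>. The quadrangle condition
  then gives a square with the same three corners whose fourth corner, necessarily \<open>y\<close>,
  is closer than \<open>u\<close>.\<close>

lemma square_descent:
  assumes z: "z \<in> verts K" and s: "sq K x u y w" and d: "vdist K z x = Suc (vdist K z u)"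
  shows "vdist K z w = Suc (vdist K z y)"
proof (rule ccontr)
  assume n: "vdist K z w \<noteq> Suc (vdist K z y)"
  have e: "(x, u) \<in> E" "(x, w) \<in> E" "(u, y) \<in> E" "(w, y) \<in> E" "u \<noteq> w" using s edges_sym by (auto simp: sq_def)
  have 1: "vdist K z y = Suc (vdist K z w)" using vdist_adjacent[OF z e(4)] n by simp
  have "vdist K z x = Suc (vdist K z w)" using vdist_adjacent[OF z e(2)] vdist_adjacent[OF z e(3)] d 1 by linarith
  then obtain y' where "sq K x u y' w" "vdist K z u = Suc (vdist K z y')" using quadrangle[OF z e(1,2,5) d] by blast
  then have "vdist K z u = Suc (vdist K z y)" using sq_unique s by metis
  then show False using 1 \<open>vdist K z x = Suc (vdist K z w)\<close> d by simp
qed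

definition descending :: "'v \<Rightarrow> 'v \<Rightarrow> 'v set" where
  "descending z x = {u. (x, u) \<in> E \<and> vdist K z x = Suc (vdist K z u)}"

lemma finite_descending: "finite (descending z x)"
  by (rule finite_subset[OF _ finite_nbs[of x]]) (auto simp: descending_def nbs_def)

text \<open>Parallel edges of a cube are linked by squares to the edge at \<open>v\<close>, and
  \<open>square_descent\<close> moves the sign of the change in distance across each square.\<close>

lemma cube_edge_vdist:
  assumes z: "z \<in> verts K" and C: "C \<in> K" "v \<in> C" and ab: "a \<in> C" "b \<in> C"
    and i: "i \<in> nbc K v C" "i \<notin> lab K v a" "lab K v b = insert i (lab K v a)"
  shows "if i \<in> descending z v then vdist K z a = Suc (vdist K z b) else vdist K z b = Suc (vdist K z a)"
  using ab i(2,3)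
proof (induction "card (lab K v a)" arbitrary: a b rule: less_induct)
  case less
  note ab = less.prems(1,2)
  have la: "lab K v a \<subseteq> nbc K v C" by (rule lab_subset[OF C ab(1)])
  have fa: "finite (lab K v a)" using la nbc_finite[OF C(1)] finite_subset by blast
  have iC: "i \<in> C" "(v, i) \<in> E" using i(1) by (auto simp: nbc_def)
  have vv: "lab K v v = {}" using lab_self C by (auto simp: verts_def)
  show ?case
  proof (cases "lab K v a = {}")
    case True
    then have "a = v" using lab_inj[OF C ab(1) C(2)] vv by simp
    moreover have "b = i" using lab_inj[OF C ab(2) iC(1)] lab_nb[OF C i(1)] less.prems(4) True by simp
    ultimately show ?thesis using iC(2) vdist_adjacent[OF z iC(2)] by (auto simp: descending_def)
  next
    case False
    then obtain j where j: "j \<in> lab K v a" by blast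
    then have ij: "i \<noteq> j" "j \<in> nbc K v C" using less.prems(3) la by auto
    obtain a' where a': "a' \<in> C" "lab K v a' = lab K v a - {j}"
      using lab_ex[OF C, of "lab K v a - {j}"] la by auto
    obtain b' where b': "b' \<in> C" "lab K v b' = insert i (lab K v a')"
      using lab_ex[OF C, of "insert i (lab K v a')"] la a' i(1) by auto
    have s: "sq K a' b' b a"
      by (rule lab_sq[OF C a'(1) b'(1) ab(2,1) i(1) ij(2,1)]) (use a' b' less.prems j in auto)
    have "card (lab K v a') < card (lab K v a)" unfolding a'(2) using fa j by (rule card_Diff1_less)
    moreover have "i \<notin> lab K v a'" using a' less.prems by auto
    ultimately have IH: "if i \<in> descending z v then vdist K z a' = Suc (vdist K z b') else vdist K z b' = Suc (vdist K z a')"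
      using less.hyps[OF _ a'(1) b'(1) _ b'(2)] by blast
    show ?thesis
    proof (cases "i \<in> descending z v")
      case True
      then show ?thesis using IH square_descent[OF z s] by simp
    next
      case False
      have "sq K b' a' a b" using s sq_rotate sq_flip by metis
      then show ?thesis using False IH square_descent[OF z] by simp
    qed
  qed
qed

text \<open>Each direction in the label adds or removes 1, independently of the order of crossing.
  The removed part stands on the left because subtraction of naturals truncates.\<close>

lemma cube_vdist:
  assumes z: "z \<in> verts K" and C: "C \<in> K" "v \<in> C" and a: "a \<in> C"
  shows "vdist K z a + card (lab K v a \<inter> descending z v) = vdist K z v + card (lab K v a - descending z v)"
proof -
  have vv: "lab K v v = {}" using lab_self C by (auto simp: verts_def)
  have "\<forall>a\<in>C. lab K v a = A \<longrightarrow> vdist K z a + card (A \<inter> descending z v) = vdist K z v + card (A - descending z v)"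
    if "finite A" "A \<subseteq> nbc K v C" for A
    using that
  proof (induction rule: finite_induct)
    case empty
    then show ?case using lab_inj[OF C _ C(2)] vv by auto
  next
    case (insert i A)
    show ?case
    proof (intro ballI impI)
      fix b assume b: "b \<in> C" "lab K v b = insert i A"
      obtain a where a: "a \<in> C" "lab K v a = A" using lab_ex[OF C, of A] insert.prems by auto
      have "if i \<in> descending z v then vdist K z a = Suc (vdist K z b) else vdist K z b = Suc (vdist K z a)"
        by (rule cube_edge_vdist[OF z C a(1) b(1)]) (use insert a b in auto)
      moreover have "vdist K z a + card (A \<inter> descending z v) = vdist K z v + card (A - descending z v)"
        using insert a by auto
      ultimately show "vdist K z b + card (insert i A \<inter> descending z v) = vdist K z v + card (insert i A - descending z v)"
        using insert.hyps by (auto simp: insert_Diff_if split: if_splits)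
    qed
  qed
  then show ?thesis using a lab_subset[OF C a] nbc_finite[OF C(1)] finite_subset by metis
qed

lemma vdist_lab:
  assumes C: "C \<in> K" "v \<in> C" and a: "a \<in> C"
  shows "vdist K v a = card (lab K v a)"
  using cube_vdist[OF _ C a, of v] C by (auto simp: verts_def descending_def)

lemma link_f_eq:
  assumes "x \<in> verts K"
  shows "link_f K x y s = (\<Sum>Q | Q \<in> K \<and> x \<in> Q \<and> y \<in> Q. s ^ (card (nbc K x Q) - card (lab K x y)))"
proof (cases "in_common_cube K x y")
  case True
  then obtain C where C: "C \<in> K" "x \<in> C" "y \<in> C" by (auto simp: in_common_cube_def)
  have eq: "(Q \<in> K \<and> mc x y \<subseteq> Q) \<longleftrightarrow> (Q \<in> K \<and> x \<in> Q \<and> y \<in> Q)" for Q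
    using mem_min_cube[where K = K and x = x and y = y] min_cube_subset[of Q K x y] by auto
  have "cube_dim K (mc x y) = card (lab K x y)"
    using cube_dim_eq[OF min_cube_in[OF C]] mem_min_cube(1) by (metis lab_def)
  then show ?thesis using True unfolding link_f_def eq
    by (auto intro!: sum.cong simp: cube_dim_eq)
next
  case False
  then have e: "{Q. Q \<in> K \<and> x \<in> Q \<and> y \<in> Q} = {}" by (auto simp: in_common_cube_def)
  show ?thesis unfolding e using False by (simp add: link_f_def)
qed

text \<open>Two descending neighbours of \<open>x\<close> span a square by the quadrangle condition.
  The flag condition then gives a cube containing any prescribed set of them, and one of its faces
  has exactly these directions at \<open>x\<close>.\<close>

lemma descending_cubes:
  assumes z: "z \<in> verts K" and x: "x \<in> verts K"
  shows "bij_betw (nbc K x) {Q \<in> K. x \<in> Q \<and> nbc K x Q \<subseteq> descending z x} (Pow (descending z x))"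
proof (rule bij_betw_imageI)
  show "inj_on (nbc K x) {Q \<in> K. x \<in> Q \<and> nbc K x Q \<subseteq> descending z x}"
    using cube_eq_iff_nbc by (auto simp: inj_on_def)
  show "nbc K x ` {Q \<in> K. x \<in> Q \<and> nbc K x Q \<subseteq> descending z x} = Pow (descending z x)"
  proof (intro equalityI subsetI)
    fix U assume "U \<in> Pow (descending z x)"
    then have U: "U \<subseteq> descending z x" by simp
    have "\<exists>C\<in>K. x \<in> C \<and> U \<subseteq> C"
    proof (rule flag[OF x])
      show "finite U" using U finite_descending finite_subset by blast
      show "(x, a) \<in> E" if "a \<in> U" for a using that U by (auto simp: descending_def)
      show "\<exists>C\<in>K. x \<in> C \<and> a \<in> C \<and> b \<in> C" if ab: "a \<in> U" "b \<in> U" "a \<noteq> b" for a b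
      proof -
        have "\<exists>y. sq K x a y b \<and> vdist K z a = Suc (vdist K z y)"
          by (rule quadrangle[OF z]) (use ab U in \<open>auto simp: descending_def\<close>)
        then show ?thesis by (auto simp: sq_def)
      qed
    qed
    then obtain C where C: "C \<in> K" "x \<in> C" "U \<subseteq> C" by blast
    then have nU: "U \<subseteq> nbc K x C" using U by (auto simp: nbc_def descending_def)
    note f = nbc_face[OF C(1,2) nU]
    have "x \<in> {w \<in> C. lab K x w \<subseteq> U}" using C lab_self[OF x] by auto
    then show "U \<in> nbc K x ` {Q \<in> K. x \<in> Q \<and> nbc K x Q \<subseteq> descending z x}"
      using f U by (intro image_eqI[of _ _ "{w \<in> C. lab K x w \<subseteq> U}"]) auto
  qed auto
qed

lemma descending_empty_iff:
  assumes z: "z \<in> verts K" and x: "x \<in> verts K"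
  shows "descending z x = {} \<longleftrightarrow> x = z"
proof
  assume d: "descending z x = {}"
  show "x = z"
  proof (rule ccontr)
    assume "x \<noteq> z"
    obtain p where p: "geod K z (x # p)" "length p = vdist K z x" using geod_ex[OF z x] by blast
    show False
    proof (cases p)
      case Nil
      then have "walk K z [x]" using p by (simp add: geod_def)
      then show False using \<open>x \<noteq> z\<close> by (auto elim: walk.cases)
    next
      case (Cons u q)
      then have "vdist K z x = Suc (vdist K z u)" using geod_tl p by blast
      moreover have "(u, x) \<in> E" using p Cons by (auto simp: geod_def elim: walk_ConsE)
      then have "(x, u) \<in> E" by (rule edges_sym)
      ultimately show False using d by (auto simp: descending_def)
    qed
  qed
qed (simp add: descending_def)

text \<open>Distances are counted from the corner of the cube nearest to \<open>z\<close>: a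
  direction leading away from \<open>z\<close> costs a factor t if crossed, one leading towards
  \<open>z\<close> if not crossed. These are the sums of the two choices for a single
  direction.\<close>

lemma fps_weights:
  defines "a \<equiv> - fps_X / (1 - fps_X\<^sup>2) :: rat fps" and "b \<equiv> fps_X\<^sup>2 / (1 - fps_X\<^sup>2) :: rat fps"
  shows "a * fps_X + b = 0" "a + b * fps_X = - fps_X"
proof -
  define q where "q = inverse (1 - fps_X\<^sup>2 :: rat fps)"
  have n: "fps_nth (1 - fps_X\<^sup>2 :: rat fps) 0 \<noteq> 0" by simp
  have q: "q * (1 - fps_X\<^sup>2) = 1" unfolding q_def by (rule inverse_mult_eq_1[OF n])
  have ab: "a = - fps_X * q" "b = fps_X\<^sup>2 * q" unfolding a_def b_def q_def by (rule fps_divide_unit[OF n])+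
  show "a * fps_X + b = 0" unfolding ab by (simp add: power2_eq_square algebra_simps)
  have "a + b * fps_X = - fps_X * (q * (1 - fps_X\<^sup>2))" unfolding ab by (simp add: power2_eq_square algebra_simps)
  then show "a + b * fps_X = - fps_X" unfolding q by simp
qed

text \<open>The sum over the corners of one cube factors over its directions at \<open>x\<close>; a direction leading
  away from \<open>z\<close> contributes the factor 0, one leading towards \<open>z\<close> the factor \<open>- t\<close>.\<close>

lemma cube_sum:
  defines "a \<equiv> - fps_X / (1 - fps_X\<^sup>2) :: rat fps" and "b \<equiv> fps_X\<^sup>2 / (1 - fps_X\<^sup>2) :: rat fps"
  assumes z: "z \<in> verts K" and Q: "Q \<in> K" "x \<in> Q"
  shows "(\<Sum>y\<in>Q. a ^ card (lab K x y) * b ^ (card (nbc K x Q) - card (lab K x y)) * fps_X ^ vdist K z y) =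
    (if nbc K x Q \<subseteq> descending z x then (- 1) ^ card (nbc K x Q) * fps_X ^ vdist K z x else 0)"
proof -
  define N where "N = nbc K x Q"
  define P where "P = N \<inter> descending z x"
  have fN: "finite N" "finite P" using nbc_finite[OF Q(1)] by (auto simp: N_def P_def)
  have PN: "P \<subseteq> N" by (simp add: P_def)
  have vd: "vdist K z y + card (lab K x y \<inter> P) = vdist K z x + card (lab K x y - P)" if "y \<in> Q" for y
  proof -
    have "lab K x y \<inter> P = lab K x y \<inter> descending z x" "lab K x y - P = lab K x y - descending z x"
      using lab_subset[OF Q that] by (auto simp: P_def N_def)
    then show ?thesis using cube_vdist[OF z Q that] by simp
  qed
  have "\<exists>y\<in>Q. lab K x y = P" by (rule lab_ex[OF Q]) (use PN N_def in auto)
  then obtain y where "y \<in> Q" "lab K x y = P" by blast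
  then have eP: "card P \<le> vdist K z x" using vd[of y] by simp
  \<comment> \<open>The distance to \<open>z\<close> of the corner with label \<open>P\<close>, the
    one nearest to \<open>z\<close>. A corner with label \<open>A\<close> is farther by one for each
    direction in \<open>A - P\<close> or \<open>P - A\<close>.\<close>
  define e where "e = vdist K z x - card P"
  have corner: "a ^ card (lab K x y) * b ^ (card N - card (lab K x y)) * fps_X ^ vdist K z y =
      fps_X ^ e * (\<Prod>u\<in>N. if u \<in> lab K x y then a * (if u \<in> P then 1 else fps_X) else b * (if u \<in> P then fps_X else 1))"
    if y: "y \<in> Q" for y
  proof -
    define A where "A = lab K x y"
    have A: "A \<subseteq> N" using lab_subset[OF Q y] by (simp add: A_def N_def)
    have fA: "finite A" using A fN finite_subset by blast
    have c: "card P = card (A \<inter> P) + card (P - A)" using card_Int_Diff[OF fN(2), of A] by (simp add: Int_commute)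
    have v: "vdist K z y = e + card (A - P) + card (P - A)"
      using vd[OF y] c eP by (simp add: A_def e_def)
    have "(\<Prod>u\<in>N. if u \<in> A then a * (if u \<in> P then 1 else fps_X) else b * (if u \<in> P then fps_X else 1)) =
      (\<Prod>u\<in>N - A. b * (if u \<in> P then fps_X else 1)) * (\<Prod>u\<in>A. a * (if u \<in> P then 1 else fps_X))"
      unfolding prod.subset_diff[OF A fN(1)] by (intro arg_cong2[where f = "(*)"] prod.cong) auto
    also have "(\<Prod>u\<in>N - A. b * (if u \<in> P then fps_X else 1)) = b ^ (card N - card A) * fps_X ^ card (P - A)"
    proof -
      have "(\<Prod>u\<in>N - A. if u \<in> P then fps_X else 1) = (\<Prod>u\<in>P - A. fps_X :: rat fps)"
        by (rule prod.mono_neutral_cong_right) (use fN PN in auto)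
      then show ?thesis using A fA by (simp add: prod.distrib card_Diff_subset)
    qed
    also have "(\<Prod>u\<in>A. a * (if u \<in> P then 1 else fps_X)) = a ^ card A * fps_X ^ card (A - P)"
    proof -
      have "(\<Prod>u\<in>A. if u \<in> P then 1 else fps_X) = (\<Prod>u\<in>A - P. fps_X :: rat fps)"
        by (rule prod.mono_neutral_cong_right) (use fA in auto)
      then show ?thesis by (simp add: prod.distrib)
    qed
    finally show ?thesis unfolding A_def[symmetric] v by (simp add: power_add mult_ac)
  qed
  have "(\<Sum>y\<in>Q. a ^ card (lab K x y) * b ^ (card N - card (lab K x y)) * fps_X ^ vdist K z y) =
    fps_X ^ e * (\<Sum>y\<in>Q. \<Prod>u\<in>N. if u \<in> lab K x y then a * (if u \<in> P then 1 else fps_X) else b * (if u \<in> P then fps_X else 1))"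
    unfolding sum_distrib_left by (rule sum.cong[OF HOL.refl corner])
  also have "(\<Sum>y\<in>Q. \<Prod>u\<in>N. if u \<in> lab K x y then a * (if u \<in> P then 1 else fps_X) else b * (if u \<in> P then fps_X else 1)) =
    (\<Sum>A\<in>Pow N. \<Prod>u\<in>N. if u \<in> A then a * (if u \<in> P then 1 else fps_X) else b * (if u \<in> P then fps_X else 1))"
    unfolding N_def by (rule sum.reindex_bij_betw[OF lab_bij[OF Q]])
  also have "\<dots> = (\<Prod>u\<in>N. a * (if u \<in> P then 1 else fps_X) + b * (if u \<in> P then fps_X else 1))"
    by (rule sum_Pow_prod[OF fN(1)])
  also have "\<dots> = (\<Prod>u\<in>N. if u \<in> P then - fps_X else 0)"
    using fps_weights by (intro prod.cong) (auto simp: a_def b_def)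
  also have "fps_X ^ e * \<dots> = (if N \<subseteq> descending z x then (- 1) ^ card N * fps_X ^ vdist K z x else 0)"
  proof (cases "N \<subseteq> descending z x")
    case True
    then have "P = N" by (auto simp: P_def)
    then have "(\<Prod>u\<in>N. if u \<in> P then - fps_X else 0) = (- fps_X :: rat fps) ^ card N" by simp
    also have "\<dots> = (- 1) ^ card N * fps_X ^ card N" by (rule power_minus)
    finally have 1: "fps_X ^ e * (\<Prod>u\<in>N. if u \<in> P then - fps_X else 0) = (- 1) ^ card N * (fps_X ^ e * fps_X ^ card N :: rat fps)" by simp
    have "e + card N = vdist K z x" using eP \<open>P = N\<close> by (simp add: e_def)
    then show ?thesis using True 1 by (simp flip: power_add)
  next
    case False
    then obtain u where "u \<in> N" "u \<notin> P" by (auto simp: P_def)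
    then have "(\<Prod>u\<in>N. if u \<in> P then - fps_X else 0) = (0 :: rat fps)" using fN by (intro prod_zero) auto
    then show ?thesis using False by simp
  qed
  finally show ?thesis unfolding N_def .
qed

lemma finite_star: "x \<in> verts K \<Longrightarrow> finite {y. in_common_cube K x y}"
proof -
  assume x: "x \<in> verts K"
  have "{y. in_common_cube K x y} = \<Union>{C \<in> K. x \<in> C}" by (auto simp: in_common_cube_def)
  then show ?thesis using finite_cubes_at[OF x] cube_finite by auto
qed

lemma c_coeff_eq:
  assumes "x \<in> verts K"
  shows "c_coeff K x y = (\<Sum>Q | Q \<in> K \<and> x \<in> Q \<and> y \<in> Q.
     (- fps_X / (1 - fps_X\<^sup>2)) ^ card (lab K x y) * (fps_X\<^sup>2 / (1 - fps_X\<^sup>2)) ^ (card (nbc K x Q) - card (lab K x y)))"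
  unfolding c_coeff_def link_f_eq[OF assms] sum_distrib_left
  by (rule sum.cong) (auto simp: vdist_lab)

theorem local_inverse:
  assumes z: "z \<in> verts K" and x: "x \<in> verts K"
  shows "(\<Sum>y | in_common_cube K x y. c_coeff K x y * fps_X ^ vdist K z y) = (if x = z then 1 else 0)"
proof -
  define a where "a = (- fps_X / (1 - fps_X\<^sup>2) :: rat fps)"
  define b where "b = (fps_X\<^sup>2 / (1 - fps_X\<^sup>2) :: rat fps)"
  define D where "D = descending z x"
  have fD: "finite D" by (simp add: D_def finite_descending)
  have fx: "finite {Q \<in> K. x \<in> Q}" by (rule finite_cubes_at[OF x])
  have "(\<Sum>y | in_common_cube K x y. c_coeff K x y * fps_X ^ vdist K z y) =
    (\<Sum>y | in_common_cube K x y. \<Sum>Q | Q \<in> {Q \<in> K. x \<in> Q} \<and> y \<in> Q.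
       a ^ card (lab K x y) * b ^ (card (nbc K x Q) - card (lab K x y)) * fps_X ^ vdist K z y)"
    unfolding c_coeff_eq[OF x] sum_distrib_right a_def b_def by (rule sum.cong) (auto intro!: sum.cong)
  also have "\<dots> = (\<Sum>Q\<in>{Q \<in> K. x \<in> Q}. \<Sum>y | y \<in> {y. in_common_cube K x y} \<and> y \<in> Q.
       a ^ card (lab K x y) * b ^ (card (nbc K x Q) - card (lab K x y)) * fps_X ^ vdist K z y)"
    by (rule sum.swap_restrict[OF finite_star[OF x] fx])
  also have "\<dots> = (\<Sum>Q\<in>{Q \<in> K. x \<in> Q}. \<Sum>y\<in>Q.
       a ^ card (lab K x y) * b ^ (card (nbc K x Q) - card (lab K x y)) * fps_X ^ vdist K z y)"
    by (intro sum.cong) (auto simp: in_common_cube_def)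
  also have "\<dots> = (\<Sum>Q\<in>{Q \<in> K. x \<in> Q}. if nbc K x Q \<subseteq> D then (- 1) ^ card (nbc K x Q) * fps_X ^ vdist K z x else 0)"
    unfolding a_def b_def D_def by (rule sum.cong[OF HOL.refl], rule cube_sum[OF z]) auto
  also have "\<dots> = (\<Sum>Q\<in>{Q \<in> K. x \<in> Q \<and> nbc K x Q \<subseteq> D}. (- 1) ^ card (nbc K x Q) * fps_X ^ vdist K z x)"
    by (rule sum.mono_neutral_cong_right) (use fx in auto)
  also have "\<dots> = (\<Sum>U\<in>Pow D. (- 1) ^ card U * fps_X ^ vdist K z x)"
    unfolding D_def by (rule sum.reindex_bij_betw[OF descending_cubes[OF z x]])
  also have "\<dots> = (\<Sum>U\<in>Pow D. (- 1) ^ card U) * fps_X ^ vdist K z x"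
    by (simp add: sum_distrib_right)
  \<comment> \<open>As a product over \<open>D\<close>, the sign lets the sum over subsets collapse
    to a product of factors - 1 + 1, which is nonzero only for the empty product.\<close>
  also have "(\<Sum>U\<in>Pow D. (- 1) ^ card U) = (\<Sum>U\<in>Pow D. \<Prod>u\<in>D. if u \<in> U then - 1 else 1 :: rat fps)"
  proof (rule sum.cong[OF HOL.refl])
    fix U assume "U \<in> Pow D"
    then have "(\<Prod>u\<in>D. if u \<in> U then - 1 else 1 :: rat fps) = (\<Prod>u\<in>U. - 1)"
      by (intro prod.mono_neutral_cong_right) (use fD in auto)
    then show "(- 1) ^ card U = (\<Prod>u\<in>D. if u \<in> U then - 1 else 1 :: rat fps)" by simp
  qed
  also have "\<dots> = (\<Prod>u\<in>D. - 1 + 1)" by (rule sum_Pow_prod[OF fD])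
  also have "\<dots> = (if D = {} then 1 else 0)" using fD by (auto simp: card_gt_0_iff)
  also have "(if D = {} then 1 else 0) * fps_X ^ vdist K z x = (if x = z then 1 else 0 :: rat fps)"
    using descending_empty_iff[OF z x] by (simp add: D_def)
  finally show ?thesis .
qed

end

section \<open>Sums over orbits\<close>

lemma bij_betw_filter:
  assumes f: "bij_betw f A B" and PQ: "\<And>a. a \<in> A \<Longrightarrow> P a \<longleftrightarrow> Q (f a)"
  shows "bij_betw f {a \<in> A. P a} {b \<in> B. Q b}"
proof (rule bij_betw_imageI)
  show "inj_on f {a \<in> A. P a}" by (rule inj_on_subset[OF bij_betw_imp_inj_on[OF f]]) auto
  show "f ` {a \<in> A. P a} = {b \<in> B. Q b}" using bij_betw_imp_surj_on[OF f] PQ by auto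
qed

lemma fps_mult_nth_cong:
  fixes f g h :: "'a::comm_ring_1 fps"
  assumes "\<And>k. k \<le> n \<Longrightarrow> fps_nth f k = fps_nth g k"
  shows "fps_nth (f * h) n = fps_nth (g * h) n" "fps_nth (h * f) n = fps_nth (h * g) n"
  using assms by (auto simp: fps_mult_nth intro!: sum.cong)

lemma sum_fps_X_nth:
  assumes "finite B"
  shows "fps_nth (\<Sum>y\<in>B. fps_X ^ d y :: rat fps) k = of_nat (card {y \<in> B. d y = k})"
proof -
  have "fps_nth (\<Sum>y\<in>B. fps_X ^ d y :: rat fps) k = (\<Sum>y\<in>B. if d y = k then 1 else 0)"
    by (simp add: fps_sum_nth eq_commute)
  also have "\<dots> = (\<Sum>y\<in>{y \<in> B. d y = k}. 1)" by (simp only: sum.inter_filter[OF assms])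
  finally show ?thesis by simp
qed

section \<open>Finite balls and symmetry of the coefficients\<close>

context locally_finite_flag
begin

lemma vdist_relpow: "x \<in> verts K \<Longrightarrow> y \<in> verts K \<Longrightarrow> (x, y) \<in> E ^^ vdist K x y"
proof -
  assume "x \<in> verts K" "y \<in> verts K"
  then obtain n where "(x, y) \<in> E ^^ n" using connected rtrancl_imp_relpow by metis
  then show ?thesis unfolding vdist_def by (rule LeastI)
qed

lemma vdist_triangle:
  assumes "x \<in> verts K" "y \<in> verts K" "w \<in> verts K"
  shows "vdist K x w \<le> vdist K x y + vdist K y w"
proof -
  have "(x, w) \<in> E ^^ (vdist K x y + vdist K y w)"
    unfolding relpow_add using vdist_relpow assms by blast
  then show ?thesis unfolding vdist_def[of K x w] by (rule Least_le)
qed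

lemma finite_vball:
  assumes x: "x \<in> verts K"
  shows "finite {y \<in> verts K. vdist K x y \<le> n}"
proof (induction n)
  case 0
  have "{y \<in> verts K. vdist K x y \<le> 0} \<subseteq> {x}" using vdist_relpow[OF x] by fastforce
  then show ?case using finite_subset by blast
next
  case (Suc n)
  let ?B = "{y \<in> verts K. vdist K x y \<le> n}"
  have "{y \<in> verts K. vdist K x y \<le> Suc n} \<subseteq> ?B \<union> (\<Union>u\<in>?B. nbs K u)"
  proof
    fix y assume y: "y \<in> {y \<in> verts K. vdist K x y \<le> Suc n}"
    show "y \<in> ?B \<union> (\<Union>u\<in>?B. nbs K u)"
    proof (cases "vdist K x y \<le> n")
      case False
      then have "vdist K x y = Suc n" using y by simp
      then obtain u where u: "(x, u) \<in> E ^^ n" "(u, y) \<in> E" using vdist_relpow[OF x, of y] y by auto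
      have "vdist K x u \<le> n" unfolding vdist_def using u(1) by (rule Least_le)
      then show ?thesis using u(2) edges_verts[OF u(2)] by (auto simp: nbs_def)
    qed (use y in auto)
  qed
  moreover have "finite (?B \<union> (\<Union>u\<in>?B. nbs K u))" using Suc finite_nbs by simp
  ultimately show ?case using finite_subset by blast
qed

abbreviation "star x \<equiv> {y. in_common_cube K x y}"

lemma star_commute: "in_common_cube K x y \<longleftrightarrow> in_common_cube K y x"
  by (auto simp: in_common_cube_def)

lemma star_verts: "in_common_cube K x y \<Longrightarrow> x \<in> verts K \<and> y \<in> verts K"
  by (auto simp: in_common_cube_def verts_def)

lemma c_coeff_outside: "\<not> in_common_cube K x y \<Longrightarrow> c_coeff K x y = 0"
  by (simp add: c_coeff_def link_f_def)

text \<open>With exponents given by distance and dimension, symmetry in \<open>x\<close> and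
  \<open>y\<close> and invariance under the group become visible; labels depend on the corner
  \<open>x\<close>.\<close>

lemma c_coeff_dim:
  assumes "x \<in> verts K"
  shows "c_coeff K x y = (\<Sum>Q | Q \<in> K \<and> x \<in> Q \<and> y \<in> Q.
     (- fps_X / (1 - fps_X\<^sup>2)) ^ vdist K x y * (fps_X\<^sup>2 / (1 - fps_X\<^sup>2)) ^ (cube_dim K Q - vdist K x y))"
  unfolding c_coeff_eq[OF assms] by (rule sum.cong) (auto simp: vdist_lab cube_dim_eq)

lemma c_coeff_commute: "c_coeff K x y = c_coeff K y x"
proof (cases "in_common_cube K x y")
  case True
  then show ?thesis using star_verts[OF True] by (simp add: c_coeff_dim vdist_commute[of K x y] conj_commute)
next
  case False
  then show ?thesis using c_coeff_outside star_commute by metis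
qed

end

section \<open>Invariance under the group and the two matrix products\<close>

locale flag_action = locally_finite_flag K + group_action G "verts K" \<phi>
  for K :: "'v set set" and G :: "('g, 'm) monoid_scheme" (structure) and \<phi> +
  assumes cellular: "g \<in> carrier G \<Longrightarrow> C \<in> K \<Longrightarrow> \<phi> g ` C \<in> K"
begin

sublocale group G
  using group_hom group_hom.axioms(1) by blast

lemma act_verts: "g \<in> carrier G \<Longrightarrow> v \<in> verts K \<Longrightarrow> \<phi> g v \<in> verts K"
  by (rule element_image) auto

lemma act_inv: "g \<in> carrier G \<Longrightarrow> v \<in> verts K \<Longrightarrow> \<phi> (inv g) (\<phi> g v) = v"
  by (rule orbit_sym_aux) auto

lemma act_inv': "g \<in> carrier G \<Longrightarrow> v \<in> verts K \<Longrightarrow> \<phi> g (\<phi> (inv g) v) = v"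
  using orbit_sym_aux[of "inv g" v] by simp

lemma act_inj: "g \<in> carrier G \<Longrightarrow> u \<in> verts K \<Longrightarrow> v \<in> verts K \<Longrightarrow> \<phi> g u = \<phi> g v \<longleftrightarrow> u = v"
  using inj_prop by (meson inj_on_eq_iff)

lemma cube_verts: "C \<in> K \<Longrightarrow> C \<subseteq> verts K"
  by (auto simp: verts_def)

lemma act_edge: "g \<in> carrier G \<Longrightarrow> (u, v) \<in> E \<Longrightarrow> (\<phi> g u, \<phi> g v) \<in> E"
proof -
  assume g: "g \<in> carrier G" and e: "(u, v) \<in> E"
  have "\<phi> g ` {u, v} \<in> K" by (rule cellular[OF g]) (use e in \<open>simp add: edges_def\<close>)
  then show ?thesis using e act_inj[OF g] edges_verts[OF e] by (auto simp: edges_def)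
qed

lemma act_relpow: "g \<in> carrier G \<Longrightarrow> (u, v) \<in> E ^^ n \<Longrightarrow> (\<phi> g u, \<phi> g v) \<in> E ^^ n"
  by (induction n arbitrary: v) (auto intro: act_edge)

lemma act_vdist:
  assumes g: "g \<in> carrier G" and uv: "u \<in> verts K" "v \<in> verts K"
  shows "vdist K (\<phi> g u) (\<phi> g v) = vdist K u v"
proof -
  have "(\<phi> g u, \<phi> g v) \<in> E ^^ n \<longleftrightarrow> (u, v) \<in> E ^^ n" for n
    using act_relpow[OF g, of u v n] act_relpow[of "inv g" "\<phi> g u" "\<phi> g v" n] act_inv[OF g] g uv by auto
  then show ?thesis by (simp add: vdist_def)
qed

lemma act_cube_bij:
  assumes g: "g \<in> carrier G" and xy: "x \<in> verts K" "y \<in> verts K"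
  shows "bij_betw (image (\<phi> g)) {Q. Q \<in> K \<and> x \<in> Q \<and> y \<in> Q} {Q. Q \<in> K \<and> \<phi> g x \<in> Q \<and> \<phi> g y \<in> Q}"
proof (rule bij_betw_byWitness[where f' = "image (\<phi> (inv g))"])
  have i: "inv g \<in> carrier G" using g by simp
  have inv1: "\<phi> (inv g) ` \<phi> g ` Q = Q" if "Q \<in> K" for Q
    using act_inv[OF g] cube_verts[OF that] by (force simp: image_image)
  have inv2: "\<phi> g ` \<phi> (inv g) ` Q = Q" if "Q \<in> K" for Q
    using act_inv'[OF g] cube_verts[OF that] by (force simp: image_image)
  show "\<forall>Q\<in>{Q. Q \<in> K \<and> x \<in> Q \<and> y \<in> Q}. \<phi> (inv g) ` \<phi> g ` Q = Q" using inv1 by blast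
  show "\<forall>Q\<in>{Q. Q \<in> K \<and> \<phi> g x \<in> Q \<and> \<phi> g y \<in> Q}. \<phi> g ` \<phi> (inv g) ` Q = Q" using inv2 by blast
  show "image (\<phi> g) ` {Q. Q \<in> K \<and> x \<in> Q \<and> y \<in> Q} \<subseteq> {Q. Q \<in> K \<and> \<phi> g x \<in> Q \<and> \<phi> g y \<in> Q}"
    using cellular[OF g] by auto
  show "image (\<phi> (inv g)) ` {Q. Q \<in> K \<and> \<phi> g x \<in> Q \<and> \<phi> g y \<in> Q} \<subseteq> {Q. Q \<in> K \<and> x \<in> Q \<and> y \<in> Q}"
    using cellular[OF i] act_inv[OF g xy(1)] act_inv[OF g xy(2)] by (auto intro: rev_image_eqI)
qed

lemma act_cube_dim:
  assumes g: "g \<in> carrier G" and Q: "Q \<in> K"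
  shows "cube_dim K (\<phi> g ` Q) = cube_dim K Q"
proof -
  obtain v where v: "v \<in> Q" using cube_nonempty[OF Q] by blast
  have "card (\<phi> g ` Q) = card Q"
    by (rule card_image) (use inj_prop[OF g] cube_verts[OF Q] inj_on_subset in blast)
  moreover have "card Q = 2 ^ cube_dim K Q" using lab_card[OF Q v] cube_dim_eq[OF Q v] by simp
  moreover have "card (\<phi> g ` Q) = 2 ^ cube_dim K (\<phi> g ` Q)"
    using lab_card[OF cellular[OF g Q], of "\<phi> g v"] cube_dim_eq[OF cellular[OF g Q], of "\<phi> g v"] v by simp
  ultimately show ?thesis by simp
qed

lemma act_c_coeff:
  assumes g: "g \<in> carrier G" and xy: "x \<in> verts K" "y \<in> verts K"
  shows "c_coeff K (\<phi> g x) (\<phi> g y) = c_coeff K x y"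
  unfolding c_coeff_dim[OF xy(1)] c_coeff_dim[OF act_verts[OF g xy(1)]] act_vdist[OF g xy]
  by (subst sum.reindex_bij_betw[OF act_cube_bij[OF g xy], symmetric])
    (auto intro!: sum.cong simp: act_cube_dim[OF g])

abbreviation "Orb \<equiv> vert_orbits G K \<phi>"

lemma orbit_eq:
  assumes v: "v \<in> verts K" and w: "w \<in> orbit G \<phi> v"
  shows "orbit G \<phi> w = orbit G \<phi> v" "w \<in> verts K"
proof -
  show wK: "w \<in> verts K" using act_verts v w by (auto simp: orbit_def)
  have sub: "u \<in> verts K" if "u \<in> orbit G \<phi> v" "v \<in> verts K" for u v using act_verts that by (auto simp: orbit_def)
  show "orbit G \<phi> w = orbit G \<phi> v"
  proof (intro equalityI subsetI)
    fix u assume "u \<in> orbit G \<phi> w"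
    then show "u \<in> orbit G \<phi> v" using orbit_trans[OF v wK _ w] sub wK by blast
  next
    fix u assume "u \<in> orbit G \<phi> v"
    then show "u \<in> orbit G \<phi> w" using orbit_trans[OF wK v _ orbit_sym[OF v wK w]] sub v by blast
  qed
qed

lemma Orb_orbit: "y \<in> Orb \<Longrightarrow> v \<in> y \<Longrightarrow> y = orbit G \<phi> v \<and> v \<in> verts K"
proof -
  assume "y \<in> Orb" and v: "v \<in> y"
  then obtain w where "w \<in> verts K" "y = orbit G \<phi> w" by (auto simp: vert_orbits_def orbits_def)
  then show ?thesis using orbit_eq[of w v] v by simp
qed

lemma Orb_rep: "y \<in> Orb \<Longrightarrow> orbit_rep y \<in> y"
proof -
  assume "y \<in> Orb"
  then obtain v where "v \<in> y" using orbit_refl by (auto simp: vert_orbits_def orbits_def)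
  then show ?thesis unfolding orbit_rep_def by (rule someI)
qed

lemma Orb_rep_verts: "y \<in> Orb \<Longrightarrow> orbit_rep y \<in> verts K"
  using Orb_orbit Orb_rep by blast

lemma Orb_disjoint: "x \<in> Orb \<Longrightarrow> y \<in> Orb \<Longrightarrow> v \<in> x \<Longrightarrow> v \<in> y \<Longrightarrow> x = y"
  using Orb_orbit by metis

lemma Orb_cover: "v \<in> verts K \<Longrightarrow> \<exists>y\<in>Orb. v \<in> y"
  using orbit_refl by (auto simp: vert_orbits_def orbits_def)

lemma Orb_translate:
  assumes "y \<in> Orb" "u \<in> y" "v \<in> y"
  obtains g where "g \<in> carrier G" "v = \<phi> g u"
  using Orb_orbit[OF assms(1,2)] assms(3) that by (auto simp: orbit_def)

lemma act_Orb_bij: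
  assumes g: "g \<in> carrier G" and y: "y \<in> Orb"
  shows "bij_betw (\<phi> g) y y"
proof (rule bij_betw_byWitness[where f' = "\<phi> (inv g)"])
  have yv: "v \<in> verts K" if "v \<in> y" for v using Orb_orbit[OF y that] by blast
  have cl: "\<phi> h v \<in> y" if "h \<in> carrier G" "v \<in> y" for h v
    using Orb_orbit[OF y that(2)] that(1) by (auto simp: orbit_def)
  show "\<forall>a\<in>y. \<phi> (inv g) (\<phi> g a) = a" using act_inv[OF g] yv by blast
  show "\<forall>a\<in>y. \<phi> g (\<phi> (inv g) a) = a" using act_inv'[OF g] yv by blast
  show "\<phi> g ` y \<subseteq> y" using cl g by blast
  show "\<phi> (inv g) ` y \<subseteq> y" using cl g by blast
qed

definition growth :: "'v \<Rightarrow> 'v set \<Rightarrow> rat fps" where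
  "growth u z = Abs_fps (\<lambda>n. of_nat (card {z' \<in> z. vdist K u z' = n}))"

lemma growth_act:
  assumes g: "g \<in> carrier G" and u: "u \<in> verts K" and z: "z \<in> Orb"
  shows "growth (\<phi> g u) z = growth u z"
proof -
  have "vdist K u v = n \<longleftrightarrow> vdist K (\<phi> g u) (\<phi> g v) = n" if "v \<in> z" for v n
    using act_vdist[OF g u] Orb_orbit[OF z that] by simp
  then have "bij_betw (\<phi> g) {z' \<in> z. vdist K u z' = n} {z' \<in> z. vdist K (\<phi> g u) z' = n}" for n
    by (intro bij_betw_filter[OF act_Orb_bij[OF g z]])
  from bij_betw_same_card[OF this]
  have "card {z' \<in> z. vdist K u z' = n} = card {z' \<in> z. vdist K (\<phi> g u) z' = n}" for n .
  then show ?thesis by (simp add: growth_def)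
qed

lemma growth_orbit: "z \<in> Orb \<Longrightarrow> y \<in> Orb \<Longrightarrow> u \<in> y \<Longrightarrow> v \<in> y \<Longrightarrow> growth u z = growth v z"
proof -
  assume z: "z \<in> Orb" and y: "y \<in> Orb" "u \<in> y" "v \<in> y"
  obtain g where "g \<in> carrier G" "v = \<phi> g u" using Orb_translate[OF y] .
  then show ?thesis using growth_act[of g u z] Orb_orbit[OF y(1,2)] z by simp
qed

lemma orbit_growth_series_eq: "z \<in> Orb \<Longrightarrow> orbit_growth_series G K \<phi> y z = growth (orbit_rep y) z"
  using Orb_orbit[OF _ Orb_rep] by (simp add: orbit_growth_series_def growth_series_def growth_def)

text \<open>Orbits may be infinite, so series are compared coefficient by coefficient; in degrees up
  to \<open>n\<close> a finite part of the orbit suffices.\<close>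

lemma growth_truncate:
  assumes u: "u \<in> verts K" and B: "finite B" "B \<subseteq> z" "\<And>z'. z' \<in> z \<Longrightarrow> vdist K u z' \<le> n \<Longrightarrow> z' \<in> B" and k: "k \<le> n"
  shows "fps_nth (growth u z) k = fps_nth (\<Sum>z'\<in>B. fps_X ^ vdist K u z') k"
proof -
  have "{z' \<in> z. vdist K u z' = k} = {z' \<in> B. vdist K u z' = k}" using B k by auto
  then show ?thesis unfolding sum_fps_X_nth[OF B(1)] by (simp add: growth_def)
qed

text \<open>The star of \<open>u\<close> is a finite range of summation that moves with
  \<open>u\<close> under the group, and it contains every nonzero term.\<close>

definition csum :: "'v \<Rightarrow> 'v set \<Rightarrow> rat fps" where
  "csum u z = (\<Sum>z'\<in>z \<inter> star u. c_coeff K u z')"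

lemma c_bar_eq: "x \<in> Orb \<Longrightarrow> c_bar K x y = csum (orbit_rep x) y"
  unfolding c_bar_def csum_def
  by (rule sum.mono_neutral_left) (use finite_star[OF Orb_rep_verts] c_coeff_outside in auto)

lemma csum_orbit:
  assumes "z \<in> Orb" "y \<in> Orb" "u \<in> y" "v \<in> y"
  shows "csum u z = csum v z"
proof -
  obtain g where g: "g \<in> carrier G" "v = \<phi> g u" using Orb_translate assms(2-4) by blast
  have uv: "u \<in> verts K" "v \<in> verts K" using Orb_orbit assms by blast+
  have zv: "w \<in> verts K" if "w \<in> z" for w using Orb_orbit[OF assms(1) that] by blast
  have b: "bij_betw (\<phi> g) z z" by (rule act_Orb_bij[OF g(1) assms(1)])
  have star: "\<phi> g w \<in> star v \<longleftrightarrow> w \<in> star u" if "w \<in> verts K" for w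
  proof -
    have "image (\<phi> g) ` {Q. Q \<in> K \<and> u \<in> Q \<and> w \<in> Q} = {Q. Q \<in> K \<and> v \<in> Q \<and> \<phi> g w \<in> Q}"
      unfolding g(2) by (rule bij_betw_imp_surj_on[OF act_cube_bij[OF g(1) uv(1) that]])
    from this[symmetric] have "{Q. Q \<in> K \<and> v \<in> Q \<and> \<phi> g w \<in> Q} = {} \<longleftrightarrow> {Q. Q \<in> K \<and> u \<in> Q \<and> w \<in> Q} = {}"
      by (simp only: image_is_empty)
    then show ?thesis unfolding in_common_cube_def by auto
  qed
  have "bij_betw (\<phi> g) {w \<in> z. w \<in> star u} {w \<in> z. w \<in> star v}"
    by (rule bij_betw_filter[OF b]) (use star zv in blast)
  then have "bij_betw (\<phi> g) (z \<inter> star u) (z \<inter> star v)" by (simp only: Int_def)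
  then have "csum v z = (\<Sum>w\<in>z \<inter> star u. c_coeff K v (\<phi> g w))"
    unfolding csum_def by (rule sum.reindex_bij_betw[symmetric])
  also have "\<dots> = csum u z" unfolding csum_def g(2)
    by (rule sum.cong) (use act_c_coeff[OF g(1) uv(1)] zv in auto)
  finally show ?thesis ..
qed

lemma sum_orbits:
  assumes O: "finite Orb" and B: "finite B" "B \<subseteq> verts K"
  shows "(\<Sum>y\<in>Orb. \<Sum>y'\<in>y \<inter> B. f y') = sum f B"
proof -
  have "B = (\<Union>y\<in>Orb. y \<inter> B)" using Orb_cover B by blast
  then have "sum f B = sum f (\<Union>y\<in>Orb. y \<inter> B)" by simp
  also have "\<dots> = (\<Sum>y\<in>Orb. \<Sum>y'\<in>y \<inter> B. f y')"
    by (rule sum.UNION_disjoint) (use O B Orb_disjoint in auto)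
  finally show ?thesis ..
qed

lemma rep_in_iff: "x \<in> Orb \<Longrightarrow> z \<in> Orb \<Longrightarrow> orbit_rep x \<in> z \<longleftrightarrow> x = z"
  using Orb_disjoint Orb_rep by blast

lemma left_inverse:
  assumes O: "finite Orb" and x: "x \<in> Orb" and z: "z \<in> Orb"
  shows "(\<Sum>y\<in>Orb. c_bar K x y * orbit_growth_series G K \<phi> y z) = (if x = z then 1 else 0)"
proof -
  define u where "u = orbit_rep x"
  have u: "u \<in> verts K" using Orb_rep_verts[OF x] by (simp add: u_def)
  have zK: "z \<subseteq> verts K" using Orb_orbit[OF z] by blast
  have fs: "finite (star u)" "star u \<subseteq> verts K" using finite_star[OF u] star_verts by auto
  have "(\<Sum>y\<in>Orb. c_bar K x y * orbit_growth_series G K \<phi> y z) =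
     (\<Sum>y\<in>Orb. \<Sum>y'\<in>y \<inter> star u. c_coeff K u y' * growth y' z)"
  proof (rule sum.cong[OF HOL.refl])
    fix y assume y: "y \<in> Orb"
    have "growth (orbit_rep y) z = growth y' z" if "y' \<in> y" for y'
      by (rule growth_orbit[OF z y Orb_rep[OF y] that])
    then show "c_bar K x y * orbit_growth_series G K \<phi> y z = (\<Sum>y'\<in>y \<inter> star u. c_coeff K u y' * growth y' z)"
      unfolding c_bar_eq[OF x] orbit_growth_series_eq[OF z] csum_def u_def[symmetric] sum_distrib_right
      by (intro sum.cong) auto
  qed
  also have "\<dots> = (\<Sum>y'\<in>star u. c_coeff K u y' * growth y' z)" by (rule sum_orbits[OF O fs])
  also have "\<dots> = (if x = z then 1 else 0)"
  proof (rule fps_ext)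
    fix n
    \<comment> \<open>With \<open>M\<close> bounding the star of \<open>u\<close>, the triangle
      inequality puts all points of \<open>z\<close> within distance \<open>n\<close> of any vertex
      of the star into the one finite set \<open>B\<close>.\<close>
    define M where "M = Max (insert 0 (vdist K u ` star u))"
    have M: "vdist K u y' \<le> M" if "y' \<in> star u" for y' unfolding M_def using fs that by (intro Max_ge) auto
    define B where "B = {z' \<in> z. vdist K u z' \<le> M + n}"
    have fB: "finite B" by (rule finite_subset[OF _ finite_vball[OF u, of "M + n"]]) (use zK in \<open>auto simp: B_def\<close>)
    have tr: "fps_nth (growth y' z) k = fps_nth (\<Sum>z'\<in>B. fps_X ^ vdist K y' z') k" if y': "y' \<in> star u" and k: "k \<le> n" for y' k
    proof (rule growth_truncate[OF _ fB _ _ k])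
      show y'K: "y' \<in> verts K" using y' fs by blast
      show "z' \<in> B" if "z' \<in> z" "vdist K y' z' \<le> n" for z'
        using vdist_triangle[OF u y'K, of z'] M[OF y'] that zK by (auto simp: B_def)
    qed (auto simp: B_def)
    have "fps_nth (\<Sum>y'\<in>star u. c_coeff K u y' * growth y' z) n =
      (\<Sum>y'\<in>star u. fps_nth (c_coeff K u y' * (\<Sum>z'\<in>B. fps_X ^ vdist K y' z')) n)"
      unfolding fps_sum_nth by (rule sum.cong[OF HOL.refl]) (rule fps_mult_nth_cong(2)[OF tr])
    also have "\<dots> = fps_nth (\<Sum>y'\<in>star u. \<Sum>z'\<in>B. c_coeff K u y' * fps_X ^ vdist K z' y') n"
      by (simp add: fps_sum_nth sum_distrib_left vdist_commute)
    also have "(\<Sum>y'\<in>star u. \<Sum>z'\<in>B. c_coeff K u y' * fps_X ^ vdist K z' y') =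
       (\<Sum>z'\<in>B. \<Sum>y'\<in>star u. c_coeff K u y' * fps_X ^ vdist K z' y')"
      by (rule sum.swap)
    also have "\<dots> = (\<Sum>z'\<in>B. if u = z' then 1 else 0)"
      by (rule sum.cong[OF HOL.refl], rule local_inverse) (use zK u in \<open>auto simp: B_def\<close>)
    also have "\<dots> = (if u \<in> B then 1 else 0)" using fB by simp
    also have "u \<in> B \<longleftrightarrow> x = z" using rep_in_iff[OF x z] by (auto simp: B_def u_def)
    finally show "fps_nth (\<Sum>y'\<in>star u. c_coeff K u y' * growth y' z) n = fps_nth (if x = z then 1 else 0) n" .
  qed
  finally show ?thesis .
qed

text \<open>Symmetry of \<open>c_coeff\<close> reduces this to the same local identity: after
  exchanging sums, \<open>u\<close> is the vertex from which distances are measured, and the star is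
  that of a vertex of \<open>z\<close>.\<close>

lemma right_inverse:
  assumes O: "finite Orb" and x: "x \<in> Orb" and z: "z \<in> Orb"
  shows "(\<Sum>y\<in>Orb. orbit_growth_series G K \<phi> x y * c_bar K y z) = (if x = z then 1 else 0)"
proof (rule fps_ext)
  fix n
  define u where "u = orbit_rep x"
  have u: "u \<in> verts K" using Orb_rep_verts[OF x] by (simp add: u_def)
  have zK: "z \<subseteq> verts K" using Orb_orbit[OF z] by blast
  define B where "B = {y' \<in> verts K. vdist K u y' \<le> n}"
  have fB: "finite B" "B \<subseteq> verts K" using finite_vball[OF u] by (auto simp: B_def)
  \<comment> \<open>Only vertices of \<open>z\<close> in a cube with some vertex of the ball
    \<open>B\<close> occur; this makes both ranges finite before the sums are exchanged.\<close>
  define Z where "Z = z \<inter> (\<Union>y'\<in>B. star y')"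
  have fZ: "finite Z" unfolding Z_def using fB finite_star by auto
  have ZK: "Z \<subseteq> verts K" using zK by (auto simp: Z_def)
  let ?X = "\<lambda>y'. fps_X ^ vdist K u y' :: rat fps"
  have "fps_nth (orbit_growth_series G K \<phi> x y * c_bar K y z) n = fps_nth (\<Sum>y'\<in>y \<inter> B. ?X y' * csum y' z) n"
    if y: "y \<in> Orb" for y
  proof -
    have yK: "y \<subseteq> verts K" using Orb_orbit[OF y] by blast
    have tr: "fps_nth (growth u y) k = fps_nth (\<Sum>y'\<in>y \<inter> B. ?X y') k" if k: "k \<le> n" for k
      by (rule growth_truncate[OF u _ _ _ k]) (use fB yK in \<open>auto simp: B_def\<close>)
    have "orbit_growth_series G K \<phi> x y * c_bar K y z = growth u y * csum (orbit_rep y) z"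
      unfolding orbit_growth_series_eq[OF y] c_bar_eq[OF y] u_def ..
    also have "fps_nth \<dots> n = fps_nth ((\<Sum>y'\<in>y \<inter> B. ?X y') * csum (orbit_rep y) z) n"
      by (rule fps_mult_nth_cong(1)[OF tr])
    also have "(\<Sum>y'\<in>y \<inter> B. ?X y') * csum (orbit_rep y) z = (\<Sum>y'\<in>y \<inter> B. ?X y' * csum y' z)"
      unfolding sum_distrib_right
      by (rule sum.cong[OF HOL.refl]) (use csum_orbit[OF z y Orb_rep[OF y]] in auto)
    finally show ?thesis .
  qed
  then have "fps_nth (\<Sum>y\<in>Orb. orbit_growth_series G K \<phi> x y * c_bar K y z) n =
     fps_nth (\<Sum>y\<in>Orb. \<Sum>y'\<in>y \<inter> B. ?X y' * csum y' z) n"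
    unfolding fps_sum_nth by (intro sum.cong) auto
  also have "(\<Sum>y\<in>Orb. \<Sum>y'\<in>y \<inter> B. ?X y' * csum y' z) = (\<Sum>y'\<in>B. ?X y' * csum y' z)"
    by (rule sum_orbits[OF O fB])
  also have "\<dots> = (\<Sum>y'\<in>B. \<Sum>z' | z' \<in> Z \<and> in_common_cube K y' z'. ?X y' * c_coeff K y' z')"
    unfolding csum_def sum_distrib_left by (rule sum.cong[OF HOL.refl], rule sum.cong) (auto simp: Z_def)
  also have "\<dots> = (\<Sum>z'\<in>Z. \<Sum>y' | y' \<in> B \<and> in_common_cube K y' z'. ?X y' * c_coeff K y' z')"
    by (rule sum.swap_restrict[OF fB(1) fZ])
  \<comment> \<open>Completing the inner sum to the full star adds only vertices farther than
    \<open>n\<close> from \<open>u\<close>, whose terms are multiples of a power of t above the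
    \<open>n\<close>-th.\<close>
  also have "fps_nth \<dots> n = fps_nth (\<Sum>z'\<in>Z. \<Sum>y'\<in>star z'. c_coeff K z' y' * ?X y') n"
    unfolding fps_sum_nth
  proof (rule sum.cong[OF HOL.refl])
    fix z' assume z': "z' \<in> Z"
    have fs: "finite (star z')" "star z' \<subseteq> verts K" using finite_star star_verts ZK z' by auto
    have "(\<Sum>y'\<in>star z'. fps_nth (c_coeff K z' y' * ?X y') n) =
      (\<Sum>y' | y' \<in> B \<and> in_common_cube K y' z'. fps_nth (c_coeff K z' y' * ?X y') n)"
    proof (rule sum.mono_neutral_right[OF fs(1)])
      show "{y'. y' \<in> B \<and> in_common_cube K y' z'} \<subseteq> star z'" using star_commute by auto
      show "\<forall>i\<in>star z' - {y'. y' \<in> B \<and> in_common_cube K y' z'}. fps_nth (c_coeff K z' i * ?X i) n = 0"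
      proof
        fix i assume i: "i \<in> star z' - {y'. y' \<in> B \<and> in_common_cube K y' z'}"
        then have "\<not> vdist K u i \<le> n" using fs star_commute by (auto simp: B_def)
        then show "fps_nth (c_coeff K z' i * ?X i) n = 0" by (simp add: fps_X_power_mult_right_nth)
      qed
    qed
    then show "(\<Sum>y' | y' \<in> B \<and> in_common_cube K y' z'. fps_nth (?X y' * c_coeff K y' z') n) =
      (\<Sum>y'\<in>star z'. fps_nth (c_coeff K z' y' * ?X y') n)"
      by (simp add: mult.commute c_coeff_commute[of z'])
  qed
  also have "(\<Sum>z'\<in>Z. \<Sum>y'\<in>star z'. c_coeff K z' y' * ?X y') = (\<Sum>z'\<in>Z. if z' = u then 1 else 0)"
    by (rule sum.cong[OF HOL.refl], rule local_inverse[OF u]) (use ZK in auto)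
  also have "\<dots> = (if u \<in> Z then 1 else 0)" using fZ by simp
  also have "u \<in> Z \<longleftrightarrow> x = z"
  proof -
    have "u \<in> B" using u by (simp add: B_def)
    moreover have "u \<in> star u" using u by (auto simp: in_common_cube_def verts_def)
    ultimately show ?thesis using rep_in_iff[OF x z] by (auto simp: Z_def u_def)
  qed
  finally show "fps_nth (\<Sum>y\<in>Orb. orbit_growth_series G K \<phi> x y * c_bar K y z) n = fps_nth (if x = z then 1 else 0) n" .
qed

end

section \<open>From the CAT(0) hypothesis to the combinatorial one\<close>

lemma (in cat0_cubical) locally_finite_flag: "locally_finite_flag K"
proof -
  interpret flag_cubical K
    by unfold_locales (rule flag)
  show ?thesis
  proof (intro_locales, unfold_locales)
    show "(x, y) \<in> E\<^sup>*" if "x \<in> verts K" "y \<in> verts K" for x y by (rule connected[OF that])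
    fix S :: "'v \<Rightarrow> 'v list set" and \<tau> z a R
    assume S: "z \<in> verts K" "a \<in> S z"
      "\<And>u v a. (u, v) \<in> E \<Longrightarrow> a \<in> S u \<Longrightarrow> \<tau> u v a \<in> S v \<and> \<tau> v u (\<tau> u v a) = a"
      "\<And>x u y w a. sq K x u y w \<Longrightarrow> a \<in> S x \<Longrightarrow> \<tau> u y (\<tau> x u a) = \<tau> w y (\<tau> x w a)"
    have "local_system K S \<tau>" by unfold_locales (use S(3,4) in blast)+
    then show "\<exists>s. s z = a \<and> (\<forall>u v. (u, v) \<in> E \<longrightarrow> vdist K z u \<le> R \<longrightarrow> vdist K z v \<le> R \<longrightarrow> s v = \<tau> u v (s u))"
      using S(1,2) by (rule sections)
  qed
qed

theorem theorem4:
  fixes K :: "'v set set"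
    and G :: "('g, 'm) monoid_scheme"
    and \<phi> :: "'g \<Rightarrow> 'v \<Rightarrow> 'v"
  assumes "CAT0_cubical_complex K"
    and "locally_finite_complex K"
    and "cellular_action G K \<phi>"
    and "cocompact_action G K \<phi>"
  shows "finite (vert_orbits G K \<phi>) \<and>
    (\<forall>x\<in>vert_orbits G K \<phi>. \<forall>z\<in>vert_orbits G K \<phi>.
       (\<Sum>y\<in>vert_orbits G K \<phi>. c_bar K x y * orbit_growth_series G K \<phi> y z) =
         (if x = z then 1 else 0) \<and>
       (\<Sum>y\<in>vert_orbits G K \<phi>. orbit_growth_series G K \<phi> x y * c_bar K y z) =
         (if x = z then 1 else 0))"
proof -
  interpret X: cat0_cubical K
    using assms(1,2) by unfold_locales (auto simp: CAT0_cubical_complex_def)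
  interpret A: flag_action K G \<phi>
    using X.locally_finite_flag assms(3)
    by (auto simp: flag_action_def flag_action_axioms_def cellular_action_def)
  have "finite (vert_orbits G K \<phi>)" by (rule X.finite_vert_orbits[OF assms(3,4)])
  then show ?thesis using A.left_inverse A.right_inverse by blast
qed

end
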